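(* Let $n\ge 2$, let $\|\cdot\|$ be an arbitrary norm on $\mathbb{R}^n$ with dual norm $\|\cdot\|_*$, and let $e=(1,0)\in\mathbb{R}\times\mathbb{R}^{n-1}$. For any $a\ge n>p>1$, the inequality $$\Big(\int_{\partial\mathbb{R}^n_+} f^{p\frac{a-1}{a-p}}\,dx\Big)^{\frac{a-p}{p(a-1)}}\le D_{n,p,a}\Big(\int_{\mathbb{R}^n_+}\|\nabla f\|_*^p\,dz\Big)^{\frac{\theta}{p}}\Big(\int_{\mathbb{R}^n_+} f^{p\frac{a-1}{a-p}}\,dz\Big)^{(1-\theta)\frac{a-p}{p(a-1)}}$$ holds for any smooth nonnegative function $f$ on $\mathbb{R}^n_+$ such that the quantities involved are well defined (all integrals finite). Here $\theta\in[0,1]$ is the unique parameter satisfying $$\frac{n-1}{n}\,\frac{a-p}{a-1}=\theta\,\frac{n-p}{n}+(1-\theta)\,\frac{a-p}{a-1},$$ and $D_{n,p,a}$ is the optimal constant, reached (i.e. equality holds) when $$f(z)=h_p(z)=\|z+e\|^{-\frac{a-p}{p-1}},\qquad z\in\mathbb{R}^n_+.$$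
   Context: $\mathbb{R}^n_+=\{z=(u,x): u\ge 0,\ x\in\mathbb{R}^{n-1}\}$ and $\partial\mathbb{R}^n_+=\{(0,x): x\in\mathbb{R}^{n-1}\}$, identified with $\mathbb{R}^{n-1}$. Integrals over $\mathbb{R}^n_+$ and $\partial\mathbb{R}^n_+$ are with respect to $n$-dimensional, respectively $(n-1)$-dimensional, Lebesgue measure. The dual norm is $\|y\|_*=\sup_{\|x\|\le1}x\cdot y$. *)

theory Defs
  imports "HOL-Analysis.Analysis"
begin

text \<open>The space of dimension \<open>n\<close> is \<^typ>\<open>real \<times> (real ^ 'm)\<close> with \<open>n = 1 + CARD('m)\<close>. As index types
  are nonempty, \<open>n \<ge> 2\<close>, and every \<open>n \<ge> 2\<close> occurs. The inner product of the product type is the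
  standard one, and \<^term>\<open>lebesgue\<close> is the Lebesgue measure of the corresponding dimension.\<close>

definition is_norm :: "('a::real_vector \<Rightarrow> real) \<Rightarrow> bool" where
  "is_norm N \<longleftrightarrow>
     (\<forall>x. 0 \<le> N x) \<and> (\<forall>x. N x = 0 \<longleftrightarrow> x = 0) \<and>
     (\<forall>c x. N (c *\<^sub>R x) = \<bar>c\<bar> * N x) \<and> (\<forall>x y. N (x + y) \<le> N x + N y)"

definition dual_norm :: "('a::real_inner \<Rightarrow> real) \<Rightarrow> 'a \<Rightarrow> real" where
  "dual_norm N y = (SUP x\<in>{x. N x \<le> 1}. x \<bullet> y)"

definition halfspace :: "(real \<times> (real ^ 'm)) set" where
  "halfspace = {(u, x). 0 \<le> u}"

fun C_k_on :: "nat \<Rightarrow> ('a::euclidean_space \<Rightarrow> real) \<Rightarrow> 'a set \<Rightarrow> bool" where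
  "C_k_on 0 f U \<longleftrightarrow> continuous_on U f"
| "C_k_on (Suc k) f U \<longleftrightarrow>
     (\<forall>x\<in>U. f differentiable (at x)) \<and>
     (\<forall>v. C_k_on k (\<lambda>x. frechet_derivative f (at x) v) U)"

text \<open>Smoothness up to the boundary: a function on a closed set is smooth if it is the restriction
  of a smooth function on an open neighbourhood. Values off the set are irrelevant.\<close>

definition smooth_on :: "'a::euclidean_space set \<Rightarrow> ('a \<Rightarrow> real) \<Rightarrow> bool" where
  "smooth_on S f \<longleftrightarrow>
     (\<exists>U g. open U \<and> S \<subseteq> U \<and> (\<forall>k. C_k_on k g U) \<and> (\<forall>z\<in>S. f z = g z))"

text \<open>The gradient is unspecified where \<open>f\<close> is not differentiable. In the integrals below this
  concerns a null set only: the boundary of the half-space (where it may depend on the values of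
  \<open>f\<close> outside) and, for the extremal function, the points where the norm is not differentiable.\<close>

definition gradient :: "('a::real_inner \<Rightarrow> real) \<Rightarrow> 'a \<Rightarrow> 'a" where
  "gradient f z = (THE D. GDERIV f z :> D)"

definition theta_equation :: "nat \<Rightarrow> real \<Rightarrow> real \<Rightarrow> real \<Rightarrow> bool" where
  "theta_equation n p a \<theta> \<longleftrightarrow>
     (real n - 1) / real n * ((a - p) / (a - 1)) =
       \<theta> * ((real n - p) / real n) + (1 - \<theta>) * ((a - p) / (a - 1))"

text \<open>Bochner integrals of non-integrable functions are \<open>0\<close>, so finiteness of the
  integrals is required explicitly.\<close>

definition well_defined ::
  "(real \<times> (real ^ 'm) \<Rightarrow> real) \<Rightarrow> real \<Rightarrow> real \<Rightarrow> (real \<times> (real ^ 'm) \<Rightarrow> real) \<Rightarrow> bool" where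
  "well_defined N p a f \<longleftrightarrow>
     (AE z in lebesgue. z \<in> halfspace \<longrightarrow> f differentiable (at z)) \<and>
     integrable lebesgue (\<lambda>x. f (0, x) powr (p * ((a - 1) / (a - p)))) \<and>
     set_integrable lebesgue halfspace (\<lambda>z. dual_norm N (gradient f z) powr p) \<and>
     set_integrable lebesgue halfspace (\<lambda>z. f z powr (p * ((a - 1) / (a - p))))"

definition trace_term :: "real \<Rightarrow> real \<Rightarrow> (real \<times> (real ^ 'm) \<Rightarrow> real) \<Rightarrow> real" where
  "trace_term p a f =
     (LINT x|lebesgue. f (0, x) powr (p * ((a - 1) / (a - p)))) powr ((a - p) / (p * (a - 1)))"

definition gradient_term ::
  "(real \<times> (real ^ 'm) \<Rightarrow> real) \<Rightarrow> real \<Rightarrow> real \<Rightarrow> (real \<times> (real ^ 'm) \<Rightarrow> real) \<Rightarrow> real" where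
  "gradient_term N p \<theta> f =
     (LINT z:halfspace|lebesgue. dual_norm N (gradient f z) powr p) powr (\<theta> / p)"

text \<open>For \<open>\<theta> = 1\<close> the exponent here is \<open>0\<close>, and \<open>0 powr 0 = 0\<close>. This convention only affects
  functions vanishing almost everywhere on the half-space.\<close>

definition interior_term ::
  "real \<Rightarrow> real \<Rightarrow> real \<Rightarrow> (real \<times> (real ^ 'm) \<Rightarrow> real) \<Rightarrow> real" where
  "interior_term p a \<theta> f =
     (LINT z:halfspace|lebesgue. f z powr (p * ((a - 1) / (a - p))))
       powr ((1 - \<theta>) * ((a - p) / (p * (a - 1))))"

definition trace_GN_inequality ::
  "(real \<times> (real ^ 'm) \<Rightarrow> real) \<Rightarrow> real \<Rightarrow> real \<Rightarrow> real \<Rightarrow> real \<Rightarrow> bool" where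
  "trace_GN_inequality N p a \<theta> D \<longleftrightarrow>
     (\<forall>f. smooth_on halfspace f \<longrightarrow> (\<forall>z\<in>halfspace. 0 \<le> f z) \<longrightarrow> well_defined N p a f \<longrightarrow>
        trace_term p a f \<le> D * gradient_term N p \<theta> f * interior_term p a \<theta> f)"

definition extremal ::
  "(real \<times> (real ^ 'm) \<Rightarrow> real) \<Rightarrow> real \<Rightarrow> real \<Rightarrow> real \<times> (real ^ 'm) \<Rightarrow> real" where
  "extremal N p a z = N (z + (1, 0)) powr (- ((a - p) / (p - 1)))"

end

(*
Let rho = f^(pa/(a-p)) and W = c N^q/q with q = p/(p-1). Transport rho onto W^(-a), restricted to the shifted
half-space {u >= 1}, by a triangular map T with diagonal derivatives T_1', ..., T_n'. The arithmetic-geometric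
mean inequality for T_1', ..., T_n' and a further weight a - n turns the change of variables formula into a
bound for the integral of W^(1-a). Integration by parts produces the boundary integral with a factor at least 1,
because T takes its values in {u >= 1}, and Young's inequality bounds -grad(f^r).T by the gradient term. No
n-dimensional map is needed: everything is carried out one coordinate at a time on iterated integrals, where
each step is a one-dimensional monotone transport. Finally two free scales, of f and of the domain, are optimised.

The extremal function corresponds to T(z) = z + e. It need not be smooth, so optimality is shown by replacing N
by an l^k-combination of finitely many linear functionals that almost norm it.
*)
theory Submission
  imports Defs
begin

section \<open>One-dimensional monotone transport\<close>

text \<open>Why no map has to be built: the triangular (Knothe) map enters only through its diagonal
  derivatives and through the values of each component along its own coordinate. Off-diagonal
  derivatives and regularity in the earlier coordinates never matter. Once a coordinate is treated,
  all that survives is a pair of slices \<open>(t, v)\<close>, the accumulated Jacobian factor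
  \<open>\<Lambda>\<close> and the accumulated trace \<open>s\<close>. So the induction hypothesis
  can be an inequality for every pair of slices in mass balance, and a new transport is chosen on
  each pair. The normal coordinate is treated first (outermost): its target interval starts at 1,
  which is the factor of the boundary term. In tangential coordinates \<open>f\<close>, once cut
  off, vanishes at both ends. The mass balance fixes the scale of \<open>W\<close>, so Young's
  inequality bounds the worst case over that scale and only \<open>\<tau>\<close> is chosen. The
  balance \<open>\<tau> powr (1 + \<eta>) = \<gamma> powr \<beta> / \<iota>\<close> is where the
  interpolation exponent \<open>\<theta> = 1 / (1 + \<eta>)\<close> comes from.\<close>

lemma indefinite_integral_inverse:
  fixes \<mu> :: "real \<Rightarrow> real"
  assumes "c < d" "continuous_on {c..d} \<mu>" "\<And>v. v \<in> {c..d} \<Longrightarrow> 0 < \<mu> v"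
  obtains G where "\<And>v. v \<in> {c..d} \<Longrightarrow> G (integral {c..v} \<mu>) = v"
    and "\<And>y. y \<in> {0..integral {c..d} \<mu>} \<Longrightarrow>
        G y \<in> {c..d} \<and> (G has_field_derivative inverse (\<mu> (G y))) (at y)"
proof -
  define \<mu>' where "\<mu>' v = \<mu> (max c (min d v))" for v
  \<comment> \<open>Continuing \<open>\<mu>\<close> by constants beyond \<open>{c..d}\<close> makes
    \<open>c\<close> and \<open>d\<close> interior points, so the inverse has two-sided derivatives
    at the ends of its range as well.\<close>
  define M where "M v = integral {c - 1..v} \<mu>' - integral {c - 1..c} \<mu>'" for v
  define S where "S = {c - 1<..<d + 1}"
  have cont': "continuous_on UNIV \<mu>'"
    unfolding \<mu>'_def
    by (rule continuous_on_compose2[OF assms(2)]) (use assms(1) in \<open>auto intro!: continuous_intros\<close>)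
  have pos': "0 < \<mu>' v" for v
    unfolding \<mu>'_def using assms(1) by (intro assms(3)) auto
  have M': "(M has_field_derivative \<mu>' v) (at v)" if "v \<in> S" for v
  proof -
    have "((\<lambda>x. integral {c - 1..x} \<mu>') has_real_derivative \<mu>' v) (at v within {c - 1..d + 1})"
      using that cont' by (intro integral_has_real_derivative)
        (auto simp: S_def intro: continuous_on_subset)
    then have "((\<lambda>x. integral {c - 1..x} \<mu>') has_real_derivative \<mu>' v) (at v)"
      using that by (subst (asm) at_within_interior) (auto simp: S_def)
    then show ?thesis
      unfolding M_def by (auto intro!: derivative_eq_intros)
  qed
  have M_less: "M u < M v" if "u < v" "u \<in> S" "v \<in> S" for u v
  proof (rule DERIV_pos_imp_increasing[OF that(1)])
    fix x assume "u \<le> x" "x \<le> v"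
    then have "x \<in> S" using that by (auto simp: S_def)
    then show "\<exists>y. (M has_field_derivative y) (at x) \<and> 0 < y" using M' pos' by blast
  qed
  have inj: "inj_on M S"
    by (rule inj_onI) (metis M_less linorder_neqE_linordered_idom order_less_irrefl)
  define G where "G = the_inv_into S M"
  have G: "G (M v) = v" if "v \<in> S" for v
    unfolding G_def using inj that by (rule the_inv_into_f_f)
  have cS: "{c..d} \<subseteq> S" unfolding S_def by auto
  have M_eq: "M v = integral {c..v} \<mu>" if "v \<in> {c..d}" for v
  proof -
    have "integral {c - 1..c} \<mu>' + integral {c..v} \<mu>' = integral {c - 1..v} \<mu>'"
      using that cont' by (intro Henstock_Kurzweil_Integration.integral_combine
         integrable_continuous_real) (auto intro: continuous_on_subset)
    moreover have "integral {c..v} \<mu>' = integral {c..v} \<mu>"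
      using that by (intro integral_cong) (auto simp: \<mu>'_def)
    ultimately show ?thesis by (simp add: M_def)
  qed
  have contM: "continuous_on {c..d} M"
    by (rule DERIV_continuous_on[where D = \<mu>']) (use M' cS in \<open>blast intro: has_field_derivative_at_within\<close>)
  show thesis
  proof (rule that[of G])
    fix v assume "v \<in> {c..d}"
    then show "G (integral {c..v} \<mu>) = v" using G M_eq cS by (metis subsetD)
  next
    fix y assume y: "y \<in> {0..integral {c..d} \<mu>}"
    have "M c = 0" "M d = integral {c..d} \<mu>" using M_eq assms(1) by auto
    then obtain v where v: "v \<in> {c..d}" "M v = y"
      using IVT'[of M c y d] y contM assms(1) by auto
    have Gy: "G y = v" using G v cS by auto
    have "(G has_derivative (*) (inverse (\<mu>' v))) (at (M v))"
    proof (rule has_derivative_inverse_strong[where f = M and x = v])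
      show "(M has_derivative (*) (\<mu>' v)) (at v)"
        using M'[of v] v cS by (auto simp: has_field_derivative_def)
      show "(*) (\<mu>' v) \<circ> (*) (inverse (\<mu>' v)) = id"
        using pos'[of v] by (auto simp: fun_eq_iff)
      show "open S" "v \<in> S" using v cS by (auto simp: S_def)
      show "continuous_on S M"
        by (rule DERIV_continuous_on[where D = \<mu>']) (use M' in \<open>auto intro: has_field_derivative_at_within\<close>)
    qed (use G in auto)
    then have "(G has_field_derivative inverse (\<mu>' v)) (at (M v))"
      by (simp add: has_field_derivative_def)
    moreover have "\<mu>' v = \<mu> v" using v by (auto simp: \<mu>'_def)
    ultimately show "G y \<in> {c..d} \<and> (G has_field_derivative inverse (\<mu> (G y))) (at y)"
      using v Gy by auto
  qed
qed

text \<open>\<open>T\<close> is the inverse of the primitive of \<open>\<mu>\<close>, applied to the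
  primitive of \<open>m\<close> divided by \<open>\<Lambda>\<close>. Only the target density is
  inverted, so \<open>m\<close> may vanish on intervals. For \<open>\<Lambda> = 0\<close> the mass
  condition forces \<open>m = 0\<close> and a constant map serves; this is why
  \<open>T \<beta> = d\<close> is claimed for positive \<open>\<Lambda>\<close> only.\<close>

lemma transport_1d:
  fixes m \<mu> :: "real \<Rightarrow> real"
  assumes ab: "\<alpha> < \<beta>" and cd: "c < d" and \<Lambda>: "0 \<le> \<Lambda>"
    and m: "continuous_on {\<alpha>..\<beta>} m" "\<And>t. t \<in> {\<alpha>..\<beta>} \<Longrightarrow> 0 \<le> m t"
    and \<mu>: "continuous_on {c..d} \<mu>" "\<And>v. v \<in> {c..d} \<Longrightarrow> 0 < \<mu> v"
    and mass: "\<Lambda> * integral {c..d} \<mu> = integral {\<alpha>..\<beta>} m"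
  obtains T T' where
    "\<And>t. t \<in> {\<alpha>..\<beta>} \<Longrightarrow> T t \<in> {c..d} \<and> 0 \<le> T' t \<and> \<Lambda> * T' t * \<mu> (T t) = m t \<and>
        (T has_field_derivative T' t) (at t within {\<alpha>..\<beta>})"
    "continuous_on {\<alpha>..\<beta>} T'" "T \<alpha> = c" "0 < \<Lambda> \<Longrightarrow> T \<beta> = d"
proof (cases "\<Lambda> = 0")
  case True
  then have "integral {\<alpha>..\<beta>} m = 0" using mass by simp
  then have m0: "m t = 0" if "t \<in> {\<alpha>..\<beta>}" for t
    using integral_eq_0_iff[of \<alpha> \<beta> m] m that ab
    by auto
  show thesis
    by (rule that[of "\<lambda>_. c" "\<lambda>_. 0"]) (use True m0 cd in auto)
next
  case False
  then have \<Lambda>: "0 < \<Lambda>" using \<Lambda> by simp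
  obtain G where G: "\<And>v. v \<in> {c..d} \<Longrightarrow> G (integral {c..v} \<mu>) = v"
    "\<And>y. y \<in> {0..integral {c..d} \<mu>} \<Longrightarrow>
        G y \<in> {c..d} \<and> (G has_field_derivative inverse (\<mu> (G y))) (at y)"
    using indefinite_integral_inverse[OF cd \<mu>] by blast
  define S where "S t = integral {\<alpha>..t} m / \<Lambda>" for t
  have int: "m integrable_on {s..t}" if "\<alpha> \<le> s" "t \<le> \<beta>" for s t
    using that by (intro integrable_continuous_real) (auto intro: continuous_on_subset[OF m(1)])
  have S: "S t \<in> {0..integral {c..d} \<mu>}" if t: "t \<in> {\<alpha>..\<beta>}" for t
  proof -
    have "integral {\<alpha>..t} m \<ge> 0" "integral {\<alpha>..t} m \<le> integral {\<alpha>..\<beta>} m"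
      using t m int by (auto intro!: Henstock_Kurzweil_Integration.integral_nonneg integral_subset_le)
    then show ?thesis using \<Lambda> mass by (auto simp: S_def field_simps)
  qed
  have S': "(S has_field_derivative m t / \<Lambda>) (at t within {\<alpha>..\<beta>})" if t: "t \<in> {\<alpha>..\<beta>}" for t
    unfolding S_def
    by (rule DERIV_cdivide[OF integral_has_real_derivative[OF m(1) t]])
  define T where "T t = G (S t)" for t
  define T' where "T' t = inverse (\<mu> (T t)) * (m t / \<Lambda>)" for t
  have T: "T t \<in> {c..d}" if "t \<in> {\<alpha>..\<beta>}" for t
    using S[OF that] G(2) by (auto simp: T_def)
  have T'T: "(T has_field_derivative T' t) (at t within {\<alpha>..\<beta>})" if "t \<in> {\<alpha>..\<beta>}" for t
    unfolding T'_def T_def using DERIV_chain2[OF _ S'[OF that]] G(2)[OF S[OF that]] by blast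
  have contT: "continuous_on {\<alpha>..\<beta>} T"
    using T'T by (rule DERIV_continuous_on)
  show thesis
  proof (rule that)
    show "T t \<in> {c..d} \<and> 0 \<le> T' t \<and> \<Lambda> * T' t * \<mu> (T t) = m t \<and>
        (T has_field_derivative T' t) (at t within {\<alpha>..\<beta>})" if "t \<in> {\<alpha>..\<beta>}" for t
      using T[OF that] T'T[OF that] m(2)[OF that] \<mu>(2)[OF T[OF that]] \<Lambda>
      by (auto simp: T'_def)
    show "continuous_on {\<alpha>..\<beta>} T'"
    proof -
      have "continuous_on {\<alpha>..\<beta>} (\<lambda>t. \<mu> (T t))"
        by (rule continuous_on_compose2[OF \<mu>(1) contT]) (use T in auto)
      then show ?thesis unfolding T'_def using m(1) \<Lambda> \<mu>(2) T
        by (intro continuous_intros) (auto simp: less_le)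
    qed
    show "T \<alpha> = c" using G(1)[of c] cd by (simp add: T_def S_def)
    have "S \<beta> = integral {c..d} \<mu>" using mass \<Lambda> by (simp add: S_def field_simps)
    then show "T \<beta> = d" using G(1)[of d] cd by (simp add: T_def)
  qed
qed

text \<open>One coordinate of the induction. \<open>H\<close> will be used at \<open>v = T t\<close>
  and \<open>x = T' t\<close>; quantifying over all \<open>v\<close> and \<open>x\<close> in mass
  balance keeps \<open>T\<close> out of the statement. The terms \<open>T' * \<Phi>\<close> and
  \<open>T * \<Phi>'\<close> add up to the derivative of \<open>T * \<Phi>\<close>, whose integral
  is \<open>- c * \<Phi> \<alpha>\<close> because \<open>\<Phi> \<beta> = 0\<close>.\<close>

lemma transport_step:
  fixes m \<mu> J \<Phi> \<Phi>' k :: "real \<Rightarrow> real"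
  assumes ab: "\<alpha> < \<beta>" and cd: "c < d" and \<Lambda>: "0 \<le> \<Lambda>"
    and m: "continuous_on {\<alpha>..\<beta>} m" "\<And>t. t \<in> {\<alpha>..\<beta>} \<Longrightarrow> 0 \<le> m t"
    and \<mu>: "continuous_on {c..d} \<mu>" "\<And>v. v \<in> {c..d} \<Longrightarrow> 0 < \<mu> v"
    and mass: "\<Lambda> * integral {c..d} \<mu> = integral {\<alpha>..\<beta>} m"
    and J: "continuous_on {\<alpha>..\<beta>} J" and k: "continuous_on {c..d} k"
    and \<Phi>': "continuous_on {\<alpha>..\<beta>} \<Phi>'"
    and \<Phi>: "\<And>t. t \<in> {\<alpha>..\<beta>} \<Longrightarrow> (\<Phi> has_field_derivative \<Phi>' t) (at t within {\<alpha>..\<beta>})" "\<Phi> \<beta> = 0"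
    and H: "\<And>t v x. t \<in> {\<alpha>..\<beta>} \<Longrightarrow> v \<in> {c..d} \<Longrightarrow> 0 \<le> x \<Longrightarrow> \<Lambda> * x * \<mu> v = m t \<Longrightarrow>
       \<Lambda> * x * k v - (s + x) * \<Phi> t \<le> J t + v * \<Phi>' t"
  shows "\<Lambda> * integral {c..d} k - s * integral {\<alpha>..\<beta>} \<Phi> + c * \<Phi> \<alpha> \<le> integral {\<alpha>..\<beta>} J"
proof -
  obtain T T' where T:
    "\<And>t. t \<in> {\<alpha>..\<beta>} \<Longrightarrow> T t \<in> {c..d} \<and> 0 \<le> T' t \<and> \<Lambda> * T' t * \<mu> (T t) = m t \<and>
        (T has_field_derivative T' t) (at t within {\<alpha>..\<beta>})"
    "continuous_on {\<alpha>..\<beta>} T'" "T \<alpha> = c" "0 < \<Lambda> \<Longrightarrow> T \<beta> = d"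
    using transport_1d[OF ab cd \<Lambda> m \<mu> mass] by blast
  have contT: "continuous_on {\<alpha>..\<beta>} T" using T(1) by (blast intro: DERIV_continuous_on)
  have cont\<Phi>: "continuous_on {\<alpha>..\<beta>} \<Phi>" using \<Phi>(1) by (rule DERIV_continuous_on)
  \<comment> \<open>For \<open>\<Lambda> = 0\<close> the map need not reach \<open>d\<close>, but
    then both sides vanish.\<close>
  have subst: "\<Lambda> * integral {c..d} k = \<Lambda> * integral {\<alpha>..\<beta>} (\<lambda>t. T' t * k (T t))"
  proof (cases "\<Lambda> = 0")
    case False
    then have "0 < \<Lambda>" using \<Lambda> by simp
    then have "((\<lambda>t. T' t *\<^sub>R k (T t)) has_integral integral {T \<alpha>..T \<beta>} k) {\<alpha>..\<beta>}"
      using T(1,3,4) cd by (intro has_integral_substitution[OF less_imp_le[OF ab] _ _ k]) auto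
    then show ?thesis using T(3,4) \<open>0 < \<Lambda>\<close> by (auto simp: has_integral_iff)
  qed auto
  have kT: "continuous_on {\<alpha>..\<beta>} (\<lambda>t. k (T t))"
    by (rule continuous_on_compose2[OF k contT]) (use T in auto)
  have ibp: "((\<lambda>t. T' t * \<Phi> t + T t * \<Phi>' t) has_integral (T \<beta> * \<Phi> \<beta> - T \<alpha> * \<Phi> \<alpha>)) {\<alpha>..\<beta>}"
  proof (rule fundamental_theorem_of_calculus[OF less_imp_le[OF ab]])
    fix t assume "t \<in> {\<alpha>..\<beta>}"
    then have "((\<lambda>t. T t * \<Phi> t) has_field_derivative T' t * \<Phi> t + T t * \<Phi>' t) (at t within {\<alpha>..\<beta>})"
      using T(1) \<Phi>(1) by (auto intro!: derivative_eq_intros)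
    then show "((\<lambda>t. T t * \<Phi> t) has_vector_derivative T' t * \<Phi> t + T t * \<Phi>' t) (at t within {\<alpha>..\<beta>})"
      by (simp add: has_real_derivative_iff_has_vector_derivative)
  qed
  have "integral {\<alpha>..\<beta>} (\<lambda>t. \<Lambda> * (T' t * k (T t)) - s * \<Phi> t - (T' t * \<Phi> t + T t * \<Phi>' t))
      \<le> integral {\<alpha>..\<beta>} J"
  proof (rule integral_le)
    show "(\<lambda>t. \<Lambda> * (T' t * k (T t)) - s * \<Phi> t - (T' t * \<Phi> t + T t * \<Phi>' t)) integrable_on {\<alpha>..\<beta>}"
      by (intro integrable_continuous_real continuous_intros contT kT cont\<Phi> \<Phi>' T)
    show "J integrable_on {\<alpha>..\<beta>}" by (rule integrable_continuous_real[OF J])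
    fix t assume "t \<in> {\<alpha>..\<beta>}"
    then show "\<Lambda> * (T' t * k (T t)) - s * \<Phi> t - (T' t * \<Phi> t + T t * \<Phi>' t) \<le> J t"
      using H[of t "T t" "T' t"] T(1)[of t] by (auto simp: algebra_simps)
  qed
  also have "integral {\<alpha>..\<beta>} (\<lambda>t. \<Lambda> * (T' t * k (T t)) - s * \<Phi> t - (T' t * \<Phi> t + T t * \<Phi>' t))
     = \<Lambda> * integral {\<alpha>..\<beta>} (\<lambda>t. T' t * k (T t)) - s * integral {\<alpha>..\<beta>} \<Phi> - (T \<beta> * \<Phi> \<beta> - T \<alpha> * \<Phi> \<alpha>)"
    using ibp
    by (subst Henstock_Kurzweil_Integration.integral_diff,
        (intro integrable_continuous_real continuous_intros contT kT cont\<Phi> \<Phi>' T)+,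
        subst Henstock_Kurzweil_Integration.integral_diff,
        (intro integrable_continuous_real continuous_intros contT kT cont\<Phi> \<Phi>' T)+)
       (auto simp: has_integral_iff)
  finally show ?thesis using subst T(3) \<Phi>(2) by auto
qed

text \<open>The induction invariant: \<open>\<Lambda>\<close> is the product of the derivatives of the transports in the coordinates
  already treated (times a constant), \<open>s\<close> is their sum plus the remaining weight, and \<open>k\<close> coordinates
  are left.\<close>

fun amgm_cond :: "real \<Rightarrow> nat \<Rightarrow> real \<Rightarrow> real \<Rightarrow> bool" where
  "amgm_cond a 0 s \<Lambda> \<longleftrightarrow> a * \<Lambda> powr (1 / a) \<le> s"
| "amgm_cond a (Suc k) s \<Lambda> \<longleftrightarrow> (\<forall>x\<ge>0. amgm_cond a k (s + x) (\<Lambda> * x))"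

text \<open>Unrolls the recursion: \<open>xs\<close> lists the diagonal derivatives still to
  come.\<close>

lemma amgm_condI:
  assumes "\<And>xs. length xs = k \<Longrightarrow> (\<forall>x\<in>set xs. 0 \<le> x) \<Longrightarrow>
     a * (\<Lambda> * prod_list xs) powr (1 / a) \<le> s + sum_list xs"
  shows "amgm_cond a k s \<Lambda>"
  using assms
proof (induction k arbitrary: s \<Lambda>)
  case 0
  then show ?case using "0"[of "[]"] by simp
next
  case (Suc k)
  show ?case
  proof (simp, intro allI impI, rule Suc.IH)
    fix x :: real and xs :: "real list"
    assume "0 \<le> x" "length xs = k" "\<forall>x\<in>set xs. 0 \<le> x"
    then show "a * (\<Lambda> * x * prod_list xs) powr (1 / a) \<le> s + x + sum_list xs"
      using Suc.prems[of "x # xs"] by (simp add: algebra_simps)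
  qed
qed

text \<open>Sum over \<open>xs\<close> of the tangent line bound
  \<open>ln x \<le> ln A + x / A - 1\<close> of the concave logarithm at \<open>A\<close>.\<close>

lemma ln_prod_list_le:
  assumes "\<forall>x\<in>set xs. 0 < x" "0 < A"
  shows "0 < prod_list xs \<and> ln (prod_list xs) \<le> length xs * ln A + sum_list xs / A - length (xs :: real list)"
  using assms
proof (induction xs)
  case (Cons x xs)
  have "ln (x / A) \<le> x / A - 1" using Cons by (intro ln_le_minus_one) auto
  then have "ln x - ln A \<le> x / A - 1" using Cons by (subst (asm) ln_div) auto
  then show ?case using Cons by (auto simp: ln_mult add_divide_distrib algebra_simps)
qed auto

text \<open>Arithmetic-geometric mean inequality for the \<open>n\<close> derivatives and the number
  \<open>\<tau>\<close> with real weight \<open>a - n\<close>. All tangent lines of the logarithm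
  are taken at the weighted mean \<open>A\<close>, where the linear terms cancel.\<close>

lemma amgm_cond_start:
  assumes "real n \<le> a" "0 < \<tau>" "0 < n"
  shows "amgm_cond a n (\<tau> * (a - n)) (\<tau> powr (a - n))"
proof (rule amgm_condI)
  fix xs :: "real list" assume xs: "length xs = n" "\<forall>x\<in>set xs. 0 \<le> x"
  have a: "0 < a" using assms by auto
  have s0: "0 \<le> sum_list xs" using xs by (simp add: sum_list_nonneg)
  show "a * (\<tau> powr (a - n) * prod_list xs) powr (1 / a) \<le> \<tau> * (a - n) + sum_list xs"
  proof (cases "0 \<in> set xs")
    case True
    then have "prod_list xs = 0" by (simp add: prod_list_zero_iff)
    then show ?thesis using assms s0 by simp
  next
    case False
    then have pos: "\<forall>x\<in>set xs. 0 < x" using xs by (metis order_le_less)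
    obtain y ys where ys: "xs = y # ys" using assms(3) xs by (cases xs) auto
    have "0 < sum_list xs" using pos xs unfolding ys
      by (auto intro!: add_pos_nonneg sum_list_nonneg)
    define A where "A = (\<tau> * (a - n) + sum_list xs) / a"
    have A: "0 < A" unfolding A_def using \<open>0 < sum_list xs\<close> assms a
      by (intro divide_pos_pos add_nonneg_pos) auto
    note l = ln_prod_list_le[OF pos A]
    have "ln (\<tau> / A) \<le> \<tau> / A - 1" using assms A by (intro ln_le_minus_one) auto
    then have "ln \<tau> \<le> ln A + \<tau> / A - 1" using assms A by (subst (asm) ln_div) auto
    then have "(a - n) * ln \<tau> \<le> (a - n) * (ln A + \<tau> / A - 1)"
      using assms by (intro mult_left_mono) auto
    then have "(a - n) * ln \<tau> + ln (prod_list xs) \<le> a * ln A + (\<tau> * (a - n) + sum_list xs) / A - a"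
      using l xs(1) by (simp add: algebra_simps add_divide_distrib diff_divide_distrib)
    also have "(\<tau> * (a - n) + sum_list xs) / A = a"
      using A a unfolding A_def by (auto simp: field_simps)
    finally have "ln (\<tau> powr (a - n) * prod_list xs) \<le> a * ln A"
      using l assms by (subst ln_mult) (auto simp: ln_powr)
    then have "ln (\<tau> powr (a - n) * prod_list xs) / a \<le> ln A"
      using a by (simp add: field_simps)
    then have "exp (ln (\<tau> powr (a - n) * prod_list xs) / a) \<le> A"
      using A by (metis exp_le_cancel_iff exp_ln)
    then have "(\<tau> powr (a - n) * prod_list xs) powr (1 / a) \<le> A"
      using l assms by (simp add: powr_def)
    then show ?thesis using a by (simp add: A_def field_simps)
  qed
qed

section \<open>Transport by iterated integration\<close>

definition set_coord :: "'a::euclidean_space \<Rightarrow> real \<Rightarrow> 'a \<Rightarrow> 'a" where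
  "set_coord b t z = z + (t - z \<bullet> b) *\<^sub>R b"

lemma set_coord_inner:
  assumes "b \<in> Basis" "c \<in> Basis"
  shows "set_coord b t z \<bullet> c = (if c = b then t else z \<bullet> c)"
  using assms by (auto simp: set_coord_def inner_add_left inner_Basis)

lemma continuous_on_set_coord [continuous_intros]:
  "continuous_on S f \<Longrightarrow> continuous_on S g \<Longrightarrow> continuous_on S (\<lambda>x. set_coord b (f x) (g x))"
  unfolding set_coord_def by (intro continuous_intros)

text \<open>The coordinates of \<open>z\<close> in the list are overwritten, the others act as
  parameters. Keeping \<open>z\<close> a point of the full space lets a slice be named by any point
  on it. The head of the list is the outermost integral.\<close>

primrec iterated_integral :: "real \<Rightarrow> 'a::euclidean_space list \<Rightarrow> ('a \<Rightarrow> real) \<Rightarrow> 'a \<Rightarrow> real" where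
  "iterated_integral R [] F z = F z"
| "iterated_integral R (b # bs) F z =
     integral {-R..R} (\<lambda>t. iterated_integral R bs F (set_coord b t z))"

lemma continuous_on_iterated_integral:
  assumes "continuous_on UNIV F"
  shows "continuous_on UNIV (iterated_integral R bs F)"
proof (induction bs)
  case (Cons b bs)
  have "continuous_on UNIV (\<lambda>z. integral (cbox (-R) R) (\<lambda>t. iterated_integral R bs F (set_coord b t z)))"
    unfolding split_beta
    by (intro integral_continuous_on_param, unfold split_beta)
       (auto intro!: continuous_on_compose2[OF Cons] continuous_intros)
  then show ?case by simp
qed (use assms in simp)

lemma continuous_on_iterated_integral':
  assumes "continuous_on UNIV F" "continuous_on S g"
  shows "continuous_on S (\<lambda>x. iterated_integral R bs F (g x))"
  by (rule continuous_on_compose2[OF continuous_on_iterated_integral[OF assms(1)] assms(2)]) auto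

lemma integrable_iterated_integral:
  assumes "continuous_on UNIV F"
  shows "(\<lambda>t. iterated_integral R bs F (set_coord b t z)) integrable_on {c..d}"
  by (intro integrable_continuous_real continuous_on_iterated_integral' assms continuous_intros)

lemma iterated_integral_mono:
  assumes "continuous_on UNIV F" "continuous_on UNIV G" "\<And>z. F z \<le> G z"
  shows "iterated_integral R bs F z \<le> iterated_integral R bs G z"
proof (induction bs arbitrary: z)
  case (Cons b bs)
  then show ?case using assms
    by (auto intro!: integral_le integrable_iterated_integral)
qed (use assms in auto)

lemma iterated_integral_0 [simp]: "iterated_integral R bs (\<lambda>z. 0) z = 0"
  by (induction bs arbitrary: z) auto

lemma iterated_integral_add:
  assumes "continuous_on UNIV F" "continuous_on UNIV G"
  shows "iterated_integral R bs (\<lambda>z. F z + c * G z) z =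
     iterated_integral R bs F z + c * iterated_integral R bs G z"
proof (induction bs arbitrary: z)
  case (Cons b bs)
  then show ?case using assms
    by (simp add: integral_add integrable_on_mult_right integrable_iterated_integral)
qed auto

lemma iterated_integral_pos:
  assumes "continuous_on UNIV F" "\<And>z. 0 < F z" "0 < R"
  shows "0 < iterated_integral R bs F z"
proof (induction bs arbitrary: z)
  case (Cons b bs)
  let ?f = "\<lambda>t. iterated_integral R bs F (set_coord b t z)"
  have c: "continuous_on {-R..R} ?f"
    by (intro continuous_on_iterated_integral' assms continuous_intros)
  have "integral {-R..R} ?f \<noteq> 0"
    using integral_eq_0_iff[OF c] Cons assms(3) less_irrefl
    by (metis atLeastAtMost_iff less_imp_le neg_less_pos order.refl)
  moreover have "0 \<le> integral {-R..R} ?f"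
    using Cons by (intro Henstock_Kurzweil_Integration.integral_nonneg integrable_iterated_integral assms)
      (auto intro: less_imp_le)
  ultimately show ?case by simp
qed (use assms in auto)

text \<open>The slice through \<open>z\<close> in the directions \<open>bs\<close>; it contains all
  points at which \<open>iterated_integral R bs F z\<close> evaluates \<open>F\<close>.\<close>

definition agree_off :: "'a::euclidean_space list \<Rightarrow> 'a \<Rightarrow> 'a \<Rightarrow> bool" where
  "agree_off bs z z' \<longleftrightarrow> (\<forall>c\<in>Basis. c \<notin> set bs \<longrightarrow> z' \<bullet> c = z \<bullet> c)"

lemma iterated_integral_eq_0:
  assumes "\<And>z'. agree_off bs z z' \<Longrightarrow> F z' = 0" "set bs \<subseteq> Basis"
  shows "iterated_integral R bs F z = 0"
  using assms
proof (induction bs arbitrary: z)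
  case (Cons b bs)
  have "iterated_integral R bs F (set_coord b t z) = 0" for t
    using Cons.prems by (intro Cons.IH) (auto simp: agree_off_def set_coord_inner split: if_splits)
  then show ?case by simp
qed (auto simp: agree_off_def)

text \<open>Differentiation under the integral sign, one inner coordinate at a time. The set
  \<open>A\<close> admits one-sided derivatives, as they occur in the normal coordinate at the
  boundary.\<close>

lemma iterated_integral_deriv:
  assumes "b \<in> Basis" "set bs \<subseteq> Basis" "b \<notin> set bs" "convex A"
    and "continuous_on UNIV F" "continuous_on UNIV F'"
    and "\<And>z. z \<bullet> b \<in> A \<Longrightarrow> ((\<lambda>t. F (set_coord b t z)) has_field_derivative F' z) (at (z \<bullet> b) within A)"
    and "z \<bullet> b \<in> A"
  shows "((\<lambda>t. iterated_integral R bs F (set_coord b t z)) has_field_derivative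
           iterated_integral R bs F' z) (at (z \<bullet> b) within A)"
  using assms
proof (induction bs arbitrary: z)
  case (Cons c bs)
  have c: "c \<in> Basis" "b \<noteq> c" using Cons.prems by auto
  let ?F = "\<lambda>u t. iterated_integral R bs F (set_coord c t (set_coord b u z))"
  let ?F' = "\<lambda>u t. iterated_integral R bs F' (set_coord c t (set_coord b u z))"
  have "((\<lambda>u. integral (cbox (-R) R) (?F u)) has_field_derivative integral (cbox (-R) R) (?F' (z \<bullet> b)))
      (at (z \<bullet> b) within A)"
  proof (rule leibniz_rule_field_derivative)
    fix u t assume u: "u \<in> A"
    have "((\<lambda>u'. iterated_integral R bs F (set_coord b u' (set_coord c t (set_coord b u z)))) has_field_derivative
       iterated_integral R bs F' (set_coord c t (set_coord b u z)))
       (at (set_coord c t (set_coord b u z) \<bullet> b) within A)"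
      using Cons.prems c u by (intro Cons.IH) (auto simp: set_coord_inner)
    moreover have "set_coord b u' (set_coord c t (set_coord b u z)) = set_coord c t (set_coord b u' z)" for u'
      by (rule euclidean_eqI) (use Cons.prems(1) c in \<open>auto simp: set_coord_inner\<close>)
    ultimately show "((\<lambda>x. ?F x t) has_field_derivative ?F' u t) (at u within A)"
      using Cons.prems(1) c by (simp add: set_coord_inner)
  next
    show "continuous_on (A \<times> cbox (- R) R) (\<lambda>(x, t). ?F' x t)"
      unfolding split_beta
      by (intro continuous_on_iterated_integral' Cons.prems continuous_intros)
  next
    show "?F u integrable_on cbox (-R) R" for u
      using integrable_iterated_integral[OF Cons.prems(5)] by simp
  qed (use Cons.prems in auto)
  moreover have "set_coord b (z \<bullet> b) z = z" by (simp add: set_coord_def)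
  ultimately show ?case by simp
qed auto

text \<open>In the application \<open>\<phi>\<close> is \<open>f\<close> to the power
  \<open>r\<close>, so \<open>\<phi> powr (a / (a - 1))\<close> is the source density;
  \<open>z\<close> and \<open>y\<close> carry the coordinates already treated. In the base case mass
  balance determines \<open>\<Lambda>\<close>, and the accumulated mean inequality becomes a
  pointwise bound. In the induction step, the transport between the marginals of the two slices
  yields exactly the mass balance of the next pair of slices, with \<open>\<Lambda> * x\<close> and
  \<open>s + x\<close>.\<close>

lemma transport_iterated_integral:
  fixes \<phi> W J :: "'a::euclidean_space \<Rightarrow> real" and \<phi>' :: "'a \<Rightarrow> 'a \<Rightarrow> real"
  assumes "0 < R" "1 < a"
    and "continuous_on UNIV \<phi>" "\<And>z. 0 \<le> \<phi> z" "\<And>b. b \<in> Basis \<Longrightarrow> continuous_on UNIV (\<phi>' b)"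
    and "continuous_on UNIV W" "\<And>y. 0 < W y"
    and "distinct bs" "set bs \<subseteq> Basis"
    and "\<And>b z. b \<in> set bs \<Longrightarrow> R \<le> \<bar>z \<bullet> b\<bar> \<Longrightarrow> \<phi> z = 0"
    and "\<And>b z. b \<in> set bs \<Longrightarrow> ((\<lambda>t. \<phi> (set_coord b t z)) has_field_derivative \<phi>' b z) (at (z \<bullet> b))"
    and "continuous_on UNIV J"
    and "\<And>z' y'. agree_off bs z z' \<Longrightarrow> agree_off bs y y' \<Longrightarrow> (\<And>b. b \<in> set bs \<Longrightarrow> \<bar>y' \<bullet> b\<bar> \<le> R) \<Longrightarrow>
        - (\<Sum>b\<leftarrow>bs. \<phi>' b z' * (y' \<bullet> b)) - (a - 1) * \<phi> z' powr (a / (a - 1)) * W y' \<le> J z'"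
    and "amgm_cond a (length bs) s \<Lambda>" "0 \<le> \<Lambda>"
    and "\<Lambda> * iterated_integral R bs (\<lambda>y. W y powr (- a)) y = iterated_integral R bs (\<lambda>z. \<phi> z powr (a / (a - 1))) z"
  shows "\<Lambda> * iterated_integral R bs (\<lambda>y. W y powr (1 - a)) y - s * iterated_integral R bs \<phi> z
     \<le> iterated_integral R bs J z"
  using assms
proof (induction bs arbitrary: z y s \<Lambda> J)
  case Nil
  note a = \<open>1 < a\<close>
  have J: "- ((a - 1) * \<phi> z powr (a / (a - 1)) * W y) \<le> J z"
    using Nil.prems(13)[of z y] by (simp add: agree_off_def)
  have m: "\<Lambda> * W y powr (- a) = \<phi> z powr (a / (a - 1))" and amgm: "a * \<Lambda> powr (1 / a) \<le> s"
    using Nil.prems by auto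
  have W: "0 < W y" and \<phi>: "0 \<le> \<phi> z" using Nil.prems by auto
  have \<Lambda>: "\<Lambda> = \<phi> z powr (a / (a - 1)) * W y powr a"
    using m W by (simp add: powr_minus field_simps)
  have "\<Lambda> powr (1 / a) = \<phi> z powr (1 / (a - 1)) * W y"
    unfolding \<Lambda> using W \<phi> a by (simp add: powr_mult powr_powr)
  \<comment> \<open>Multiplied by \<open>\<phi> z\<close>, the mean inequality reads
    \<open>a * \<rho> * W \<le> s * \<phi>\<close> with
    \<open>\<rho> = \<phi> powr (a / (a - 1))\<close>. One of the \<open>a\<close> copies of
    \<open>\<rho> * W\<close> is \<open>\<Lambda> * W powr (1 - a)\<close>; the other
    \<open>a - 1\<close> are absorbed by \<open>J\<close>.\<close>
  then have "\<phi> z * (a * (\<phi> z powr (1 / (a - 1)) * W y)) \<le> \<phi> z * s"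
    using amgm \<phi> by (intro mult_left_mono) auto
  moreover have "\<phi> z * \<phi> z powr (1 / (a - 1)) = \<phi> z powr (a / (a - 1))"
  proof (cases "\<phi> z = 0")
    case False
    have e: "a / (a - 1) = 1 + 1 / (a - 1)" using a by (simp add: field_simps)
    show ?thesis unfolding e using False \<phi> by (subst powr_add) auto
  qed (use a in auto)
  moreover have "\<Lambda> * W y powr (1 - a) = \<phi> z powr (a / (a - 1)) * W y"
    unfolding \<Lambda> using W by (simp add: powr_add[symmetric])
  ultimately show ?case using J by (simp add: algebra_simps)
next
  case (Cons b bs)
  note pr = Cons.prems
  have b: "b \<in> Basis" "b \<notin> set bs" "set bs \<subseteq> Basis" "distinct bs" using pr by auto
  have a: "0 \<le> a / (a - 1)" using pr by auto
  let ?I = "iterated_integral R bs"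
  let ?z = "\<lambda>t. set_coord b t z" and ?y = "\<lambda>t. set_coord b t y"
  have c\<rho>: "continuous_on UNIV (\<lambda>z. \<phi> z powr (a / (a - 1)))"
    by (intro continuous_on_powr' continuous_intros pr) (use pr(2,4) in auto)
  have cW: "continuous_on UNIV (\<lambda>z. W z powr t)" for t
    using pr(7) by (intro continuous_on_powr' continuous_intros pr) (auto simp: less_le)
  have "\<Lambda> * integral {-R..R} (\<lambda>v. ?I (\<lambda>y. W y powr (1 - a)) (?y v)) - s * integral {-R..R} (\<lambda>t. ?I \<phi> (?z t))
     + (-R) * ?I \<phi> (?z (-R)) \<le> integral {-R..R} (\<lambda>t. ?I J (?z t))"
  proof (rule transport_step[where m = "\<lambda>t. ?I (\<lambda>z. \<phi> z powr (a / (a - 1))) (?z t)"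
        and \<mu> = "\<lambda>v. ?I (\<lambda>y. W y powr (- a)) (?y v)" and \<Phi>' = "\<lambda>t. ?I (\<phi>' b) (?z t)"])
    fix t
    have "((\<lambda>u. ?I \<phi> (set_coord b u (?z t))) has_field_derivative ?I (\<phi>' b) (?z t)) (at (?z t \<bullet> b) within UNIV)"
      by (rule iterated_integral_deriv) (use b pr in auto)
    moreover have "set_coord b u (?z t) = ?z u" for u
      by (rule euclidean_eqI) (use b in \<open>auto simp: set_coord_inner\<close>)
    ultimately show "((\<lambda>t. ?I \<phi> (?z t)) has_field_derivative ?I (\<phi>' b) (?z t)) (at t within {-R..R})"
      using b by (auto simp: set_coord_inner intro: has_field_derivative_at_within)
  next
    show "?I \<phi> (?z R) = 0"
    proof (rule iterated_integral_eq_0)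
      fix z' assume "agree_off bs (set_coord b R z) z'"
      then have "z' \<bullet> b = R" using b by (auto simp: agree_off_def set_coord_inner)
      then show "\<phi> z' = 0" using pr(1) by (intro pr(10)[of b]) auto
    qed (use b in auto)
  next
    fix t v x assume t: "t \<in> {-R..R}" and v: "v \<in> {-R..R}" and x: "0 \<le> (x::real)"
      and m: "\<Lambda> * x * ?I (\<lambda>y. W y powr (- a)) (?y v) = ?I (\<lambda>z. \<phi> z powr (a / (a - 1))) (?z t)"
    \<comment> \<open>With the target coordinate \<open>v\<close> frozen, the derivative term of
      direction \<open>b\<close> moves into the right-hand side, so the induction hypothesis
      concerns the remaining directions only.\<close>
    let ?J = "\<lambda>z. J z + v * \<phi>' b z"
    have "\<Lambda> * x * ?I (\<lambda>y. W y powr (1 - a)) (?y v) - (s + x) * ?I \<phi> (?z t) \<le> ?I ?J (?z t)"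
    proof (rule Cons.IH)
      show "continuous_on UNIV ?J" using b pr by (intro continuous_intros) auto
      show "amgm_cond a (length bs) (s + x) (\<Lambda> * x)" using pr x by auto
      show "0 \<le> \<Lambda> * x" using pr x by auto
      show "\<phi> z' = 0" if "c \<in> set bs" "R \<le> \<bar>z' \<bullet> c\<bar>" for c z'
        using that by (intro pr(10)[of c]) auto
      show "((\<lambda>t. \<phi> (set_coord c t z')) has_field_derivative \<phi>' c z') (at (z' \<bullet> c))" if "c \<in> set bs" for c z'
        using that by (intro pr(11)) auto
      fix z' y' assume *: "agree_off bs (?z t) z'" "agree_off bs (?y v) y'" "\<And>b. b \<in> set bs \<Longrightarrow> \<bar>y' \<bullet> b\<bar> \<le> R"
      have yb: "y' \<bullet> b = v" using * b by (auto simp: agree_off_def set_coord_inner)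
      have "- (\<Sum>b\<leftarrow>b # bs. \<phi>' b z' * (y' \<bullet> b)) - (a - 1) * \<phi> z' powr (a / (a - 1)) * W y' \<le> J z'"
      proof (rule pr(13))
        show "agree_off (b # bs) z z'" "agree_off (b # bs) y y'"
          using * b by (auto simp: agree_off_def set_coord_inner)
        show "\<bar>y' \<bullet> c\<bar> \<le> R" if "c \<in> set (b # bs)" for c
          using that * yb v by auto
      qed
      then show "- (\<Sum>b\<leftarrow>bs. \<phi>' b z' * (y' \<bullet> b)) - (a - 1) * \<phi> z' powr (a / (a - 1)) * W y' \<le> ?J z'"
        using yb by (simp add: algebra_simps)
    qed (use b pr m in auto)
    also have "?I ?J (?z t) = ?I J (?z t) + v * ?I (\<phi>' b) (?z t)"
      by (rule iterated_integral_add) (use pr b in auto)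
    finally show "\<Lambda> * x * ?I (\<lambda>y. W y powr (1 - a)) (?y v) - (s + x) * ?I \<phi> (?z t) \<le>
        ?I J (?z t) + v * ?I (\<phi>' b) (?z t)" .
  next
    show "0 \<le> ?I (\<lambda>z. \<phi> z powr (a / (a - 1))) (?z t)" for t
      using iterated_integral_mono[OF _ c\<rho>, of "\<lambda>_. 0"] by simp
    show "0 < ?I (\<lambda>y. W y powr (- a)) (?y v)" for v
      using pr(1,7) by (intro iterated_integral_pos cW) (auto simp: less_le)
  qed (use pr b in \<open>auto intro!: continuous_on_iterated_integral' c\<rho> cW continuous_intros\<close>)
  \<comment> \<open>No boundary contribution in these directions: \<open>\<phi>\<close> vanishes on
    both opposite faces of the box.\<close>
  moreover have "?I \<phi> (?z (-R)) = 0"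
  proof (rule iterated_integral_eq_0)
    fix z' assume "agree_off bs (set_coord b (-R) z) z'"
    then have "z' \<bullet> b = -R" using b by (auto simp: agree_off_def set_coord_inner)
    then show "\<phi> z' = 0" using pr(1) by (intro pr(10)[of b]) auto
  qed (use b in auto)
  ultimately show ?case by simp
qed

section \<open>Transport inequality on the half-space\<close>

text \<open>Tonelli's theorem, peeling one factor off the product measure per recursion step.
  Working in \<open>ennreal\<close> avoids integrability conditions on the way.\<close>

lemma iterated_integral_nn_integral:
  fixes F :: "'a::euclidean_space \<Rightarrow> real"
  assumes F: "continuous_on UNIV F" "\<And>z. 0 \<le> F z"
    and "distinct bs" "set bs \<subseteq> Basis"
  shows "ennreal (iterated_integral R bs F z) =
     (\<integral>\<^sup>+w. (\<Prod>b\<in>set bs. indicator {-R..R} (w b)) * ennreal (F (z + (\<Sum>b\<in>set bs. (w b - z \<bullet> b) *\<^sub>R b)))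
        \<partial>(\<Pi>\<^sub>M b\<in>set bs. lborel))"
  using assms(3,4)
proof (induction bs arbitrary: z)
  case Nil
  interpret product_sigma_finite "\<lambda>_::'a. lborel :: real measure"
    by unfold_locales
  show ?case by (simp add: PiM_empty nn_integral_count_space_finite)
next
  case (Cons b bs)
  interpret product_sigma_finite "\<lambda>_::'a. lborel :: real measure"
    by unfold_locales
  have b: "b \<in> Basis" "b \<notin> set bs" "distinct bs" "set bs \<subseteq> Basis" using Cons.prems by auto
  have [measurable]: "F \<in> borel_measurable borel"
    using F(1) by (rule borel_measurable_continuous_onI)
  let ?I = "\<lambda>t. iterated_integral R bs F (set_coord b t z)"
  have I0: "0 \<le> ?I t" for t
    using iterated_integral_mono[of "\<lambda>_. 0" F] F by simp
  have "ennreal (iterated_integral R (b # bs) F z) = (\<integral>\<^sup>+t. indicator {-R..R} t * ennreal (?I t) \<partial>lborel)"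
    using nn_integral_has_integral_lebesgue[OF _ integrable_integral[OF integrable_iterated_integral[OF F(1)]]] I0
    by (simp add: ennreal_mult' ennreal_indicator)
  also have "\<dots> = (\<integral>\<^sup>+t. (\<integral>\<^sup>+w. indicator {-R..R} t * ((\<Prod>b\<in>set bs. indicator {-R..R} (w b)) *
      ennreal (F (set_coord b t z + (\<Sum>c\<in>set bs. (w c - set_coord b t z \<bullet> c) *\<^sub>R c))))
        \<partial>(\<Pi>\<^sub>M b\<in>set bs. lborel)) \<partial>lborel)"
    using b by (subst Cons.IH) (auto intro!: nn_integral_cong simp: nn_integral_cmult)
  also have "\<dots> = (\<integral>\<^sup>+t. (\<integral>\<^sup>+w. (\<Prod>c\<in>insert b (set bs). indicator {-R..R} ((w(b := t)) c)) *
      ennreal (F (z + (\<Sum>c\<in>insert b (set bs). ((w(b := t)) c - z \<bullet> c) *\<^sub>R c)))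
        \<partial>(\<Pi>\<^sub>M b\<in>set bs. lborel)) \<partial>lborel)"
  proof (intro nn_integral_cong)
    fix t and w :: "'a \<Rightarrow> real"
    have "(\<Prod>c\<in>insert b (set bs). indicator {-R..R} ((w(b := t)) c)) =
        (indicator {-R..R} t :: ennreal) * (\<Prod>b\<in>set bs. indicator {-R..R} (w b))"
      using b by (subst prod.insert) (auto intro!: arg_cong2[where f="(*)"] prod.cong)
    moreover have "z + (\<Sum>c\<in>insert b (set bs). ((w(b := t)) c - z \<bullet> c) *\<^sub>R c) =
        set_coord b t z + (\<Sum>c\<in>set bs. (w c - set_coord b t z \<bullet> c) *\<^sub>R c)"
    proof -
      have "(\<Sum>c\<in>set bs. ((w(b := t)) c - z \<bullet> c) *\<^sub>R c) = (\<Sum>c\<in>set bs. (w c - set_coord b t z \<bullet> c) *\<^sub>R c)"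
        using b by (intro sum.cong) (auto simp: set_coord_inner)
      then show ?thesis using b by (simp add: set_coord_def)
    qed
    ultimately show "indicator {-R..R} t * ((\<Prod>b\<in>set bs. indicator {-R..R} (w b)) *
      ennreal (F (set_coord b t z + (\<Sum>c\<in>set bs. (w c - set_coord b t z \<bullet> c) *\<^sub>R c)))) =
      (\<Prod>c\<in>insert b (set bs). indicator {-R..R} ((w(b := t)) c)) *
      ennreal (F (z + (\<Sum>c\<in>insert b (set bs). ((w(b := t)) c - z \<bullet> c) *\<^sub>R c)))"
      by (simp add: mult.assoc)
  qed
  also have "\<dots> = (\<integral>\<^sup>+w. (\<Prod>c\<in>insert b (set bs). indicator {-R..R} (w c)) *
      ennreal (F (z + (\<Sum>c\<in>insert b (set bs). (w c - z \<bullet> c) *\<^sub>R c))) \<partial>(\<Pi>\<^sub>M b\<in>insert b (set bs). lborel))"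
    using b by (subst product_nn_integral_insert_rev) auto
  finally show ?case by simp
qed

lemma iterated_integral_eq_integral_nonneg:
  fixes F :: "'a::euclidean_space \<Rightarrow> real"
  assumes F: "continuous_on UNIV F" "\<And>z. 0 \<le> F z"
    and "distinct bs" "set bs = Basis"
  shows "iterated_integral R bs F z = integral (cbox (- (R *\<^sub>R One)) (R *\<^sub>R One)) F"
proof -
  have [measurable]: "F \<in> borel_measurable borel"
    using F(1) by (rule borel_measurable_continuous_onI)
  let ?B = "cbox (- (R *\<^sub>R One)) (R *\<^sub>R One) :: 'a set"
  have p: "(\<Prod>b\<in>Basis. indicator {-R..R} (x \<bullet> b)) = (indicator ?B x :: ennreal)" for x :: 'a
  proof (cases "x \<in> ?B")
    case True
    then have "(\<Prod>b\<in>Basis. indicator {-R..R} (x \<bullet> b)) = (\<Prod>b\<in>(Basis::'a set). (1::ennreal))"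
      by (intro prod.cong) (auto simp: mem_box)
    then show ?thesis using True by simp
  next
    case False
    then obtain b where "b \<in> Basis" "x \<bullet> b \<notin> {-R..R}"
      by (auto simp: mem_box)
    then show ?thesis using False by (auto intro!: bexI[of _ b] simp: prod_zero_iff)
  qed
  have "ennreal (iterated_integral R bs F z) =
     (\<integral>\<^sup>+w. (\<Prod>b\<in>Basis. indicator {-R..R} (w b)) * ennreal (F (z + (\<Sum>b\<in>Basis. (w b - z \<bullet> b) *\<^sub>R b)))
        \<partial>(\<Pi>\<^sub>M b\<in>(Basis :: 'a set). lborel))"
    using iterated_integral_nn_integral[OF F assms(3)] assms(4) by simp
  also have "\<dots> = (\<integral>\<^sup>+w. (\<Prod>b\<in>Basis. indicator {-R..R} ((\<Sum>b\<in>Basis. w b *\<^sub>R b) \<bullet> b)) * ennreal (F (\<Sum>b\<in>Basis. w b *\<^sub>R b))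
        \<partial>(\<Pi>\<^sub>M b\<in>(Basis :: 'a set). lborel))"
    by (intro nn_integral_cong arg_cong2[where f="(*)"] prod.cong)
      (auto simp: scaleR_diff_left sum_subtractf euclidean_representation)
  also have "\<dots> = (\<integral>\<^sup>+x. (\<Prod>b\<in>Basis. indicator {-R..R} (x \<bullet> b)) * ennreal (F x) \<partial>lborel)"
    by (subst lborel_eq) (subst nn_integral_distr, auto)
  also have "\<dots> = (\<integral>\<^sup>+x. indicator ?B x * ennreal (F x) \<partial>lborel)" by (simp add: p)
  also have "\<dots> = ennreal (integral ?B F)"
    using nn_integral_has_integral_lebesgue[of ?B F, OF _ integrable_integral[OF integrable_continuous]] F
      by (simp add: ennreal_mult' ennreal_indicator continuous_on_subset[OF F(1)])
  finally have eq: "ennreal (iterated_integral R bs F z) = ennreal (integral ?B F)" .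
  have "0 \<le> iterated_integral R bs F z"
    using iterated_integral_mono[of "\<lambda>_. 0" F] F by simp
  moreover have "0 \<le> integral ?B F"
    using F by (intro Henstock_Kurzweil_Integration.integral_nonneg integrable_continuous) (auto intro: continuous_on_subset)
  ultimately show ?thesis using eq by simp
qed

lemma iterated_integral_Pair:
  "iterated_integral R (map (Pair (0::real)) xs) F (u, x) = iterated_integral R xs (\<lambda>x. F (u, x)) x"
  by (induction xs arbitrary: x) (auto simp: set_coord_def)

text \<open>Retraction onto the half-space. It extends functions given there continuously to the
  whole space, as the lemmas on iterated integrals ask for continuity everywhere.\<close>

definition clip :: "real \<times> 'b \<Rightarrow> real \<times> 'b" where
  "clip z = (max 0 (fst z), snd z)"

lemma continuous_on_clip:
  assumes "continuous_on {z. 0 \<le> fst z} F"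
  shows "continuous_on UNIV (\<lambda>z::real \<times> 'b::euclidean_space. F (clip z))"
  unfolding clip_def
  by (rule continuous_on_compose2[OF assms]) (auto intro!: continuous_intros)

lemma sum_Basis_prod:
  "(\<Sum>b\<in>Basis. g b) = g (1::real, 0) + (\<Sum>b\<in>Basis. (g (0, b) :: real))"
proof -
  have B: "(Basis :: (real \<times> 'a) set) = insert (1, 0) (Pair 0 ` Basis)"
    by (auto simp: Basis_prod_def)
  show ?thesis unfolding B
    by (subst sum.insert) (auto simp: sum.reindex inj_on_def)
qed

text \<open>The normal coordinate is peeled off by \<open>transport_step\<close> with target
  interval \<open>{1..R}\<close>, whose lower end 1 is the coefficient of the boundary integral; the
  tangential coordinates go through \<open>transport_iterated_integral\<close>. Keeping
  \<open>young\<close> abstract separates the Jacobian argument from norms and gradients.\<close>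

lemma transport_halfspace:
  fixes \<phi> W J :: "real \<times> 'b::euclidean_space \<Rightarrow> real" and \<phi>' :: "real \<times> 'b \<Rightarrow> real \<times> 'b \<Rightarrow> real"
    and R a \<tau> :: real
  defines "n \<equiv> DIM(real \<times> 'b)"
  defines "X \<equiv> cbox (- (R *\<^sub>R One)) (R *\<^sub>R One) :: 'b set"
  defines "A \<equiv> {0..R} \<times> X" and "Q \<equiv> {1..R} \<times> X"
  assumes a: "real n \<le> a" and R: "1 < R" and \<tau>: "0 < \<tau>"
    and \<phi>: "continuous_on {z. 0 \<le> fst z} \<phi>" "\<And>z. 0 \<le> fst z \<Longrightarrow> 0 \<le> \<phi> z"
    and \<phi>': "\<And>b. b \<in> Basis \<Longrightarrow> continuous_on {z. 0 \<le> fst z} (\<phi>' b)"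
    and vanish: "\<And>z b. 0 \<le> fst z \<Longrightarrow> b \<in> Basis \<Longrightarrow> R \<le> \<bar>z \<bullet> b\<bar> \<Longrightarrow> \<phi> z = 0"
    and deriv: "\<And>z b. 0 \<le> fst z \<Longrightarrow> b \<in> Basis \<Longrightarrow>
       ((\<lambda>t. \<phi> (set_coord b t z)) has_field_derivative \<phi>' b z) (at (z \<bullet> b) within (if b = (1, 0) then {0..} else UNIV))"
    and W: "continuous_on UNIV W" "\<And>y. 0 < W y"
    and J: "continuous_on {z. 0 \<le> fst z} J" "\<And>z. 0 \<le> fst z \<Longrightarrow> 0 \<le> J z"
    and young: "\<And>z y. 0 \<le> fst z \<Longrightarrow> 1 \<le> fst y \<Longrightarrow>
      - (\<Sum>b\<in>Basis. \<phi>' b z * (y \<bullet> b)) - (a - 1) * \<phi> z powr (a / (a - 1)) * W y \<le> J z"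
    and mass: "\<tau> powr (a - n) * integral Q (\<lambda>y. W y powr (- a)) = integral A (\<lambda>z. \<phi> z powr (a / (a - 1)))"
  shows "\<tau> powr (a - n) * integral Q (\<lambda>y. W y powr (1 - a)) + integral X (\<lambda>x. \<phi> (0, x))
     \<le> \<tau> * (a - n) * integral A \<phi> + integral A J"
proof -
  obtain xs :: "'b list" where xs: "set xs = Basis" "distinct xs" "length xs = DIM('b)"
    using finite_distinct_list[OF finite_Basis] distinct_card by metis
  define bs where "bs = map (Pair (0::real)) xs"
  have bs: "set bs = Pair 0 ` Basis" "distinct bs" "set bs \<subseteq> Basis" "length bs = DIM('b)"
    using xs by (auto simp: bs_def distinct_map inj_on_def Basis_prod_def)
  define e where "e = (1::real, 0::'b)"
  have e: "e \<in> Basis" "e \<notin> set bs" by (auto simp: e_def bs Basis_prod_def)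
  have n: "n = Suc (DIM('b))" "0 < DIM('b)" by (auto simp: n_def)
  have "2 \<le> n" using n by linarith
  then have a1: "1 < a" using a by linarith
  have a': "0 < a / (a - 1)" using a1 by simp
  let ?I = "iterated_integral R bs"
  define \<psi> where "\<psi> z = \<phi> (clip z)" for z
  define K where "K z = J (clip z)" for z
  define \<psi>' where "\<psi>' b z = \<phi>' b (clip z)" for b z
  have cX: "cbox (0, - (R *\<^sub>R One)) (R, R *\<^sub>R One) = A" "cbox (1, - (R *\<^sub>R One)) (R, R *\<^sub>R One) = Q"
    by (auto simp: A_def X_def Q_def cbox_Pair_eq)
  have clip [simp]: "0 \<le> fst z \<Longrightarrow> clip z = z" for z :: "real \<times> 'b" by (simp add: clip_def prod_eq_iff)
  have clip0: "0 \<le> fst (clip z)" for z :: "real \<times> 'b" by (simp add: clip_def)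
  have c\<psi>: "continuous_on UNIV \<psi>" and cK: "continuous_on UNIV K"
    and c\<psi>': "\<And>b. b \<in> Basis \<Longrightarrow> continuous_on UNIV (\<psi>' b)"
    unfolding \<psi>_def K_def \<psi>'_def using \<phi> \<phi>' J by (auto intro: continuous_on_clip)
  have \<psi>0: "0 \<le> \<psi> z" and K0: "0 \<le> K z" for z
    unfolding \<psi>_def K_def using \<phi> J clip0 by auto
  have c\<rho>: "continuous_on UNIV (\<lambda>z. \<psi> z powr (a / (a - 1)))"
    by (intro continuous_on_powr' continuous_intros c\<psi>) (use a' \<psi>0 in auto)
  have cW: "continuous_on UNIV (\<lambda>z. W z powr t)" for t
    using W(2) by (intro continuous_on_powr' continuous_intros W) (auto simp: less_le)
  have I_eq: "?I F (u, 0) = integral X (\<lambda>x. F (u, x))" if "continuous_on UNIV F" "\<And>z. 0 \<le> F z" for F u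
    unfolding bs_def iterated_integral_Pair X_def
    by (rule iterated_integral_eq_integral_nonneg)
      (use that xs in \<open>auto intro!: continuous_on_compose2[OF that(1)] continuous_intros\<close>)
  have I2: "integral {v..R} (\<lambda>u. ?I F (u, 0)) = integral ({v..R} \<times> X) F"
    if "continuous_on UNIV F" "\<And>z. 0 \<le> F z" for F v
    using integral_prod_continuous[of v "- (R *\<^sub>R One)" R "R *\<^sub>R One" F] that
    by (simp add: I_eq[OF that] continuous_on_subset[OF that(1)] cbox_Pair_eq X_def)
  have IA: "integral {0..R} (\<lambda>u. ?I (\<lambda>z. F (clip z)) (u, 0)) = integral A F"
    if "continuous_on UNIV (\<lambda>z. F (clip z))" "\<And>z. 0 \<le> F (clip z)" for F
    unfolding I2[OF that] A_def[symmetric]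
    by (rule integral_cong) (auto simp: A_def)
  have step: "\<tau> powr (a - n) * integral {1..R} (\<lambda>v. ?I (\<lambda>y. W y powr (1 - a)) (v, 0)) -
      \<tau> * (a - n) * integral {0..R} (\<lambda>t. ?I \<psi> (t, 0))
     + 1 * ?I \<psi> (0, 0) \<le> integral {0..R} (\<lambda>t. ?I K (t, 0))"
  proof (rule transport_step[where m = "\<lambda>t. ?I (\<lambda>z. \<psi> z powr (a / (a - 1))) (t, 0)"
        and \<mu> = "\<lambda>v. ?I (\<lambda>y. W y powr (- a)) (v, 0)" and \<Phi>' = "\<lambda>t. ?I (\<psi>' e) (t, 0)"])
    fix t assume t: "t \<in> {0..R}"
    have "((\<lambda>u. ?I \<psi> (set_coord e u (t, 0))) has_field_derivative ?I (\<psi>' e) (t, 0)) (at ((t, 0::'b) \<bullet> e) within {0..})"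
    proof (rule iterated_integral_deriv)
      fix z :: "real \<times> 'b" assume "z \<bullet> e \<in> {0..}"
      then have z: "0 \<le> fst z" by (cases z) (auto simp: e_def)
      have "((\<lambda>t. \<phi> (set_coord e t z)) has_field_derivative \<phi>' e z) (at (z \<bullet> e) within {0..})"
        using deriv[OF z e(1)] by (simp add: e_def)
      \<comment> \<open>Clipping may destroy the two-sided normal derivative at the boundary, but
        within \<open>{0..}\<close> nothing changes.\<close>
      then have "((\<lambda>t. \<psi> (set_coord e t z)) has_field_derivative \<phi>' e z) (at (z \<bullet> e) within {0..})"
        by (rule has_field_derivative_transform_within[where d = 1])
          (use z in \<open>auto simp: \<psi>_def set_coord_def e_def clip_def inner_prod_def plus_prod_def\<close>)
      then show "((\<lambda>t. \<psi> (set_coord e t z)) has_field_derivative \<psi>' e z) (at (z \<bullet> e) within {0..})"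
        using z by (simp add: \<psi>'_def)
    qed (use e bs c\<psi> c\<psi>' t in \<open>auto simp: e_def\<close>)
    then have "((\<lambda>u. ?I \<psi> (u, 0)) has_field_derivative ?I (\<psi>' e) (t, 0)) (at t within {0..})"
      by (simp add: e_def set_coord_def)
    then show "((\<lambda>t. ?I \<psi> (t, 0)) has_field_derivative ?I (\<psi>' e) (t, 0)) (at t within {0..R})"
      by (rule DERIV_subset) auto
  next
    show "?I \<psi> (R, 0) = 0"
    proof (rule iterated_integral_eq_0)
      fix z' :: "real \<times> 'b" assume "agree_off bs (R, 0) z'"
      then have "z' \<bullet> e = (R, 0) \<bullet> e" using e unfolding agree_off_def by blast
      then have "fst z' = R" by (cases z') (auto simp: e_def)
      then show "\<psi> z' = 0" unfolding \<psi>_def using R vanish[of z' "e"] e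
        by (cases z') (auto simp: clip_def e_def)
    qed (use bs in auto)
  next
    fix t v x assume t: "t \<in> {0..R}" and v: "v \<in> {1..R}" and x: "0 \<le> (x::real)"
      and m: "\<tau> powr (a - n) * x * ?I (\<lambda>y. W y powr (- a)) (v, 0) = ?I (\<lambda>z. \<psi> z powr (a / (a - 1))) (t, 0)"
    let ?J = "\<lambda>z. K z + v * \<psi>' e z"
    have "\<tau> powr (a - n) * x * ?I (\<lambda>y. W y powr (1 - a)) (v, 0) - (\<tau> * (a - n) + x) * ?I \<psi> (t, 0) \<le> ?I ?J (t, 0)"
    proof (rule transport_iterated_integral[where \<phi>' = \<psi>' and a = a and W = W and R = R
          and y = "(v, 0)" and z = "(t, 0)" and \<phi> = \<psi> and bs = bs and J = ?J])
      show "continuous_on UNIV ?J" using cK c\<psi>' e by (intro continuous_intros) auto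
      \<comment> \<open>The number \<open>x\<close> takes the place of the first of the
        \<open>n\<close> derivatives; the \<open>length bs\<close> tangential ones remain.\<close>
      have "amgm_cond a (Suc (length bs)) (\<tau> * (a - n)) (\<tau> powr (a - n))"
        using amgm_cond_start[of n a \<tau>] a \<tau> n bs by simp
      then show "amgm_cond a (length bs) (\<tau> * (a - n) + x) (\<tau> powr (a - n) * x)" using x by simp
      fix z' y' :: "real \<times> 'b"
      assume *: "agree_off bs (t, 0) z'" "agree_off bs (v, 0) y'" "\<And>b. b \<in> set bs \<Longrightarrow> \<bar>y' \<bullet> b\<bar> \<le> R"
      have "z' \<bullet> e = (t, 0) \<bullet> e" "y' \<bullet> e = (v, 0) \<bullet> e" using e * unfolding agree_off_def by blast+
      then have f: "fst z' = t" "fst y' = v" "y' \<bullet> e = v" by (cases z', cases y', auto simp: e_def)+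
      then have "0 \<le> fst z'" "1 \<le> fst y'" using t v by auto
      from young[OF this]
      have "- (\<phi>' e z' * v + (\<Sum>b\<leftarrow>bs. \<phi>' b z' * (y' \<bullet> b))) - (a - 1) * \<phi> z' powr (a / (a - 1)) * W y' \<le> J z'"
        using xs f by (simp add: sum_Basis_prod bs_def sum_list_distinct_conv_sum_set o_def e_def)
      then show "- (\<Sum>b\<leftarrow>bs. \<psi>' b z' * (y' \<bullet> b)) - (a - 1) * \<psi> z' powr (a / (a - 1)) * W y' \<le> ?J z'"
        using f t by (simp add: \<psi>_def \<psi>'_def K_def algebra_simps)
    next
      fix b z assume b: "b \<in> set bs"
      show "\<psi> z = 0" if "R \<le> \<bar>z \<bullet> b\<bar>"
        unfolding \<psi>_def using that b bs by (intro vanish[OF clip0, of b]) (auto simp: clip_def inner_prod_def)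
      have "((\<lambda>t. \<phi> (set_coord b t (clip z))) has_field_derivative \<phi>' b (clip z)) (at (clip z \<bullet> b))"
        using deriv[OF clip0, of b z] b bs e(2) by (auto simp: e_def)
      moreover have "\<phi> (set_coord b t (clip z)) = \<psi> (set_coord b t z)" "clip z \<bullet> b = z \<bullet> b" for t
        using b bs by (auto simp: \<psi>_def clip_def set_coord_def inner_prod_def plus_prod_def)
      ultimately show "((\<lambda>t. \<psi> (set_coord b t z)) has_field_derivative \<psi>' b z) (at (z \<bullet> b))"
        by (simp add: \<psi>'_def)
    qed (use R a1 c\<psi> c\<psi>' W \<psi>0 bs x m \<tau> in auto)
    also have "?I ?J (t, 0) = ?I K (t, 0) + v * ?I (\<psi>' e) (t, 0)"
      by (rule iterated_integral_add) (use cK c\<psi>' e in auto)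
    finally show "\<tau> powr (a - n) * x * ?I (\<lambda>y. W y powr (1 - a)) (v, 0) - (\<tau> * (a - n) + x) * ?I \<psi> (t, 0) \<le>
       ?I K (t, 0) + v * ?I (\<psi>' e) (t, 0)" .
  next
    show "0 \<le> ?I (\<lambda>z. \<psi> z powr (a / (a - 1))) (t, 0)" for t
      using iterated_integral_mono[OF _ c\<rho>, of "\<lambda>_. 0"] by simp
    show "0 < ?I (\<lambda>y. W y powr (- a)) (v, 0)" for v
      using R W by (intro iterated_integral_pos cW) (auto simp: less_le)
  next
    have "integral {1..R} (\<lambda>u. ?I (\<lambda>y. W y powr (- a)) (u, 0)) = integral Q (\<lambda>y. W y powr (- a))"
      unfolding Q_def by (rule I2[OF cW]) auto
    moreover have "integral {0..R} (\<lambda>u. ?I (\<lambda>z. \<psi> z powr (a / (a - 1))) (u, 0)) = integral A (\<lambda>z. \<phi> z powr (a / (a - 1)))"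
      unfolding \<psi>_def by (rule IA) (use c\<rho> in \<open>auto simp: \<psi>_def\<close>)
    ultimately show "\<tau> powr (a - n) * integral {1..R} (\<lambda>u. ?I (\<lambda>y. W y powr (- a)) (u, 0)) =
      integral {0..R} (\<lambda>u. ?I (\<lambda>z. \<psi> z powr (a / (a - 1))) (u, 0))"
      using mass by simp
  qed (use R \<tau> e in \<open>auto intro!: continuous_on_iterated_integral' c\<rho> cW cK c\<psi>' continuous_intros\<close>)
  have "integral {1..R} (\<lambda>v. ?I (\<lambda>y. W y powr (1 - a)) (v, 0)) = integral Q (\<lambda>y. W y powr (1 - a))"
    unfolding Q_def by (rule I2[OF cW]) auto
  moreover have "integral {0..R} (\<lambda>t. ?I \<psi> (t, 0)) = integral A \<phi>"
    unfolding \<psi>_def by (rule IA) (use c\<psi> \<psi>0 in \<open>auto simp: \<psi>_def\<close>)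
  moreover have "integral {0..R} (\<lambda>t. ?I K (t, 0)) = integral A J"
    unfolding K_def by (rule IA) (use cK K0 in \<open>auto simp: K_def\<close>)
  moreover have "?I \<psi> (0, 0) = integral X (\<lambda>x. \<phi> (0, x))"
    by (subst I_eq[OF c\<psi> \<psi>0]) (auto simp: \<psi>_def)
  ultimately show ?thesis using step by simp
qed

section \<open>Norms, dual norms and Young's inequality\<close>

lemma is_normD:
  assumes "is_norm N"
  shows "0 \<le> N x" "N x = 0 \<longleftrightarrow> x = 0" "N (c *\<^sub>R x) = \<bar>c\<bar> * N x" "N (x + y) \<le> N x + N y"
    "N (- x) = N x" "N 0 = 0" "x \<noteq> 0 \<Longrightarrow> 0 < N x"
proof -
  show *: "0 \<le> N x" "N x = 0 \<longleftrightarrow> x = 0" "N (c *\<^sub>R x) = \<bar>c\<bar> * N x" "N (x + y) \<le> N x + N y" for x y c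
    using assms unfolding is_norm_def by blast+
  show "N (- x) = N x" using *(3)[of "-1" x] by simp
  show "N 0 = 0" "x \<noteq> 0 \<Longrightarrow> 0 < N x" using * by (auto simp: order_less_le)
qed

lemma is_norm_diff_le: "is_norm N \<Longrightarrow> \<bar>N x - N y\<bar> \<le> N (x - y)"
  using is_normD(4)[of N "x - y" y] is_normD(4)[of N "y - x" x] is_normD(5)[of N "x - y"] by auto

lemma is_norm_le_norm:
  fixes N :: "'a::euclidean_space \<Rightarrow> real"
  assumes "is_norm N"
  obtains C where "0 < C" "\<And>x. N x \<le> C * norm x"
proof
  note N = is_normD[OF assms]
  let ?C = "1 + (\<Sum>b\<in>Basis. N b)"
  show "0 < ?C" using N(1) by (intro add_pos_nonneg sum_nonneg) auto
  fix x
  have sum_le: "N (\<Sum>b\<in>S. g b) \<le> (\<Sum>b\<in>S. N (g b))" if "finite S" for S and g :: "'a \<Rightarrow> 'a"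
    using that by (induction S rule: finite_induct) (auto simp: N(6) intro: order_trans[OF N(4)])
  have "N x = N (\<Sum>b\<in>Basis. (x \<bullet> b) *\<^sub>R b)" by (simp add: euclidean_representation)
  also have "\<dots> \<le> (\<Sum>b\<in>Basis. \<bar>x \<bullet> b\<bar> * N b)"
    using sum_le[of Basis "\<lambda>b. (x \<bullet> b) *\<^sub>R b"] N(3) by simp
  also have "\<dots> \<le> (\<Sum>b\<in>Basis. norm x * N b)"
    by (intro sum_mono mult_right_mono N(1) Basis_le_norm)
  also have "\<dots> \<le> ?C * norm x" by (simp add: sum_distrib_left algebra_simps)
  finally show "N x \<le> ?C * norm x" .
qed

lemma continuous_on_is_norm:
  fixes N :: "'a::euclidean_space \<Rightarrow> real"
  assumes N: "is_norm N"
  shows "continuous_on S N"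
proof -
  obtain C where C: "0 < C" "\<And>x. N x \<le> C * norm x" using is_norm_le_norm[OF N] by blast
  have "C-lipschitz_on S N"
    by (rule lipschitz_onI) (use C is_norm_diff_le[OF N] in \<open>auto simp: dist_norm intro: order_trans\<close>)
  then show ?thesis by (rule lipschitz_on_continuous_on)
qed

lemma is_norm_ge_norm:
  fixes N :: "'a::euclidean_space \<Rightarrow> real"
  assumes N: "is_norm N"
  obtains c where "0 < c" "\<And>x. c * norm x \<le> N x"
proof -
  have "\<exists>x\<in>sphere 0 1. \<forall>y\<in>sphere 0 1. N x \<le> N y"
    by (intro continuous_attains_inf continuous_on_is_norm N) (auto intro!: exI[of _ "SOME b::'a. b \<in> Basis"] norm_Basis[OF SOME_Basis])
  then obtain x where x: "norm x = 1" "\<And>y. norm y = 1 \<Longrightarrow> N x \<le> N y" by auto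
  show thesis
  proof
    show "0 < N x" using is_normD(7)[OF N, of x] x by force
    fix y show "N x * norm y \<le> N y"
    proof (cases "y = 0")
      case False
      have "N x \<le> N (y /\<^sub>R norm y)" using False by (intro x) auto
      also have "\<dots> = N y / norm y" using is_normD(3)[OF N] by (simp add: field_simps)
      finally show ?thesis using False by (simp add: field_simps)
    qed (use is_normD[OF N] in auto)
  qed
qed

lemma dual_norm_bdd:
  fixes N :: "'a::euclidean_space \<Rightarrow> real"
  assumes N: "is_norm N"
  shows "bdd_above ((\<lambda>x. x \<bullet> y) ` {x. N x \<le> 1})"
proof -
  obtain c where c: "0 < c" "\<And>x. c * norm x \<le> N x" using is_norm_ge_norm[OF N] by blast
  show ?thesis
  proof (rule bdd_aboveI2[where M = "1 / c * norm y"])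
    fix x assume "x \<in> {x. N x \<le> 1}"
    then have "norm x \<le> 1 / c" using c(1) c(2)[of x] by (simp add: field_simps)
    then show "x \<bullet> y \<le> 1 / c * norm y"
      using norm_cauchy_schwarz[of x y] by (meson mult_right_mono norm_ge_zero order_trans)
  qed
qed

text \<open>Hoelder's inequality for the pair of norms; it is how the gradient term of the transport
  inequality meets the weight \<open>N\<close>.\<close>

lemma inner_le_dual_norm:
  fixes N :: "'a::euclidean_space \<Rightarrow> real"
  assumes N: "is_norm N"
  shows "x \<bullet> y \<le> N x * dual_norm N y"
proof (cases "x = 0")
  case False
  then have Nx: "0 < N x" using is_normD(7)[OF N] by blast
  have "(x /\<^sub>R N x) \<bullet> y \<le> dual_norm N y"
    unfolding dual_norm_def using Nx is_normD(3)[OF N]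
    by (intro cSUP_upper dual_norm_bdd N) auto
  then show ?thesis using Nx by (simp add: field_simps)
qed (simp add: is_normD(6)[OF N])

lemma dual_norm_nonneg:
  fixes N :: "'a::euclidean_space \<Rightarrow> real"
  assumes N: "is_norm N"
  shows "0 \<le> dual_norm N y"
  unfolding dual_norm_def using is_normD(6)[OF N]
  by (intro cSUP_upper2[where x = 0] dual_norm_bdd N) auto

lemma dual_norm_le:
  fixes N :: "'a::euclidean_space \<Rightarrow> real"
  assumes N: "is_norm N" and "\<And>x. x \<bullet> y \<le> M * N x" "0 \<le> M"
  shows "dual_norm N y \<le> M"
  unfolding dual_norm_def
proof (rule cSUP_least)
  show "{x. N x \<le> 1} \<noteq> {}" using is_normD(6)[OF N] by (auto intro: exI[of _ 0])
  fix x assume "x \<in> {x. N x \<le> 1}"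
  then show "x \<bullet> y \<le> M" using assms(2)[of x] mult_left_mono[of "N x" 1 M] assms(3) by auto
qed

lemma dual_norm_add:
  fixes N :: "'a::euclidean_space \<Rightarrow> real"
  assumes N: "is_norm N"
  shows "dual_norm N (x + y) \<le> dual_norm N x + dual_norm N y"
  using inner_le_dual_norm[OF N] dual_norm_nonneg[OF N]
  by (intro dual_norm_le[OF N]) (auto simp: inner_add_right algebra_simps intro: add_mono)

lemma dual_norm_scaleR_le:
  fixes N :: "'a::euclidean_space \<Rightarrow> real"
  assumes N: "is_norm N"
  shows "dual_norm N (c *\<^sub>R y) \<le> \<bar>c\<bar> * dual_norm N y"
proof (rule dual_norm_le[OF N])
  fix x
  have "(c *\<^sub>R x) \<bullet> y \<le> N (c *\<^sub>R x) * dual_norm N y" by (rule inner_le_dual_norm[OF N])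
  then show "x \<bullet> c *\<^sub>R y \<le> \<bar>c\<bar> * dual_norm N y * N x" by (simp add: is_normD[OF N] algebra_simps)
qed (simp add: dual_norm_nonneg[OF N])

lemma dual_norm_le_norm:
  fixes N :: "'a::euclidean_space \<Rightarrow> real"
  assumes N: "is_norm N"
  obtains C where "0 < C" "\<And>y. dual_norm N y \<le> C * norm y"
proof -
  obtain c where c: "0 < c" "\<And>x. c * norm x \<le> N x" using is_norm_ge_norm[OF N] by blast
  show thesis
  proof (rule that[of "1 / c"])
    fix y show "dual_norm N y \<le> 1 / c * norm y"
    proof (rule dual_norm_le[OF N])
      fix x
      have "x \<bullet> y \<le> norm x * norm y" by (rule norm_cauchy_schwarz)
      also have "\<dots> \<le> N x / c * norm y" using c by (intro mult_right_mono) (auto simp: field_simps)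
      finally show "x \<bullet> y \<le> 1 / c * norm y * N x" by (simp add: mult.commute)
    qed (use c in auto)
  qed (use c in auto)
qed

lemma continuous_on_dual_norm:
  fixes N :: "'a::euclidean_space \<Rightarrow> real"
  assumes N: "is_norm N"
  shows "continuous_on S (dual_norm N)"
proof -
  obtain C where C: "0 < C" "\<And>y. dual_norm N y \<le> C * norm y" using dual_norm_le_norm[OF N] by blast
  have *: "dual_norm N x - dual_norm N y \<le> C * norm (x - y)" for x y
    using dual_norm_add[OF N, of "x - y" y] C(2)[of "x - y"] by simp
  have "C-lipschitz_on S (dual_norm N)"
  proof (rule lipschitz_onI)
    fix x y show "dist (dual_norm N x) (dual_norm N y) \<le> C * dist x y"
      using *[of x y] *[of y x] norm_minus_commute[of x y] by (simp add: dist_norm abs_le_iff)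
  qed (use C in simp)
  then show ?thesis by (rule lipschitz_on_continuous_on)
qed

section \<open>Young's inequality and the choice of scales\<close>

lemma has_real_derivative_abs_powr:
  fixes t r :: real
  assumes r: "1 < r"
  shows "((\<lambda>t. \<bar>t\<bar> powr r) has_field_derivative r * sgn t * \<bar>t\<bar> powr (r - 1)) (at t)"
proof (cases t rule: linorder_cases[of _ "0::real"])
  case equal
  have "((\<lambda>h. \<bar>h\<bar> powr (r - 1)) \<longlongrightarrow> 0) (at 0)"
    using r by (auto intro!: tendsto_eq_intros)
  then have "((\<lambda>h. (\<bar>h\<bar> powr r) / \<bar>h\<bar>) \<longlongrightarrow> 0) (at (0::real))"
    by (rule Lim_transform_eventually)
       (auto simp: eventually_at powr_diff intro!: exI[of _ 1])
  then have "((\<lambda>h. (\<bar>h\<bar> powr r) / h) \<longlongrightarrow> 0) (at (0::real))"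
    by (subst tendsto_rabs_zero_iff[symmetric]) (simp add: abs_divide)
  then show ?thesis using equal by (simp add: has_field_derivative_iff)
next
  case less
  have "((\<lambda>t. (- t) powr r) has_field_derivative r * sgn t * \<bar>t\<bar> powr (r - 1)) (at t)"
    using less by (auto intro!: derivative_eq_intros simp: powr_diff)
  then show ?thesis
    by (rule has_field_derivative_transform_within_open[where S = "{..<0}"]) (use less in auto)
next
  case greater
  have "((\<lambda>t. t powr r) has_field_derivative r * sgn t * \<bar>t\<bar> powr (r - 1)) (at t)"
    using greater by (auto intro!: derivative_eq_intros simp: powr_diff)
  then show ?thesis
    by (rule has_field_derivative_transform_within_open[where S = "{0<..}"]) (use greater in auto)
qed

lemma Young_powr:
  fixes s X Y c p a :: real
  assumes p: "1 < p" "p < a" and nn: "0 \<le> s" "0 \<le> X" "0 \<le> Y" "0 < c"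
  defines "q \<equiv> p / (p - 1)" and "r \<equiv> p * ((a - 1) / (a - p))"
  shows "r * s powr (r - 1) * (X * Y) \<le>
    (a - 1) / p * (p / (a - p)) powr p * c powr (1 - p) * X powr p +
    (a - 1) * (s powr r) powr (a / (a - 1)) * (c * (Y powr q / q))"
proof -
  have q: "1 < q" "1 / p + 1 / q = 1" using p by (auto simp: q_def field_simps)
  \<comment> \<open>The powers of \<open>c\<close> cancel in the product, and
    \<open>p / (a - p)\<close> turns the factor \<open>a - 1\<close> into \<open>r\<close>. The
    identity \<open>(r - 1) * q = r * (a / (a - 1))\<close> makes the second power the source
    density times the weight.\<close>
  let ?A = "p / (a - p) * X * c powr (- (1 / q))" and ?B = "s powr (r - 1) * c powr (1 / q) * Y"
  have "?A * ?B \<le> ?A powr p / p + ?B powr q / q"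
    using p q nn by (intro Youngs_inequality) auto
  then have "(a - 1) * (?A * ?B) \<le> (a - 1) * (?A powr p / p + ?B powr q / q)"
    using p by (intro mult_left_mono) auto
  moreover have "(a - 1) * (?A * ?B) = r * s powr (r - 1) * (X * Y)"
  proof -
    have "(a - 1) * (?A * ?B) = ((a - 1) * (p / (a - p))) * (s powr (r - 1) * (X * Y)) * (c powr (- (1 / q)) * c powr (1 / q))"
      by (simp only: mult_ac)
    also have "c powr (- (1 / q)) * c powr (1 / q) = 1" using nn by (simp add: powr_add[symmetric])
    also have "(a - 1) * (p / (a - p)) = r" by (simp add: r_def)
    finally show ?thesis by simp
  qed
  moreover have "?A powr p = (p / (a - p)) powr p * X powr p * c powr (1 - p)"
  proof -
    have "- (1 / q) * p = 1 - p" using p by (simp add: q_def)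
    then show ?thesis using p nn by (simp add: powr_mult powr_powr del: times_divide_eq_left times_divide_eq_right)
  qed
  moreover have "?B powr q = (s powr r) powr (a / (a - 1)) * c * Y powr q"
  proof -
    have "(r - 1) * q = r * (a / (a - 1))" using p by (simp add: q_def r_def divide_simps) (simp add: algebra_simps)
    then show ?thesis using p q nn by (simp add: powr_mult powr_powr)
  qed
  ultimately show ?thesis by (simp add: algebra_simps add_divide_distrib diff_divide_distrib)
qed

text \<open>\<open>\<tau>\<close> may be chosen, but the \<open>x\<close> that comes with it may
  not: in the application it is fixed by mass balance. So Young's inequality with the conjugate
  exponents \<open>(a - 1) / (p - 1)\<close> and \<open>(a - 1) / (a - p)\<close> bounds the terms
  in \<open>x\<close> by their supremum, and the remaining function of \<open>\<tau>\<close> is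
  optimised. \<open>\<kappa>\<close> measures the truncation of the target and will tend to
  1.\<close>

lemma powr_optimisation:
  fixes B K0 \<kappa> \<iota> \<gamma> p a m :: real
  assumes p: "1 < p" "p < m" "m \<le> a" and pos: "0 < K0" "0 < \<kappa>" "0 < \<iota>" "0 < \<gamma>"
    and H: "\<And>\<tau>. 0 < \<tau> \<Longrightarrow> \<exists>x>0. B + \<tau> powr (a - m) * x powr (a - 1) * (\<kappa> * K0) \<le>
       \<tau> * (a - m) * (\<iota> * K0) + x powr (p - 1) * ((a - 1) / (p - 1) * (\<gamma> * K0))"
  defines "\<theta> \<equiv> (a - p) / (p * (a - m) + m - p)"
  shows "B \<le> K0 * ((a - m) + \<kappa> powr (- ((p - 1) / (a - p))) * ((a - p) / (p - 1))) *
    (\<iota> powr (1 - \<theta>) * \<gamma> powr (\<theta> * ((a - 1) / (a - p))))"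
proof -
  define \<beta> \<alpha> \<eta> where "\<beta> = (a - 1) / (a - p)" and "\<alpha> = (a - 1) / (p - 1)"
    and "\<eta> = (a - m) * (p - 1) / (a - p)"
  have den: "0 < p * (a - m) + m - p" using p by (simp add: add_nonneg_pos add_diff_eq[symmetric])
  have \<theta>: "0 < \<theta>" unfolding \<theta>_def using p den by simp
  have \<theta>\<eta>: "(1 + \<eta>) * \<theta> = 1"
  proof -
    have "1 + \<eta> = (p * (a - m) + m - p) / (a - p)" using p by (simp add: \<eta>_def divide_simps) (simp add: algebra_simps)
    then show ?thesis using p den by (simp add: \<theta>_def)
  qed
  \<comment> \<open>For \<open>\<kappa> = 1\<close> this minimises the bound, whose terms are
    \<open>(a - m) * \<tau> * \<iota>\<close> and \<open>(\<alpha> - 1) * \<gamma> powr \<beta> *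
    \<tau> powr (- \<eta>)\<close>, because \<open>(\<alpha> - 1) * \<eta> = a - m\<close>.\<close>
  define \<tau> where "\<tau> = (\<gamma> powr \<beta> / \<iota>) powr \<theta>"
  have \<tau>: "0 < \<tau>" using pos by (simp add: \<tau>_def)
  obtain x where x: "0 < x" "B + \<tau> powr (a - m) * x powr (a - 1) * (\<kappa> * K0) \<le>
       \<tau> * (a - m) * (\<iota> * K0) + x powr (p - 1) * ((a - 1) / (p - 1) * (\<gamma> * K0))"
    using H[OF \<tau>] by blast
  define k where "k = \<tau> powr (a - m) * \<kappa>"
  have k: "0 < k" using \<tau> pos by (simp add: k_def)
  have \<alpha>\<beta>: "1 < \<alpha>" "1 < \<beta>" "1 / \<alpha> + 1 / \<beta> = 1" "\<alpha> / \<beta> = \<alpha> - 1" "\<beta> / \<alpha> = (p - 1) / (a - p)"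
  proof -
    have nz: "a \<noteq> 1" "p \<noteq> 1" "a \<noteq> p" using p by auto
    show "1 < \<alpha>" "1 < \<beta>" using p by (auto simp: \<alpha>_def \<beta>_def)
    show "1 / \<alpha> + 1 / \<beta> = 1" using nz by (simp add: \<alpha>_def \<beta>_def add_divide_distrib[symmetric])
    show "\<alpha> / \<beta> = \<alpha> - 1" using nz by (simp add: \<alpha>_def \<beta>_def diff_divide_distrib[symmetric] divide_diff_eq_iff)
    show "\<beta> / \<alpha> = (p - 1) / (a - p)" using nz by (simp add: \<alpha>_def \<beta>_def)
  qed
  \<comment> \<open>The factor \<open>k powr (1 / \<alpha>)\<close> is chosen so that
    \<open>?u powr \<alpha>\<close> is exactly the term in \<open>x\<close> on the left of the
    hypothesis.\<close>
  let ?u = "x powr (p - 1) * k powr (1 / \<alpha>)" and ?v = "\<gamma> * k powr (- (1 / \<alpha>))"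
  have "?u * ?v \<le> ?u powr \<alpha> / \<alpha> + ?v powr \<beta> / \<beta>"
    using \<alpha>\<beta> x k pos by (intro Youngs_inequality) auto
  then have "\<alpha> * (?u * ?v) \<le> \<alpha> * (?u powr \<alpha> / \<alpha> + ?v powr \<beta> / \<beta>)"
    using \<alpha>\<beta> by (intro mult_left_mono) auto
  also have "\<dots> = ?u powr \<alpha> + (\<alpha> / \<beta>) * ?v powr \<beta>"
    using \<alpha>\<beta>(1) by (simp add: distrib_left)
  also have "\<alpha> / \<beta> = \<alpha> - 1" by (rule \<alpha>\<beta>(4))
  also have "?u * ?v = x powr (p - 1) * \<gamma>" using k by (simp add: powr_minus field_simps)
  also have "?u powr \<alpha> = x powr (a - 1) * k"
    using x k \<alpha>\<beta> p by (simp add: powr_mult powr_powr) (simp add: \<alpha>_def)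
  also have "?v powr \<beta> = \<gamma> powr \<beta> * k powr (- ((p - 1) / (a - p)))"
    using pos k \<alpha>\<beta>(5) by (simp add: powr_mult powr_powr)
  also have "k powr (- ((p - 1) / (a - p))) = \<tau> powr (- \<eta>) * \<kappa> powr (- ((p - 1) / (a - p)))"
    using \<tau> pos by (simp add: k_def powr_mult powr_powr \<eta>_def)
  finally have Y: "\<alpha> * (x powr (p - 1) * \<gamma>) - x powr (a - 1) * k \<le>
      (\<alpha> - 1) * (\<gamma> powr \<beta> * \<tau> powr (- \<eta>)) * \<kappa> powr (- ((p - 1) / (a - p)))" by (simp add: algebra_simps)
  have V1: "\<gamma> powr \<beta> * \<tau> powr (- \<eta>) = \<tau> * \<iota>"
  proof -
    have "\<tau> powr (1 + \<eta>) = \<gamma> powr \<beta> / \<iota>"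
      using pos \<theta>\<eta> unfolding \<tau>_def by (simp add: powr_powr mult.commute)
    then show ?thesis using \<tau> pos by (simp add: powr_add powr_minus field_simps)
  qed
  have V2: "\<tau> * \<iota> = \<iota> powr (1 - \<theta>) * \<gamma> powr (\<theta> * \<beta>)"
    unfolding \<tau>_def using pos by (simp add: powr_divide powr_powr powr_diff mult.commute)
  have "B \<le> K0 * (\<tau> * (a - m) * \<iota> + (\<alpha> * (x powr (p - 1) * \<gamma>) - x powr (a - 1) * k))"
    using x(2) by (simp add: k_def \<alpha>_def algebra_simps)
  also have "\<dots> \<le> K0 * (\<tau> * (a - m) * \<iota> + (\<alpha> - 1) * (\<tau> * \<iota>) * \<kappa> powr (- ((p - 1) / (a - p))))"
    using Y pos unfolding V1 by (intro mult_left_mono add_left_mono) auto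
  also have "\<dots> = K0 * ((a - m) + \<kappa> powr (- ((p - 1) / (a - p))) * (\<alpha> - 1)) * (\<tau> * \<iota>)"
    by (simp add: algebra_simps)
  also have "\<alpha> - 1 = (a - p) / (p - 1)" using p by (simp add: \<alpha>_def field_simps)
  finally show ?thesis unfolding V2 by (simp add: \<beta>_def)
qed

text \<open>The inequality before optimisation, for \<open>\<psi>\<close> vanishing outside a box:
  \<open>transport_halfspace\<close> with weight \<open>c * W0\<close>. The witness \<open>x\<close>
  is \<open>1 / c\<close>, where \<open>c\<close> rescales the weight until source and target masses
  match.\<close>

lemma halfspace_core:
  fixes \<psi> N :: "real \<times> 'b::euclidean_space \<Rightarrow> real" and D :: "real \<times> 'b \<Rightarrow> real \<times> 'b" and R a p \<tau> :: real
  defines "n \<equiv> DIM(real \<times> 'b)" and "q \<equiv> p / (p - 1)" and "r \<equiv> p * ((a - 1) / (a - p))"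
  defines "X \<equiv> cbox (- (R *\<^sub>R One)) (R *\<^sub>R One) :: 'b set"
  defines "A \<equiv> {0..R} \<times> X" and "Q \<equiv> {1..R} \<times> X"
  assumes N: "is_norm N" and p: "1 < p" "p < n" "real n \<le> a" and R: "1 < R" and \<tau>: "0 < \<tau>"
    and \<psi>: "\<And>z. 0 \<le> fst z \<Longrightarrow> 0 \<le> \<psi> z" "\<And>z. 0 \<le> fst z \<Longrightarrow> (\<psi> has_derivative (\<lambda>v. v \<bullet> D z)) (at z)"
    and D: "continuous_on {z. 0 \<le> fst z} D"
    and vanish: "\<And>z b. 0 \<le> fst z \<Longrightarrow> b \<in> Basis \<Longrightarrow> R \<le> \<bar>z \<bullet> b\<bar> \<Longrightarrow> \<psi> z = 0"
    and ne: "\<exists>z. 0 \<le> fst z \<and> \<psi> z \<noteq> 0"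
  shows "\<exists>x>0. integral X (\<lambda>x. \<psi> (0, x) powr r) +
      \<tau> powr (a - n) * x powr (a - 1) * integral Q (\<lambda>y. (N y powr q / q) powr (1 - a)) \<le>
     \<tau> * (a - n) * integral A (\<lambda>z. \<psi> z powr r) +
     x powr (p - 1) * ((a - 1) / p * (p / (a - p)) powr p * integral A (\<lambda>z. dual_norm N (D z) powr p))"
proof -
  let ?H = "{z :: real \<times> 'b. 0 \<le> fst z}"
  have pa: "1 < p" "p < a" "1 < a" using p by auto
  have r: "1 < r" unfolding r_def
  proof -
    have "1 * (a - 1) < p * (a - 1)" using pa by (intro mult_strict_right_mono) auto
    then have "a - p < p * (a - 1)" using pa by (simp add: algebra_simps)
    then show "1 < p * ((a - 1) / (a - p))" using pa by (simp add: field_simps)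
  qed
  have q: "1 < q" using p by (auto simp: q_def field_simps)
  have c\<psi>: "continuous_on ?H \<psi>"
    by (auto intro!: continuous_at_imp_continuous_on has_derivative_continuous[OF \<psi>(2)])
  obtain \<delta> where \<delta>: "0 < \<delta>" "\<And>x. \<delta> * norm x \<le> N x" using is_norm_ge_norm[OF N] by blast
  have N\<delta>: "\<delta> \<le> N y" if "1 \<le> fst y" for y
  proof -
    have "1 \<le> norm y" using that norm_fst_le[of "fst y" "snd y"] by simp
    then have "\<delta> * 1 \<le> \<delta> * norm y" using \<delta> by (intro mult_left_mono) auto
    then show ?thesis using \<delta>(2)[of y] by simp
  qed
  \<comment> \<open>\<open>N\<close> vanishes at the origin, while the weight has to be positive
    everywhere. On the target region \<open>1 \<le> fst y\<close> the truncation at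
    \<open>\<delta>\<close> changes nothing.\<close>
  define W0 where "W0 y = max \<delta> (N y) powr q / q" for y
  have W0: "continuous_on UNIV W0" "0 < W0 y" for y
    unfolding W0_def using \<delta> q
    by (auto intro!: continuous_intros continuous_on_powr' continuous_on_is_norm[OF N])
  have W0_N: "W0 y = N y powr q / q" if "1 \<le> fst y" for y
    using N\<delta>[OF that] by (simp add: W0_def max_def)
  \<comment> \<open>Off the half-space \<open>\<psi>\<close> may be negative. As
    \<open>r > 1\<close>, the power of the absolute value is differentiable at every point of the
    closed half-space, zeros of \<open>\<psi>\<close> included.\<close>
  define \<phi> where "\<phi> z = \<bar>\<psi> z\<bar> powr r" for z
  have \<phi>\<psi>: "\<phi> z = \<psi> z powr r" if "0 \<le> fst z" for z using \<psi>(1)[OF that] by (simp add: \<phi>_def)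
  define \<phi>' where "\<phi>' b z = r * sgn (\<psi> z) * \<bar>\<psi> z\<bar> powr (r - 1) * (b \<bullet> D z)" for b z
  have \<phi>'_eq: "\<phi>' b z = r * \<psi> z powr (r - 1) * (b \<bullet> D z)" if "0 \<le> fst z" for b z
    using \<psi>(1)[OF that] by (cases "\<psi> z = 0") (auto simp: \<phi>'_def)
  have c\<phi>: "continuous_on ?H \<phi>"
    unfolding \<phi>_def using r by (intro continuous_on_powr' continuous_intros c\<psi>) auto
  have c\<phi>': "continuous_on ?H (\<phi>' b)" for b
  proof -
    have "continuous_on ?H (\<lambda>z. r * \<psi> z powr (r - 1) * (b \<bullet> D z))"
      using r \<psi>(1) by (intro continuous_on_powr' continuous_intros c\<psi> D) auto
    then show ?thesis using \<phi>'_eq by (subst continuous_on_cong[OF refl]) auto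
  qed
  have cA: "A = cbox (0, - (R *\<^sub>R One)) (R, R *\<^sub>R One)" and cQ: "Q = cbox (1, - (R *\<^sub>R One)) (R, R *\<^sub>R One)"
    by (auto simp: A_def X_def Q_def cbox_Pair_eq)
  have AH: "A \<subseteq> ?H" "\<And>z. z \<in> A \<Longrightarrow> 0 \<le> fst z" "\<And>z. z \<in> Q \<Longrightarrow> 1 \<le> fst z" by (auto simp: A_def Q_def)
  have neA: "box (0, - (R *\<^sub>R One)) (R, R *\<^sub>R (One::'b)) \<noteq> {}" and neQ: "box (1, - (R *\<^sub>R One)) (R, R *\<^sub>R (One::'b)) \<noteq> {}"
    using R by (auto simp: box_ne_empty Basis_prod_def)
  have apos: "0 < a / (a - 1)" using pa by simp
  let ?M = "integral A (\<lambda>z. \<phi> z powr (a / (a - 1)))"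
  have c\<rho>: "continuous_on A (\<lambda>z. \<phi> z powr (a / (a - 1)))"
    using apos by (intro continuous_on_powr' continuous_intros continuous_on_subset[OF c\<phi> AH(1)]) (auto simp: \<phi>_def)
  have M: "0 < ?M"
  proof -
    obtain z where z: "0 \<le> fst z" "\<psi> z \<noteq> 0" using ne by blast
    have "\<bar>z \<bullet> b\<bar> < R" if "b \<in> Basis" for b using vanish[OF z(1) that] z(2) by (meson not_le)
    note zb = this[of "(1, 0)"] this[of "(0, b)" for b]
    have "fst z < R" using zb(1) z(1) by (auto simp: Basis_prod_def inner_prod_def)
    moreover have "\<bar>snd z \<bullet> b\<bar> < R" if "b \<in> Basis" for b
      using zb(2)[of b] that by (auto simp: Basis_prod_def inner_prod_def)
    ultimately have "fst z \<in> {0..R}" "snd z \<in> X" using z(1) unfolding X_def mem_box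
      by (auto simp: abs_less_iff less_imp_le minus_less_iff intro: less_imp_le)
    then have zA: "z \<in> A" by (cases z) (auto simp: A_def)
    have "?M \<noteq> 0"
    proof
      assume "?M = 0"
      then have "\<phi> z powr (a / (a - 1)) = 0"
        using integral_cbox_eq_0_iff[OF c\<rho>[unfolded cA] neA] zA unfolding cA by auto
      then show False using z by (simp add: \<phi>_def)
    qed
    moreover have "0 \<le> ?M"
      using c\<rho> unfolding cA by (intro Henstock_Kurzweil_Integration.integral_nonneg integrable_continuous) auto
    ultimately show ?thesis by simp
  qed
  have cW0: "continuous_on S (\<lambda>y. W0 y powr t)" for S t
    using W0(2) by (intro continuous_on_powr' continuous_intros continuous_on_subset[OF W0(1)]) (auto simp: less_le)
  let ?m = "integral Q (\<lambda>y. W0 y powr (- a))"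
  have m: "0 < ?m"
  proof -
    have "?m \<noteq> 0"
    proof
      assume "?m = 0"
      then have "\<forall>y\<in>Q. W0 y powr (- a) = 0"
        using integral_cbox_eq_0_iff[OF cW0 neQ] unfolding cQ by auto
      moreover obtain y where "y \<in> Q" using neQ box_subset_cbox unfolding cQ by blast
      ultimately show False using W0(2)[of y] by auto
    qed
    moreover have "0 \<le> ?m"
      using cW0 unfolding cQ by (intro Henstock_Kurzweil_Integration.integral_nonneg integrable_continuous) auto
    ultimately show ?thesis by simp
  qed
  \<comment> \<open>Solves the mass balance: passing from \<open>W0\<close> to \<open>c * W0\<close>
    multiplies the target mass by \<open>c powr (- a)\<close>.\<close>
  define c where "c = (\<tau> powr (a - n) * ?m / ?M) powr (1 / a)"
  have c: "0 < c" using \<tau> m M by (simp add: c_def)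
  have ca: "c powr a = \<tau> powr (a - n) * ?m / ?M" using pa \<tau> m M by (simp add: c_def powr_powr)
  define C where "C = (a - 1) / p * (p / (a - p)) powr p"
  have C: "0 \<le> C" using pa by (simp add: C_def)
  define J where "J z = C * c powr (1 - p) * dual_norm N (D z) powr p" for z
  have main: "\<tau> powr (a - n) * integral Q (\<lambda>y. (c * W0 y) powr (1 - a)) + integral X (\<lambda>x. \<phi> (0, x))
     \<le> \<tau> * (a - n) * integral A \<phi> + integral A J"
    unfolding n_def Q_def A_def X_def
  proof (rule transport_halfspace[where \<phi>' = \<phi>'])
    show "continuous_on UNIV (\<lambda>y. c * W0 y)" using W0 by (intro continuous_intros)
    show "continuous_on ?H J" unfolding J_def using pa
      by (intro continuous_on_powr' continuous_intros continuous_on_compose2[OF continuous_on_dual_norm[OF N, of UNIV] D])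
         (auto simp: dual_norm_nonneg[OF N])
    show "0 \<le> J z" for z unfolding J_def using C by simp
    show "\<phi> z = 0" if "0 \<le> fst z" "b \<in> Basis" "R \<le> \<bar>z \<bullet> b\<bar>" for z b
      using vanish[OF that] by (simp add: \<phi>_def)
  next
    fix z b :: "real \<times> 'b" assume z: "0 \<le> fst z" and b: "b \<in> Basis"
    have sz: "set_coord b (z \<bullet> b) z = z" by (simp add: set_coord_def)
    have "((\<lambda>t. \<psi> (set_coord b t z)) has_derivative (\<lambda>h. (h *\<^sub>R b) \<bullet> D z)) (at (z \<bullet> b))"
      by (rule has_derivative_compose[of "\<lambda>t. set_coord b t z" "\<lambda>h. h *\<^sub>R b" "z \<bullet> b" UNIV, unfolded sz])
         (use \<psi>(2)[OF z] in \<open>auto simp: set_coord_def intro!: derivative_eq_intros\<close>)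
    then have "((\<lambda>t. \<psi> (set_coord b t z)) has_field_derivative b \<bullet> D z) (at (z \<bullet> b))"
      by (simp add: has_field_derivative_def mult_commute_abs)
    from DERIV_chain2[OF has_real_derivative_abs_powr[OF r] this]
    have "((\<lambda>t. \<phi> (set_coord b t z)) has_field_derivative \<phi>' b z) (at (z \<bullet> b))"
      by (simp add: \<phi>_def \<phi>'_def sz)
    then show "((\<lambda>t. \<phi> (set_coord b t z)) has_field_derivative \<phi>' b z) (at (z \<bullet> b) within (if b = (1, 0) then {0..} else UNIV))"
      by (rule has_field_derivative_at_within)
  next
    fix z y :: "real \<times> 'b" assume z: "0 \<le> fst z" and y: "1 \<le> fst y"
    have "(\<Sum>b\<in>Basis. \<phi>' b z * (y \<bullet> b)) = r * \<psi> z powr (r - 1) * (\<Sum>b\<in>Basis. (D z \<bullet> b) * (y \<bullet> b))"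
      unfolding \<phi>'_eq[OF z] by (simp add: sum_distrib_left mult_ac inner_commute)
    also have "(\<Sum>b\<in>Basis. (D z \<bullet> b) * (y \<bullet> b)) = y \<bullet> D z"
      by (subst inner_commute) (rule euclidean_inner[symmetric])
    finally have "- (\<Sum>b\<in>Basis. \<phi>' b z * (y \<bullet> b)) = r * \<psi> z powr (r - 1) * ((- y) \<bullet> D z)" by simp
    also have "\<dots> \<le> r * \<psi> z powr (r - 1) * (N (- y) * dual_norm N (D z))"
      using r by (intro mult_left_mono inner_le_dual_norm N) auto
    also have "\<dots> = r * \<psi> z powr (r - 1) * (dual_norm N (D z) * N y)" by (simp add: is_normD(5)[OF N])
    also have "\<dots> \<le> C * c powr (1 - p) * dual_norm N (D z) powr p +
        (a - 1) * (\<psi> z powr r) powr (a / (a - 1)) * (c * (N y powr q / q))"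
      unfolding r_def q_def C_def
      using pa \<psi>(1)[OF z] c by (intro Young_powr dual_norm_nonneg[OF N] is_normD(1)[OF N])
    finally show "- (\<Sum>b\<in>Basis. \<phi>' b z * (y \<bullet> b)) - (a - 1) * \<phi> z powr (a / (a - 1)) * (c * W0 y) \<le> J z"
      by (simp add: J_def W0_N[OF y] \<phi>\<psi>[OF z])
  next
    have "integral Q (\<lambda>y. (c * W0 y) powr (- a)) = integral Q (\<lambda>y. c powr (- a) * W0 y powr (- a))"
      using c W0(2) by (simp add: powr_mult less_imp_le)
    also have "\<dots> = c powr (- a) * ?m" by simp
    finally have "\<tau> powr (a - n) * integral Q (\<lambda>y. (c * W0 y) powr (- a)) = ?M"
      using c \<tau> m M ca by (simp add: powr_minus field_simps)
    then show "\<tau> powr (a - DIM(real \<times> 'b)) * integral ({1..R} \<times> cbox (- (R *\<^sub>R One)) (R *\<^sub>R One)) (\<lambda>y. (c * W0 y) powr (- a))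
       = integral ({0..R} \<times> cbox (- (R *\<^sub>R One)) (R *\<^sub>R One)) (\<lambda>z. \<phi> z powr (a / (a - 1)))"
      unfolding n_def A_def X_def Q_def by simp
  qed (use p R \<tau> c W0 c\<phi> c\<phi>' in \<open>auto simp: n_def \<phi>_def\<close>)
  have "integral Q (\<lambda>y. (c * W0 y) powr (1 - a)) = integral Q (\<lambda>y. c powr (1 - a) * (N y powr q / q) powr (1 - a))"
    using c W0(2) by (intro integral_cong) (simp add: powr_mult less_imp_le W0_N[OF AH(3), symmetric])
  also have "\<dots> = c powr (1 - a) * integral Q (\<lambda>y. (N y powr q / q) powr (1 - a))" by simp
  finally have eQ: "integral Q (\<lambda>y. (c * W0 y) powr (1 - a)) = c powr (1 - a) * integral Q (\<lambda>y. (N y powr q / q) powr (1 - a))" .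
  have eX: "integral X (\<lambda>x. \<phi> (0, x)) = integral X (\<lambda>x. \<psi> (0, x) powr r)"
    by (rule integral_cong) (simp add: \<phi>\<psi>)
  have eA: "integral A \<phi> = integral A (\<lambda>z. \<psi> z powr r)"
    by (rule integral_cong) (simp add: \<phi>\<psi> AH(2))
  have eJ: "integral A J = C * c powr (1 - p) * integral A (\<lambda>z. dual_norm N (D z) powr p)"
    unfolding J_def by simp
  show ?thesis
  proof (intro exI conjI)
    show "0 < 1 / c" using c by simp
    have "(1 / c) powr t = c powr (- t)" for t
      using c by (simp add: powr_def ln_div)
    from this[of "a - 1"] this[of "p - 1"]
    have "(1 / c) powr (a - 1) = c powr (1 - a)" "(1 / c) powr (p - 1) = c powr (1 - p)" by simp_all
    then show "integral X (\<lambda>x. \<psi> (0, x) powr r) +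
      \<tau> powr (a - n) * (1 / c) powr (a - 1) * integral Q (\<lambda>y. (N y powr q / q) powr (1 - a)) \<le>
     \<tau> * (a - n) * integral A (\<lambda>z. \<psi> z powr r) +
     (1 / c) powr (p - 1) * ((a - 1) / p * (p / (a - p)) powr p * integral A (\<lambda>z. dual_norm N (D z) powr p))"
      using main by (simp add: eQ eX eA eJ C_def algebra_simps)
  qed
qed

section \<open>Removing the compact support\<close>

lemma integral_cbox_eq_set_lebesgue_integral:
  fixes F :: "'a::euclidean_space \<Rightarrow> real"
  assumes "continuous_on (cbox a b) F"
  shows "set_integrable lborel (cbox a b) F" "integral (cbox a b) F = (LINT z:cbox a b|lborel. F z)"
proof -
  show *: "set_integrable lborel (cbox a b) F"
    using borel_integrable_compact[OF compact_cbox assms]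
    by (simp add: set_integrable_def indicator_scaleR_eq_if if_distrib cong: if_cong)
  show "integral (cbox a b) F = (LINT z:cbox a b|lborel. F z)"
    using set_borel_integral_eq_integral(2)[OF *] by simp
qed

text \<open>Two nested squared positive parts give a continuously differentiable function that is 1
  up to 1 and 0 from 2 on. One continuous derivative is what \<open>halfspace_core\<close> asks
  for.\<close>

definition cutoff :: "real \<Rightarrow> real" where
  "cutoff s = (max 0 (1 - (max 0 (s - 1))\<^sup>2))\<^sup>2"

definition cutoff_deriv :: "real \<Rightarrow> real" where
  "cutoff_deriv s = - 4 * max 0 (1 - (max 0 (s - 1))\<^sup>2) * max 0 (s - 1)"

lemma has_real_derivative_pos_part_sq:
  "((\<lambda>t. (max 0 t)\<^sup>2) has_field_derivative 2 * max 0 t) (at (t::real))"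
proof (cases t rule: linorder_cases[of _ "0::real"])
  case equal
  have "((\<lambda>h::real. max 0 h) \<longlongrightarrow> max 0 0) (at 0)" by (intro tendsto_intros)
  then have "((\<lambda>h::real. (max 0 h)\<^sup>2 / h) \<longlongrightarrow> 0) (at 0)"
    by (elim filterlim_mono_eventually) (auto simp: eventually_at max_def power2_eq_square intro!: exI[of _ 1])
  then show ?thesis using equal by (simp add: has_field_derivative_iff)
next
  case less
  have "((\<lambda>t. 0) has_field_derivative 2 * max 0 t) (at t)" using less by (simp add: max_def)
  then show ?thesis
    by (rule has_field_derivative_transform_within_open[where S = "{..<0}"]) (use less in \<open>auto simp: max_def\<close>)
next
  case greater
  have "((\<lambda>t. t\<^sup>2) has_field_derivative 2 * max 0 t) (at t)"
    using greater by (auto intro!: derivative_eq_intros simp: max_def)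
  then show ?thesis
    by (rule has_field_derivative_transform_within_open[where S = "{0<..}"]) (use greater in \<open>auto simp: max_def\<close>)
qed

lemma cutoff:
  "(cutoff has_field_derivative cutoff_deriv s) (at s)"
  "0 \<le> cutoff s" "cutoff s \<le> 1" "s \<le> 1 \<Longrightarrow> cutoff s = 1" "2 \<le> s \<Longrightarrow> cutoff s = 0"
  "\<bar>cutoff_deriv s\<bar> \<le> 4" "2 \<le> s \<Longrightarrow> cutoff_deriv s = 0" "continuous_on S cutoff_deriv"
proof -
  have 1: "((\<lambda>s. 1 - (max 0 (s - 1))\<^sup>2) has_field_derivative 0 - 2 * max 0 (s - 1) * 1) (at s)"
    by (intro DERIV_diff DERIV_const DERIV_chain2[OF has_real_derivative_pos_part_sq])
      (auto intro!: derivative_eq_intros)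
  show "(cutoff has_field_derivative cutoff_deriv s) (at s)"
    using DERIV_chain2[OF has_real_derivative_pos_part_sq 1]
    by (simp add: cutoff_def[abs_def] cutoff_deriv_def mult_ac)
  have w: "0 \<le> max 0 (1 - (max 0 (s - 1))\<^sup>2)" "max 0 (1 - (max 0 (s - 1))\<^sup>2) \<le> 1" by auto
  show "0 \<le> cutoff s" by (simp add: cutoff_def)
  show "cutoff s \<le> 1" unfolding cutoff_def using w by (intro power_le_one)
  show "cutoff s = 1" if "s \<le> 1" using that by (simp add: cutoff_def max_def)
  have large: "max 0 (1 - (max 0 (s - 1))\<^sup>2) = 0" if "1 \<le> s - 1" for s :: real
    using that power_mono[of 1 "s - 1" 2] by simp
  show "2 \<le> s \<Longrightarrow> cutoff s = 0" "2 \<le> s \<Longrightarrow> cutoff_deriv s = 0"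
    using large[of s] by (auto simp: cutoff_def cutoff_deriv_def)
  show "\<bar>cutoff_deriv s\<bar> \<le> 4"
  proof (cases "1 \<le> s - 1")
    case False
    then have "max 0 (1 - (max 0 (s - 1))\<^sup>2) * max 0 (s - 1) \<le> 1 * 1"
      using w by (intro mult_mono) auto
    then show ?thesis using w unfolding cutoff_deriv_def by (simp add: abs_mult)
  qed (simp add: large cutoff_deriv_def)
  show "continuous_on S cutoff_deriv"
    unfolding cutoff_deriv_def[abs_def] by (intro continuous_intros)
qed

text \<open>Convexity of the power at \<open>(1 - t) * (x / (1 - t)) + t * (y / t)\<close>. The
  point is the factor of \<open>x powr p\<close>: it tends to 1 with \<open>t\<close> tending to 0,
  so the sharp constant survives the cutoff.\<close>

lemma powr_add_le:
  fixes x y t p :: real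
  assumes "0 \<le> x" "0 \<le> y" "0 < t" "t < 1" "1 \<le> p"
  shows "(x + y) powr p \<le> (1 - t) powr (1 - p) * x powr p + t powr (1 - p) * y powr p"
proof -
  have ge1: "1 \<le> s powr (1 - p)" if "0 < s" "s < 1" for s :: real
    using that assms powr_mono2'[of "1 - p" s 1] by simp
  consider "x = 0" | "y = 0" | "0 < x" "0 < y" using assms by linarith
  then show ?thesis
  proof cases
    case 1
    then show ?thesis using ge1[of t] assms mult_right_mono[of 1 "t powr (1 - p)" "y powr p"] by simp
  next
    case 2
    then show ?thesis using ge1[of "1 - t"] assms mult_right_mono[of 1 "(1 - t) powr (1 - p)" "x powr p"] by simp
  next
    case 3
    have "((1 - t) * (x / (1 - t)) + t * (y / t)) powr p \<le>
       (1 - t) * (x / (1 - t)) powr p + t * (y / t) powr p"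
      using convex_onD[OF powr_convex[OF assms(5)], of t "x / (1 - t)" "y / t"] 3 assms by simp
    also have "\<dots> = (1 - t) powr (1 - p) * x powr p + t powr (1 - p) * y powr p"
      using 3 assms by (simp add: powr_divide powr_diff)
    finally show ?thesis using assms by simp
  qed
qed

text \<open>For \<open>s > A\<close> the first summand alone dominates, otherwise the
  second.\<close>

lemma powr_le_interpolate:
  fixes s A p r :: real
  assumes "0 \<le> s" "0 < A" "0 < p" "p \<le> r"
  shows "s powr p \<le> A powr (p - r) * s powr r + A powr p"
proof (cases "s \<le> A")
  case True
  then have "s powr p \<le> A powr p" using assms by (intro powr_mono2) auto
  then show ?thesis using assms by (simp add: add_increasing)
next
  case False
  then have "s powr p = s powr (p - r) * s powr r" using assms by (simp add: powr_add[symmetric])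
  also have "s powr (p - r) \<le> A powr (p - r)" using False assms by (intro powr_mono2') auto
  finally have "s powr p \<le> A powr (p - r) * s powr r" by (simp add: mult_right_mono)
  then show ?thesis using assms by (simp add: add_increasing2)
qed

text \<open>The squared norm keeps the function differentiable at the origin.\<close>

definition radial_cutoff :: "real \<Rightarrow> 'a::euclidean_space \<Rightarrow> real" where
  "radial_cutoff k z = cutoff ((norm z)\<^sup>2 / k\<^sup>2)"

definition radial_cutoff_grad :: "real \<Rightarrow> 'a::euclidean_space \<Rightarrow> 'a" where
  "radial_cutoff_grad k z = (cutoff_deriv ((norm z)\<^sup>2 / k\<^sup>2) * (2 / k\<^sup>2)) *\<^sub>R z"

lemma radial_cutoff:
  fixes z :: "'a::euclidean_space"
  assumes k: "0 < k"
  shows "(radial_cutoff k has_derivative (\<lambda>v. v \<bullet> radial_cutoff_grad k z)) (at z)"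
    "0 \<le> radial_cutoff k z" "radial_cutoff k z \<le> 1" "norm z \<le> k \<Longrightarrow> radial_cutoff k z = 1"
    "2 * k \<le> norm z \<Longrightarrow> radial_cutoff k z = 0"
    "norm (radial_cutoff_grad k z) \<le> 16 / k"
    "continuous_on S (radial_cutoff_grad k :: 'a \<Rightarrow> 'a)"
proof -
  have "((\<lambda>z. inverse (k\<^sup>2) * (z \<bullet> z)) has_derivative (\<lambda>v. inverse (k\<^sup>2) * (z \<bullet> v + v \<bullet> z))) (at z)"
    by (intro derivative_intros)
  then have "((\<lambda>z. z \<bullet> z / k\<^sup>2) has_derivative (\<lambda>v. (2 * (v \<bullet> z)) / k\<^sup>2)) (at z)"
    by (simp add: inner_commute divide_inverse mult_ac)
  from has_derivative_compose[OF this, of cutoff "(*) (cutoff_deriv (z \<bullet> z / k\<^sup>2))"]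
  show "(radial_cutoff k has_derivative (\<lambda>v. v \<bullet> radial_cutoff_grad k z)) (at z)"
    using cutoff(1) by (simp add: radial_cutoff_def[abs_def] radial_cutoff_grad_def has_field_derivative_def
      power2_norm_eq_inner mult_ac)
  show "0 \<le> radial_cutoff k z" "radial_cutoff k z \<le> 1" by (auto simp: radial_cutoff_def cutoff)
  show "radial_cutoff k z = 1" if "norm z \<le> k" unfolding radial_cutoff_def using that k
    by (intro cutoff) (simp add: power_mono)
  have large: "2 \<le> (norm z)\<^sup>2 / k\<^sup>2" if "2 * k \<le> norm z"
  proof -
    have "(2 * k)\<^sup>2 \<le> (norm z)\<^sup>2" using that k by (intro power_mono) auto
    then have "4 * k\<^sup>2 \<le> (norm z)\<^sup>2" by (simp add: power_mult_distrib)
    moreover have "2 * k\<^sup>2 \<le> 4 * k\<^sup>2" by (intro mult_right_mono) auto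
    ultimately have "2 * k\<^sup>2 \<le> (norm z)\<^sup>2" by (rule order_trans[rotated])
    then show ?thesis using k by (simp add: field_simps)
  qed
  then show "2 * k \<le> norm z \<Longrightarrow> radial_cutoff k z = 0" unfolding radial_cutoff_def by (auto intro: cutoff)
  show "norm (radial_cutoff_grad k z) \<le> 16 / k"
  proof (cases "2 * k \<le> norm z")
    case True
    then show ?thesis using cutoff(7)[OF large] k by (simp add: radial_cutoff_grad_def)
  next
    case False
    have "norm (radial_cutoff_grad k z) = \<bar>cutoff_deriv ((norm z)\<^sup>2 / k\<^sup>2)\<bar> * (2 / k\<^sup>2) * norm z"
      by (simp add: radial_cutoff_grad_def abs_mult)
    also have "\<dots> \<le> 4 * (2 / k\<^sup>2) * (2 * k)"
      using False k by (intro mult_mono cutoff) auto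
    also have "\<dots> = 16 / k" using k by (simp add: power2_eq_square)
    finally show ?thesis .
  qed
  show "continuous_on S (radial_cutoff_grad k :: 'a \<Rightarrow> 'a)"
    unfolding radial_cutoff_grad_def[abs_def] using k
    by (intro continuous_intros continuous_on_compose2[OF cutoff(8)[of UNIV]]) auto
qed

section \<open>Convergence of the truncated integrals\<close>

lemma continuous_on_dual_norm_powr:
  fixes N :: "'a::euclidean_space \<Rightarrow> real"
  assumes N: "is_norm N" and f: "continuous_on S f" and p: "0 < p"
  shows "continuous_on S (\<lambda>x. dual_norm N (f x) powr p)"
proof (rule continuous_on_powr')
  show "continuous_on S (\<lambda>x. dual_norm N (f x))"
    by (rule continuous_on_compose2[OF continuous_on_dual_norm[OF N] f]) auto
qed (use p dual_norm_nonneg[OF N] in auto)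

lemma set_lebesgue_integral_mono_set:
  fixes F :: "'a \<Rightarrow> real"
  assumes "set_integrable M B F" "A \<subseteq> B" "A \<in> sets M" "\<And>x. x \<in> B \<Longrightarrow> 0 \<le> F x"
  shows "(LINT z:A|M. F z) \<le> (LINT z:B|M. F z)"
  unfolding set_lebesgue_integral_def
proof (rule integral_mono)
  show "integrable M (\<lambda>z. indicator A z *\<^sub>R F z)"
    using set_integrable_subset[OF assms(1,3,2)] by (simp add: set_integrable_def)
qed (use assms in \<open>auto simp: set_integrable_def indicator_def\<close>)

text \<open>The error term of the cutoff vanishes in the limit because \<open>f\<close> lies in
  \<open>L\<^sup>r\<close> with \<open>n (r - p) < p r\<close>; splitting \<open>f\<close> at the level \<open>k powr (- \<alpha>)\<close> replaces Hoelder's inequality.\<close>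

lemma cutoff_gradient_limit:
  fixes g N :: "real \<times> 'b::euclidean_space \<Rightarrow> real" and D :: "real \<times> 'b \<Rightarrow> real \<times> 'b" and a p :: real
  defines "n \<equiv> DIM(real \<times> 'b)" and "r \<equiv> p * ((a - 1) / (a - p))" and "H \<equiv> {z. 0 \<le> fst z}"
  defines "A k \<equiv> {0..2 * k} \<times> cbox (- ((2 * k) *\<^sub>R One)) ((2 * k) *\<^sub>R One) :: (real \<times> 'b) set"
  assumes N: "is_norm N" and p: "1 < p" "p < n" "real n \<le> a"
    and g: "continuous_on H g" "\<And>z. z \<in> H \<Longrightarrow> 0 \<le> g z" and D: "continuous_on H D"
    and int: "set_integrable lborel H (\<lambda>z. dual_norm N (D z) powr p)" "set_integrable lborel H (\<lambda>z. g z powr r)"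
    and \<Gamma>': "(LINT z:H|lborel. dual_norm N (D z) powr p) < \<Gamma>'"
  shows "eventually (\<lambda>k. integral (A k) (\<lambda>z. dual_norm N (radial_cutoff k z *\<^sub>R D z + g z *\<^sub>R radial_cutoff_grad k z) powr p) \<le> \<Gamma>') at_top"
proof -
  define \<Gamma> I where "\<Gamma> = (LINT z:H|lborel. dual_norm N (D z) powr p)" and "I = (LINT z:H|lborel. g z powr r)"
  have \<Gamma>0: "0 \<le> \<Gamma>" unfolding \<Gamma>_def set_lebesgue_integral_def by (rule Bochner_Integration.integral_nonneg) auto
  have pr: "0 < p" "p \<le> r" "r - p = p * (p - 1) / (a - p)"
  proof -
    show "0 < p" using p by simp
    show "r - p = p * (p - 1) / (a - p)" using p by (simp add: r_def field_simps)
    moreover have "0 \<le> p * (p - 1) / (a - p)" using p by (intro divide_nonneg_nonneg mult_nonneg_nonneg) auto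
    ultimately show "p \<le> r" by linarith
  qed
  obtain C where C: "0 < C" "\<And>y. dual_norm N y \<le> C * norm y" using dual_norm_le_norm[OF N] by blast
  \<comment> \<open>\<open>t\<close> is the parameter of \<open>powr_add_le\<close>, the inner power
    of \<open>k\<close> is the level at which \<open>g\<close> is split, and
    \<open>(4 * k) ^ n\<close> bounds the volume of \<open>A k\<close>.\<close>
  define E where "E t k = (1 - t) powr (1 - p) * \<Gamma> + t powr (1 - p) * ((C * 16 / k) powr p *
      ((k powr (- ((n - p) * ((1 / p + 1 / (p - 1)) / 2)))) powr (p - r) * I +
       (k powr (- ((n - p) * ((1 / p + 1 / (p - 1)) / 2)))) powr p * (4 * k) ^ n))" for t k :: real
  have cA: "A k = cbox (0, - ((2 * k) *\<^sub>R One)) (2 * k, (2 * k) *\<^sub>R One)" for k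
    by (auto simp: A_def cbox_Pair_eq)
  have AH: "A k \<subseteq> H" for k by (auto simp: A_def H_def)
  have bound: "integral (A k) (\<lambda>z. dual_norm N (radial_cutoff k z *\<^sub>R D z + g z *\<^sub>R radial_cutoff_grad k z) powr p) \<le> E t k"
    if k: "0 < k" and t: "0 < t" "t < 1" for t k
  proof -
    define \<epsilon> where "\<epsilon> = k powr (- ((n - p) * ((1 / p + 1 / (p - 1)) / 2)))"
    have \<epsilon>: "0 < \<epsilon>" using k by (simp add: \<epsilon>_def)
    let ?F = "\<lambda>z. dual_norm N (radial_cutoff k z *\<^sub>R D z + g z *\<^sub>R radial_cutoff_grad k z) powr p"
    let ?G = "\<lambda>z. (1 - t) powr (1 - p) * dual_norm N (D z) powr p +
        t powr (1 - p) * ((C * 16 / k) powr p * (\<epsilon> powr (p - r) * g z powr r + \<epsilon> powr p))"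
    have le: "?F z \<le> ?G z" if z: "z \<in> A k" for z
    proof -
      have gz: "0 \<le> g z" using g(2) AH z by blast
      have d: "dual_norm N (radial_cutoff_grad k z) \<le> C * (16 / k)"
        using C(1) radial_cutoff(6)[OF k, of z] by (intro order_trans[OF C(2)] mult_left_mono) auto
      have "dual_norm N (radial_cutoff k z *\<^sub>R D z + g z *\<^sub>R radial_cutoff_grad k z) \<le>
        \<bar>radial_cutoff k z\<bar> * dual_norm N (D z) + \<bar>g z\<bar> * dual_norm N (radial_cutoff_grad k z)"
        using dual_norm_add[OF N] dual_norm_scaleR_le[OF N] by (meson add_mono order_trans)
      also have "\<dots> \<le> 1 * dual_norm N (D z) + g z * (C * (16 / k))"
        using gz radial_cutoff(2,3)[OF k, of z] d
        by (intro add_mono mult_mono) (auto simp: dual_norm_nonneg[OF N])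
      finally have "?F z \<le> (dual_norm N (D z) + g z * (C * (16 / k))) powr p"
        using p by (intro powr_mono2) (auto simp: dual_norm_nonneg[OF N])
      also have "\<dots> \<le> (1 - t) powr (1 - p) * dual_norm N (D z) powr p + t powr (1 - p) * (g z * (C * (16 / k))) powr p"
        using t p k C gz by (intro powr_add_le) (auto simp: dual_norm_nonneg[OF N])
      also have "(g z * (C * (16 / k))) powr p = (C * 16 / k) powr p * g z powr p"
        using gz C k by (simp add: powr_mult[symmetric] mult_ac)
      also have "g z powr p \<le> \<epsilon> powr (p - r) * g z powr r + \<epsilon> powr p"
        using gz \<epsilon> pr by (intro powr_le_interpolate) auto
      finally show ?thesis by (simp add: mult_left_mono)
    qed
    have cD: "continuous_on (A k) D" and cg': "continuous_on (A k) g"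
      using continuous_on_subset[OF D AH] continuous_on_subset[OF g(1) AH] by auto
    have cc: "continuous_on (A k) (radial_cutoff k)"
      by (intro continuous_at_imp_continuous_on ballI has_derivative_continuous[OF radial_cutoff(1)] k)
    have cF: "continuous_on (A k) ?F" and cN: "continuous_on (A k) (\<lambda>z. dual_norm N (D z) powr p)"
      using pr cc cD cg' radial_cutoff(7)[OF k, of "A k"]
      by (intro continuous_on_dual_norm_powr N continuous_on_add continuous_on_scaleR; simp)+
    have "0 \<le> g z" if "z \<in> A k" for z using g(2) AH that by blast
    then have cg: "continuous_on (A k) (\<lambda>z. g z powr r)"
      using pr by (intro continuous_on_powr' continuous_on_const cg') auto
    note ints = integrable_continuous[OF cN[unfolded cA]] integrable_continuous[OF cg[unfolded cA]]
    have "integral (A k) ?F \<le> integral (A k) ?G"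
    proof (rule integral_le)
      show "?F integrable_on A k" using cF unfolding cA by (rule integrable_continuous)
      have "continuous_on (A k) ?G"
        by (intro continuous_on_add continuous_on_mult_left continuous_on_const cN cg)
      then show "?G integrable_on A k" unfolding cA by (rule integrable_continuous)
    qed (use le in auto)
    also have "\<dots> = (1 - t) powr (1 - p) * integral (A k) (\<lambda>z. dual_norm N (D z) powr p) +
       t powr (1 - p) * ((C * 16 / k) powr p * (\<epsilon> powr (p - r) * integral (A k) (\<lambda>z. g z powr r) + measure lborel (A k) *\<^sub>R \<epsilon> powr p))"
      unfolding cA
      by (intro integral_unique has_integral_add has_integral_mult_right has_integral_const
            integrable_integral ints)
    also have "\<dots> \<le> E t k"
      unfolding E_def \<epsilon>_def[symmetric]
    proof (intro add_mono mult_left_mono)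
      show "integral (A k) (\<lambda>z. dual_norm N (D z) powr p) \<le> \<Gamma>" unfolding \<Gamma>_def
        unfolding cA integral_cbox_eq_set_lebesgue_integral(2)[OF cN[unfolded cA]]
        using AH[of k] unfolding cA by (intro set_lebesgue_integral_mono_set int) auto
      show "integral (A k) (\<lambda>z. g z powr r) \<le> I" unfolding I_def
        unfolding cA integral_cbox_eq_set_lebesgue_integral(2)[OF cg[unfolded cA]]
        using AH[of k] unfolding cA by (intro set_lebesgue_integral_mono_set int) auto
      have "(\<Prod>b\<in>Basis. ((2 * k) *\<^sub>R (One::'b) - - ((2 * k) *\<^sub>R One)) \<bullet> b) = (\<Prod>b\<in>(Basis::'b set). 4 * k)"
        by (rule prod.cong) (auto simp: inner_add_left)
      then have "measure lborel (A k) = (2 * k) * (4 * k) ^ DIM('b)"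
        using k unfolding cA
        by (subst content_Pair) (simp add: measure_lborel_cbox_eq)
      also have "\<dots> \<le> (4 * k) * (4 * k) ^ DIM('b)" using k by (intro mult_right_mono) auto
      finally have "\<epsilon> powr p * measure lborel (A k) \<le> \<epsilon> powr p * (4 * k) ^ n"
        by (intro mult_left_mono) (auto simp: n_def)
      then show "measure lborel (A k) *\<^sub>R \<epsilon> powr p \<le> \<epsilon> powr p * (4 * k) ^ n" by (simp add: mult.commute)
    qed auto
    finally show ?thesis .
  qed
  have lim: "((\<lambda>k. E t k) \<longlongrightarrow> (1 - t) powr (1 - p) * \<Gamma>) at_top" if t: "0 < t" "t < 1" for t
  proof -
    \<comment> \<open>Both error terms decay if \<open>n - p < \<alpha> * p\<close> and
      \<open>\<alpha> * (r - p) < p\<close>. Since \<open>r - p = p * (p - 1) / (a - p)\<close> and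
      \<open>n \<le> a\<close>, any value strictly between \<open>(n - p) / p\<close> and
      \<open>(n - p) / (p - 1)\<close> does; the midpoint is taken.\<close>
    define \<alpha> where "\<alpha> = (n - p) * ((1 / p + 1 / (p - 1)) / 2)"
    have \<alpha>: "n - p < \<alpha> * p" "\<alpha> * (r - p) < p"
    proof -
      have "1 / p < 1 / (p - 1)" using p by (intro divide_strict_left_mono) auto
      then have b: "1 / p < (1 / p + 1 / (p - 1)) / 2" "(1 / p + 1 / (p - 1)) / 2 < 1 / (p - 1)"
        using less_half_sum[of "1 / p" "1 / (p - 1)"] gt_half_sum[of "1 / p" "1 / (p - 1)"] by (simp_all only: one_add_one)
      have "(n - p) * (1 / p) < \<alpha>" "\<alpha> < (n - p) * (1 / (p - 1))"
        unfolding \<alpha>_def using b p by (intro mult_strict_left_mono; simp)+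
      then show "n - p < \<alpha> * p" using p by (simp add: field_simps)
      have "\<alpha> < (a - p) / (p - 1)"
        using \<open>\<alpha> < (n - p) * (1 / (p - 1))\<close> p by (smt (verit) divide_right_mono mult_cancel_left1 times_divide_eq_right)
      then have "\<alpha> * (p * (p - 1) / (a - p)) < (a - p) / (p - 1) * (p * (p - 1) / (a - p))"
        using p by (intro mult_strict_right_mono) auto
      then show "\<alpha> * (r - p) < p" using p unfolding pr(3) by simp
    qed
    have eq: "E t k = (1 - t) powr (1 - p) * \<Gamma> + t powr (1 - p) * ((C * 16) powr p *
       (k powr (\<alpha> * (r - p) - p) * I + 4 ^ n * k powr (n - p - \<alpha> * p)))" if k: "0 < k" for k
    proof -
      have e1: "(C * 16 / k) powr p = (C * 16) powr p * k powr (- p)"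
        using C(1) k by (simp add: powr_divide powr_minus_divide)
      have e2: "(k powr (- \<alpha>)) powr (p - r) = k powr (\<alpha> * (r - p))" "(k powr (- \<alpha>)) powr p = k powr (- \<alpha> * p)"
        using k by (auto simp: powr_powr algebra_simps)
      have e3: "(4 * k) ^ n = 4 ^ n * k powr n" using k by (simp add: power_mult_distrib powr_realpow)
      have e4: "k powr (- p) * k powr (\<alpha> * (r - p)) = k powr (\<alpha> * (r - p) - p)"
         "k powr (- p) * (k powr (- \<alpha> * p) * k powr n) = k powr (n - p - \<alpha> * p)"
        using k by (auto simp: powr_add[symmetric] algebra_simps)
      have "E t k = (1 - t) powr (1 - p) * \<Gamma> + t powr (1 - p) * ((C * 16) powr p *
         ((k powr (- p) * k powr (\<alpha> * (r - p))) * I + 4 ^ n * (k powr (- p) * (k powr (- \<alpha> * p) * k powr n))))"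
        unfolding E_def \<alpha>_def[symmetric] e1 e2 e3 by (simp only: ring_distribs mult_ac)
      then show ?thesis unfolding e4 .
    qed
    have z: "((\<lambda>k::real. k powr (\<alpha> * (r - p) - p)) \<longlongrightarrow> 0) at_top" "((\<lambda>k::real. k powr (n - p - \<alpha> * p)) \<longlongrightarrow> 0) at_top"
      using \<alpha> by (auto intro!: tendsto_neg_powr filterlim_ident)
    have "((\<lambda>k. (1 - t) powr (1 - p) * \<Gamma> + t powr (1 - p) * ((C * 16) powr p *
       (k powr (\<alpha> * (r - p) - p) * I + 4 ^ n * k powr (n - p - \<alpha> * p)))) \<longlongrightarrow>
       (1 - t) powr (1 - p) * \<Gamma> + t powr (1 - p) * ((C * 16) powr p * (0 * I + 4 ^ n * 0))) at_top"
      by (intro tendsto_intros z)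
    then have "((\<lambda>k. (1 - t) powr (1 - p) * \<Gamma> + t powr (1 - p) * ((C * 16) powr p *
       (k powr (\<alpha> * (r - p) - p) * I + 4 ^ n * k powr (n - p - \<alpha> * p)))) \<longlongrightarrow>
       (1 - t) powr (1 - p) * \<Gamma>) at_top" by simp
    then show ?thesis
      by (rule Lim_transform_eventually) (use eventually_gt_at_top[of 0] in \<open>eventually_elim, simp add: eq\<close>)
  qed
  \<comment> \<open>\<open>t\<close> is fixed before \<open>k\<close> tends to infinity: the factor
    \<open>t powr (1 - p)\<close> of the error is large but does not depend on
    \<open>k\<close>.\<close>
  have "((\<lambda>t. (1 - t) powr (1 - p) * \<Gamma>) \<longlongrightarrow> (1 - 0) powr (1 - p) * \<Gamma>) (at_right 0)"
    by (intro tendsto_intros) auto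
  then have "eventually (\<lambda>t. (1 - t) powr (1 - p) * \<Gamma> < \<Gamma>') (at_right 0)"
    using \<Gamma>' by (intro order_tendstoD(2)) (auto simp: \<Gamma>_def)
  moreover have "eventually (\<lambda>t::real. 0 < t \<and> t < 1) (at_right 0)"
    by (auto simp: eventually_at_right_field intro!: exI[of _ 1])
  ultimately have "eventually (\<lambda>t. (1 - t) powr (1 - p) * \<Gamma> < \<Gamma>' \<and> 0 < t \<and> t < 1) (at_right 0)"
    by eventually_elim auto
  then obtain t where t: "(1 - t) powr (1 - p) * \<Gamma> < \<Gamma>'" "0 < t" "t < 1"
    by (metis (mono_tags, lifting) eventually_happens trivial_limit_at_right_real)
  have "eventually (\<lambda>k. E t k < \<Gamma>') at_top"
    using lim[OF t(2,3)] t(1) by (intro order_tendstoD(2)) auto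
  then show ?thesis
    using eventually_gt_at_top[of 0]
  proof eventually_elim
    case (elim k)
    then show ?case using bound[OF elim(2) t(2,3)] by linarith
  qed
qed

lemma tendsto_set_lebesgue_integral_exhaust:
  fixes F :: "'a::euclidean_space \<Rightarrow> real" and G :: "real \<Rightarrow> 'a \<Rightarrow> real"
  assumes F: "set_integrable lborel B F"
    and A: "\<And>k. A k \<subseteq> B" "\<And>k. set_borel_measurable lborel (A k) (G k)"
    and G: "\<And>k z. z \<in> A k \<Longrightarrow> \<bar>G k z\<bar> \<le> F z"
    and ev: "\<And>z. z \<in> B \<Longrightarrow> eventually (\<lambda>k. z \<in> A k \<and> G k z = F z) at_top"
  shows "((\<lambda>k. LINT z:A k|lborel. G k z) \<longlongrightarrow> (LINT z:B|lborel. F z)) at_top"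
  unfolding set_lebesgue_integral_def
proof (rule integral_dominated_convergence_at_top[where w = "\<lambda>z. norm (indicator B z *\<^sub>R F z)"])
  show "(\<lambda>z. indicator B z *\<^sub>R F z) \<in> borel_measurable lborel"
    using F by (auto simp: set_integrable_def)
  show "(\<lambda>z. indicator (A k) z *\<^sub>R G k z) \<in> borel_measurable lborel" for k
    using A(2) by (simp add: set_borel_measurable_def)
  show "integrable lborel (\<lambda>z. norm (indicator B z *\<^sub>R F z))"
    using F unfolding set_integrable_def by (rule integrable_norm)
  show "\<forall>\<^sub>F k in at_top. AE z in lborel. norm (indicator (A k) z *\<^sub>R G k z) \<le> norm (indicator B z *\<^sub>R F z)"
    using A(1) G by (intro always_eventually allI AE_I2) (fastforce simp: indicator_def)
  show "AE z in lborel. ((\<lambda>k. indicator (A k) z *\<^sub>R G k z) \<longlongrightarrow> indicator B z *\<^sub>R F z) at_top"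
  proof (rule AE_I2)
    fix z :: 'a
    show "((\<lambda>k. indicator (A k) z *\<^sub>R G k z) \<longlongrightarrow> indicator B z *\<^sub>R F z) at_top"
    proof (cases "z \<in> B")
      case True
      from ev[OF True] show ?thesis
        by (intro tendsto_eventually, elim eventually_mono) (auto simp: True)
    next
      case False
      then have "z \<notin> A k" for k using A(1) by blast
      then show ?thesis using False by simp
    qed
  qed
qed

lemma eventually_mem_cbox_One:
  "eventually (\<lambda>k::real. x \<in> cbox (- ((c * k) *\<^sub>R One)) ((c * k) *\<^sub>R One :: 'a::euclidean_space)) at_top" if "0 < c"
proof -
  have "eventually (\<lambda>k. norm x / c \<le> k) at_top" by (rule eventually_ge_at_top)
  then show ?thesis
  proof eventually_elim
    case (elim k)
    then have "norm x \<le> c * k" using that by (simp add: field_simps)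
    then have "\<bar>x \<bullet> b\<bar> \<le> c * k" if "b \<in> Basis" for b using Basis_le_norm[OF that, of x] by linarith
    then show ?case by (auto simp: mem_box abs_le_iff minus_le_iff)
  qed
qed

text \<open>Limit of \<open>halfspace_core\<close> for \<open>g\<close> times a radial cutoff, on
  growing boxes. The scales are optimised before the limit. The target box covers only the fraction
  \<open>\<kappa> k\<close> of the total weight \<open>K\<close>, and this fraction tends to
  1.\<close>

lemma halfspace_inequality:
  fixes g N :: "real \<times> 'b::euclidean_space \<Rightarrow> real" and D :: "real \<times> 'b \<Rightarrow> real \<times> 'b" and a p :: real
  defines "n \<equiv> DIM(real \<times> 'b)" and "q \<equiv> p / (p - 1)" and "r \<equiv> p * ((a - 1) / (a - p))"
    and "H \<equiv> {z. 0 \<le> fst z}" and "H1 \<equiv> {z. 1 \<le> fst z}"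
  defines "\<theta> \<equiv> (a - p) / (p * (a - n) + n - p)"
  defines "K \<equiv> (LINT y:H1|lborel. (N y powr q / q) powr (1 - a))"
  defines "\<Gamma> \<equiv> (LINT z:H|lborel. dual_norm N (D z) powr p)" and "I \<equiv> (LINT z:H|lborel. g z powr r)"
  assumes N: "is_norm N" and p: "1 < p" "p < n" "real n \<le> a"
    and g: "\<And>z. 0 \<le> fst z \<Longrightarrow> 0 \<le> g z" "\<And>z. 0 \<le> fst z \<Longrightarrow> (g has_derivative (\<lambda>v. v \<bullet> D z)) (at z)"
    and D: "continuous_on H D"
    and int: "set_integrable lborel H (\<lambda>z. dual_norm N (D z) powr p)" "set_integrable lborel H (\<lambda>z. g z powr r)"
      "integrable lborel (\<lambda>x. g (0, x) powr r)"
    and K: "set_integrable lborel H1 (\<lambda>y. (N y powr q / q) powr (1 - a))" "0 < K"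
    and ne: "\<exists>z. 0 \<le> fst z \<and> g z \<noteq> 0" and I: "0 < I"
  shows "(LINT x|lborel. g (0, x) powr r) \<le> K * ((a - n) + (a - p) / (p - 1)) *
    ((I / K) powr (1 - \<theta>) * ((p - 1) / p * (p / (a - p)) powr p * \<Gamma> / K) powr (\<theta> * ((a - 1) / (a - p))))"
proof -
  define X where "X k = cbox (- ((2 * k) *\<^sub>R One)) ((2 * k) *\<^sub>R One :: 'b)" for k
  define A Q where "A k = {0..2 * k} \<times> X k" and "Q k = {1..2 * k} \<times> X k" for k
  have cA: "A k = cbox (0, - ((2 * k) *\<^sub>R One)) (2 * k, (2 * k) *\<^sub>R One)"
    and cQ: "Q k = cbox (1, - ((2 * k) *\<^sub>R One)) (2 * k, (2 * k) *\<^sub>R One)" for k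
    by (auto simp: A_def Q_def X_def cbox_Pair_eq)
  have AH: "A k \<subseteq> H" "Q k \<subseteq> H1" for k by (auto simp: A_def H_def Q_def H1_def)
  have cg: "continuous_on H g" unfolding H_def
    by (auto intro!: continuous_at_imp_continuous_on has_derivative_continuous[OF g(2)])
  have gH: "0 \<le> g z" if "z \<in> H" for z using g(1) that by (auto simp: H_def)
  have r: "0 < r" unfolding r_def using p by (intro mult_pos_pos divide_pos_pos) auto
  define \<psi> where "\<psi> k z = g z * radial_cutoff k z" for k z
  define E where "E k z = radial_cutoff k z *\<^sub>R D z + g z *\<^sub>R radial_cutoff_grad k z" for k z
  have \<psi>0: "0 \<le> \<psi> k z" "\<psi> k z \<le> g z" if "0 \<le> fst z" "0 < k" for k z
    using g(1)[OF that(1)] radial_cutoff(2,3)[OF that(2), of z] by (auto simp: \<psi>_def mult_left_le)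
  have c\<psi>: "continuous_on H (\<psi> k)" if "0 < k" for k
    unfolding \<psi>_def using that
    by (intro continuous_on_mult cg continuous_at_imp_continuous_on ballI has_derivative_continuous[OF radial_cutoff(1)])
  have c\<psi>r: "continuous_on H (\<lambda>z. \<psi> k z powr r)" if "0 < k" for k
    using r that by (intro continuous_on_powr' c\<psi> continuous_on_const) (auto simp: \<psi>0 H_def)
  have cE: "continuous_on H (E k)" if "0 < k" for k
    unfolding E_def using that
    by (intro continuous_on_add continuous_on_scaleR cg D radial_cutoff(7) continuous_at_imp_continuous_on ballI
      has_derivative_continuous[OF radial_cutoff(1)])
  define B where "B k = integral (X k) (\<lambda>x. \<psi> k (0, x) powr r)" for k
  define \<kappa> where "\<kappa> k = integral (Q k) (\<lambda>y. (N y powr q / q) powr (1 - a)) / K" for k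
  have q: "0 < q" using p by (simp add: q_def)
  have Npos: "0 < N y" if "y \<in> H1" for y
  proof (rule is_normD(7)[OF N])
    show "y \<noteq> 0" using that by (auto simp: H1_def)
  qed
  have cW: "continuous_on S (\<lambda>y. (N y powr q / q) powr (1 - a))" if "S \<subseteq> H1" for S
    using Npos that q
    by (intro continuous_on_powr' continuous_on_divide continuous_on_const continuous_on_is_norm N) (fastforce simp: less_le)+
  have \<kappa>1: "(\<kappa> \<longlongrightarrow> 1) at_top"
  proof -
    have "((\<lambda>k. LINT y:Q k|lborel. (N y powr q / q) powr (1 - a)) \<longlongrightarrow> K) at_top"
      unfolding K_def
    proof (rule tendsto_set_lebesgue_integral_exhaust[OF K(1) AH(2)])
      show "set_borel_measurable lborel (Q k) (\<lambda>y. (N y powr q / q) powr (1 - a))" for k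
        using integral_cbox_eq_set_lebesgue_integral(1)[OF cW[OF AH(2)[of k, unfolded cQ]]]
        unfolding cQ set_integrable_def set_borel_measurable_def by auto
      fix y :: "real \<times> 'b" assume "y \<in> H1"
      then have y: "1 \<le> fst y" by (simp add: H1_def)
      have "eventually (\<lambda>k. fst y / 2 \<le> k) at_top" by (rule eventually_ge_at_top)
      moreover have "eventually (\<lambda>k. snd y \<in> X k) at_top"
        unfolding X_def by (rule eventually_mem_cbox_One) simp
      ultimately show "eventually (\<lambda>k. y \<in> Q k \<and> (N y powr q / q) powr (1 - a) = (N y powr q / q) powr (1 - a)) at_top"
        by eventually_elim (use y in \<open>cases y, auto simp: Q_def\<close>)
    qed auto
    then have "((\<lambda>k. (LINT y:Q k|lborel. (N y powr q / q) powr (1 - a)) / K) \<longlongrightarrow> K / K) at_top"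
      using K by (intro tendsto_divide tendsto_const) auto
    moreover have "\<kappa> = (\<lambda>k. (LINT y:Q k|lborel. (N y powr q / q) powr (1 - a)) / K)"
    proof (rule ext)
      fix k show "\<kappa> k = (LINT y:Q k|lborel. (N y powr q / q) powr (1 - a)) / K"
      unfolding \<kappa>_def cQ using cW[OF AH(2)[of k, unfolded cQ]]
      by (subst integral_cbox_eq_set_lebesgue_integral(2)) auto
    qed
    ultimately show ?thesis using K by simp
  qed
  have Blim: "(B \<longlongrightarrow> (LINT x|lborel. g (0, x) powr r)) at_top"
  proof -
    have cX: "continuous_on (X k) (\<lambda>x. \<psi> k (0, x) powr r)" if "0 < k" for k
      by (rule continuous_on_compose2[OF c\<psi>r[OF that]]) (auto simp: H_def intro!: continuous_intros)
    \<comment> \<open>The cutoff facts hold for positive \<open>k\<close>; the value 0 elsewhere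
      makes the domination valid for all \<open>k\<close>.\<close>
    define G where "G k x = (if 0 < k then \<psi> k (0, x) powr r else 0)" for k x
    have "((\<lambda>k. LINT x:X k|lborel. G k x) \<longlongrightarrow> (LINT x:UNIV|lborel. g (0, x) powr r)) at_top"
    proof (rule tendsto_set_lebesgue_integral_exhaust)
      show "set_integrable lborel UNIV (\<lambda>x. g (0, x) powr r)" using int(3) by (simp add: set_integrable_def)
      show "set_borel_measurable lborel (X k) (G k)" for k
      proof (cases "0 < k")
        case True
        then have "continuous_on (X k) (G k)" using cX by (simp add: G_def)
        from integral_cbox_eq_set_lebesgue_integral(1)[OF this[unfolded X_def]] show ?thesis
          unfolding X_def set_integrable_def set_borel_measurable_def by auto
      qed (simp add: G_def set_borel_measurable_def)
      show "\<bar>G k x\<bar> \<le> g (0, x) powr r" for k x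
        using \<psi>0[of "(0, x)" k] r by (auto simp: G_def intro!: powr_mono2)
      fix x :: 'b
      have "eventually (\<lambda>k. x \<in> X k) at_top"
        unfolding X_def by (rule eventually_mem_cbox_One) simp
      moreover have "eventually (\<lambda>k. norm x \<le> k) at_top" "eventually (\<lambda>k. 0 < (k::real)) at_top"
        by (rule eventually_ge_at_top eventually_gt_at_top)+
      ultimately show "eventually (\<lambda>k. x \<in> X k \<and> G k x = g (0, x) powr r) at_top"
      proof eventually_elim
        case (elim k)
        then have "radial_cutoff k (0::real, x) = 1" by (intro radial_cutoff) auto
        then show ?case using elim by (simp add: G_def \<psi>_def)
      qed
    qed auto
    then have "((\<lambda>k. LINT x:X k|lborel. G k x) \<longlongrightarrow> (LINT x|lborel. g (0, x) powr r)) at_top"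
      by (simp add: set_lebesgue_integral_def)
    moreover have "eventually (\<lambda>k. (LINT x:X k|lborel. G k x) = B k) at_top"
      using eventually_gt_at_top[of 0]
    proof eventually_elim
      case (elim k)
      then show ?case using integral_cbox_eq_set_lebesgue_integral(2)[OF cX[OF elim, unfolded X_def]]
        unfolding B_def G_def X_def by simp
    qed
    ultimately show ?thesis by (rule Lim_transform_eventually)
  qed
  \<comment> \<open>Absorbs the factor from Young's inequality:
    \<open>(a - 1) / p * (p / (a - p)) powr p\<close> equals
    \<open>(a - 1) / (p - 1) * (C * K)\<close>, the shape that \<open>powr_optimisation\<close>
    expects.\<close>
  define C where "C = (p - 1) / p * (p / (a - p)) powr p / K"
  have C: "0 < C" using p K by (simp add: C_def)
  define P where "P \<gamma> \<kappa> = K * ((a - n) + \<kappa> powr (- ((p - 1) / (a - p))) * ((a - p) / (p - 1))) *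
    ((I / K) powr (1 - \<theta>) * (C * \<gamma>) powr (\<theta> * ((a - 1) / (a - p))))" for \<gamma> \<kappa>
  \<comment> \<open>The gradient integral of the cut-off functions is eventually below each
    \<open>\<Gamma>'\<close> greater than \<open>\<Gamma>\<close>. The strict inequality also
    provides the positive parameter demanded by the optimisation when
    \<open>\<Gamma> = 0\<close>.\<close>
  have approx: "(LINT x|lborel. g (0, x) powr r) \<le> P \<Gamma>' 1" if \<Gamma>': "\<Gamma> < \<Gamma>'" for \<Gamma>'
  proof -
    have "0 \<le> \<Gamma>" unfolding \<Gamma>_def set_lebesgue_integral_def by (rule Bochner_Integration.integral_nonneg) auto
    then have \<Gamma>'0: "0 < \<Gamma>'" using \<Gamma>' by simp
    have ev1: "eventually (\<lambda>k. integral (A k) (\<lambda>z. dual_norm N (E k z) powr p) \<le> \<Gamma>') at_top"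
      unfolding A_def X_def E_def
      by (rule cutoff_gradient_limit[where a = a])
        (use N p cg gH D int \<Gamma>' in \<open>auto simp: n_def H_def r_def \<Gamma>_def\<close>)
    obtain z0 where z0: "0 \<le> fst z0" "g z0 \<noteq> 0" using ne by blast
    have ev2: "eventually (\<lambda>k. 1 < k \<and> norm z0 \<le> k \<and> 0 < \<kappa> k) at_top"
      using order_tendstoD(1)[OF \<kappa>1, of 0] by (intro eventually_conj eventually_ge_at_top eventually_gt_at_top) auto
    have "eventually (\<lambda>k. B k \<le> P \<Gamma>' (\<kappa> k)) at_top"
      using ev1 ev2
    proof eventually_elim
      case (elim k)
      then have k: "0 < k" "1 < 2 * k" "0 < \<kappa> k" by auto
      have "B k \<le> K * ((a - n) + \<kappa> k powr (- ((p - 1) / (a - p))) * ((a - p) / (p - 1))) *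
        ((I / K) powr (1 - \<theta>) * (C * \<Gamma>') powr (\<theta> * ((a - 1) / (a - p))))"
        unfolding \<theta>_def
      proof (rule powr_optimisation[OF p])
        fix \<tau> :: real assume \<tau>: "0 < \<tau>"
        have "\<exists>x>0. integral (X k) (\<lambda>x. \<psi> k (0, x) powr r) +
            \<tau> powr (a - n) * x powr (a - 1) * integral (Q k) (\<lambda>y. (N y powr q / q) powr (1 - a)) \<le>
           \<tau> * (a - n) * integral (A k) (\<lambda>z. \<psi> k z powr r) +
           x powr (p - 1) * ((a - 1) / p * (p / (a - p)) powr p * integral (A k) (\<lambda>z. dual_norm N (E k z) powr p))"
          unfolding X_def A_def Q_def n_def r_def q_def
        proof (rule halfspace_core[OF N p(1) _ _ k(2) \<tau>])
          show "p < real DIM(real \<times> 'b)" "real DIM(real \<times> 'b) \<le> a" using p by (auto simp: n_def)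
          show "0 \<le> \<psi> k z" if "0 \<le> fst z" for z using \<psi>0 that k by blast
          show "(\<psi> k has_derivative (\<lambda>v. v \<bullet> E k z)) (at z)" if "0 \<le> fst z" for z
            unfolding \<psi>_def E_def using g(2)[OF that] radial_cutoff(1)[OF k(1), of z]
            by (auto intro!: derivative_eq_intros simp: inner_add_right)
          show "continuous_on {z. 0 \<le> fst z} (E k)" using cE[OF k(1)] by (simp add: H_def)
          show "\<psi> k z = 0" if "b \<in> Basis" "2 * k \<le> \<bar>z \<bullet> b\<bar>" for z b
          proof -
            have "2 * k \<le> norm z" using that(2) Basis_le_norm[OF that(1), of z] by linarith
            then show ?thesis using k by (simp add: \<psi>_def radial_cutoff)
          qed
          show "\<exists>z. 0 \<le> fst z \<and> \<psi> k z \<noteq> 0"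
            using z0 elim radial_cutoff(4)[OF k(1), of z0] by (intro exI[of _ z0]) (auto simp: \<psi>_def)
        qed
        then obtain x where x: "0 < x" "B k + \<tau> powr (a - n) * x powr (a - 1) * (\<kappa> k * K) \<le>
           \<tau> * (a - n) * integral (A k) (\<lambda>z. \<psi> k z powr r) +
           x powr (p - 1) * ((a - 1) / p * (p / (a - p)) powr p * integral (A k) (\<lambda>z. dual_norm N (E k z) powr p))"
          using K unfolding B_def \<kappa>_def by auto
        have "integral (A k) (\<lambda>z. \<psi> k z powr r) \<le> I"
        proof -
          have cgr: "continuous_on (A k) (\<lambda>z. g z powr r)"
            using r AH(1)[of k] gH by (intro continuous_on_powr' continuous_on_subset[OF cg] continuous_on_const) auto
          have "integral (A k) (\<lambda>z. \<psi> k z powr r) \<le> integral (A k) (\<lambda>z. g z powr r)"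
          proof (rule integral_le)
            show "(\<lambda>z. \<psi> k z powr r) integrable_on A k" "(\<lambda>z. g z powr r) integrable_on A k"
              using cgr continuous_on_subset[OF c\<psi>r[OF k(1)] AH(1)] unfolding cA by (auto intro: integrable_continuous)
            show "\<psi> k z powr r \<le> g z powr r" if "z \<in> A k" for z
              using \<psi>0[of z k] that AH(1)[of k] k r by (intro powr_mono2) (auto simp: H_def)
          qed
          also have "\<dots> = (LINT z:A k|lborel. g z powr r)"
            using integral_cbox_eq_set_lebesgue_integral(2)[OF cgr[unfolded cA]] unfolding cA .
          also have "\<dots> \<le> I" unfolding I_def
            using AH(1) by (intro set_lebesgue_integral_mono_set int) (auto simp: cA)
          finally show ?thesis .
        qed
        then have i1: "\<tau> * (a - n) * integral (A k) (\<lambda>z. \<psi> k z powr r) \<le> \<tau> * (a - n) * (I / K * K)"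
          using \<tau> p K by (intro mult_left_mono) auto
        have "x powr (p - 1) * ((a - 1) / p * (p / (a - p)) powr p * integral (A k) (\<lambda>z. dual_norm N (E k z) powr p)) \<le>
            x powr (p - 1) * ((a - 1) / p * (p / (a - p)) powr p * \<Gamma>')"
          using elim p by (intro mult_left_mono) auto
        also have "\<dots> = x powr (p - 1) * ((a - 1) / (p - 1) * (C * \<Gamma>' * K))"
          using p K by (simp add: C_def)
        finally show "\<exists>x>0. B k + \<tau> powr (a - n) * x powr (a - 1) * (\<kappa> k * K) \<le>
          \<tau> * (a - n) * (I / K * K) + x powr (p - 1) * ((a - 1) / (p - 1) * (C * \<Gamma>' * K))"
          using x i1 by (intro exI[of _ x]) linarith
      qed (use K I C \<Gamma>'0 k in auto)
      then show ?case by (simp add: P_def)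
    qed
    moreover have "((\<lambda>k. P \<Gamma>' (\<kappa> k)) \<longlongrightarrow> P \<Gamma>' 1) at_top"
      unfolding P_def by (intro tendsto_intros \<kappa>1) auto
    ultimately show ?thesis using Blim by (intro tendsto_le[OF _ _ Blim]) auto
  qed
  have den: "0 < p * (a - n) + n - p" using p by (simp add: add_nonneg_pos add_diff_eq[symmetric])
  then have ex: "0 < \<theta> * ((a - 1) / (a - p))" unfolding \<theta>_def using p by (intro mult_pos_pos divide_pos_pos) auto
  \<comment> \<open>\<open>\<Gamma>\<close> may be 0, where continuity of the power rests on the
    positivity of its exponent.\<close>
  have "((\<lambda>\<gamma>. P \<gamma> 1) \<longlongrightarrow> P \<Gamma> 1) (at_right \<Gamma>)"
  proof -
    have "0 \<le> \<Gamma>" unfolding \<Gamma>_def set_lebesgue_integral_def by (rule Bochner_Integration.integral_nonneg) auto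
    moreover have "eventually (\<lambda>\<gamma>. \<Gamma> < \<gamma>) (at_right \<Gamma>)" by (simp add: eventually_at_right_less)
    ultimately have "eventually (\<lambda>\<gamma>. 0 \<le> C * \<gamma>) (at_right \<Gamma>)"
      using C by (elim eventually_mono) (simp add: zero_le_mult_iff)
    then show ?thesis
      unfolding P_def using ex by (intro tendsto_mult tendsto_const tendsto_powr2 tendsto_ident_at) auto
  qed
  then have "(LINT x|lborel. g (0, x) powr r) \<le> P \<Gamma> 1"
    by (rule tendsto_lowerbound) (use approx in \<open>auto simp: eventually_at_right_less intro: eventually_mono[OF eventually_at_right_less]\<close>)
  then show ?thesis by (simp add: P_def C_def)
qed

section \<open>Integrals of powers of the norm\<close>

lemma nn_integral_powr_to_inf:
  assumes "1 < s"
  shows "(\<integral>\<^sup>+x. indicator {1..} x * ennreal (x powr (- s)) \<partial>lborel) = ennreal (1 / (s - 1))"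
proof -
  have "((\<lambda>x. x powr (- s)) has_integral -(1 powr (- s + 1)) / (- s + 1)) {1..}"
    using assms by (intro has_integral_powr_to_inf) auto
  also have "-(1 powr (- s + 1)) / (- s + 1) = 1 / (s - 1)"
    using assms by (simp add: divide_simps)
  finally show ?thesis
    using nn_integral_has_integral_lebesgue[of "{1..}" "\<lambda>x. x powr (- s)" "1 / (s - 1)"]
    by (simp add: ennreal_mult' ennreal_indicator)
qed

lemma nn_integral_one_plus_abs_powr_finite:
  assumes "1 < s"
  shows "(\<integral>\<^sup>+(x::real). ennreal ((1 + \<bar>x\<bar>) powr (- s)) \<partial>lborel) < \<infinity>"
proof -
  let ?f = "\<lambda>x::real. indicator {1..} x * ennreal (x powr (- s))"
  have "(\<integral>\<^sup>+(x::real). ennreal ((1 + \<bar>x\<bar>) powr (- s)) \<partial>lborel) \<le>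
     (\<integral>\<^sup>+x. ?f (1 + 1 * x) + ?f (1 + (-1) * x) \<partial>lborel)"
    by (intro nn_integral_mono) (auto simp: indicator_def abs_if)
  also have "\<dots> = (\<integral>\<^sup>+x. ?f (1 + 1 * x) \<partial>lborel) + (\<integral>\<^sup>+x. ?f (1 + (-1) * x) \<partial>lborel)"
    by (rule nn_integral_add) auto
  also have "(\<integral>\<^sup>+x. ?f (1 + 1 * x) \<partial>lborel) = (\<integral>\<^sup>+x. ?f x \<partial>lborel)"
    by (subst (2) nn_integral_real_affine[where c = 1 and t = 1]) auto
  also have "(\<integral>\<^sup>+x. ?f (1 + (-1) * x) \<partial>lborel) = (\<integral>\<^sup>+x. ?f x \<partial>lborel)"
    by (subst (2) nn_integral_real_affine[where c = "-1" and t = 1]) auto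
  finally show ?thesis unfolding nn_integral_powr_to_inf[OF assms]
    by (simp add: order_le_less_trans)
qed

text \<open>Factorises into one-dimensional integrals, each convergent because
  \<open>\<kappa> / DIM('b) > 1\<close>.\<close>

lemma nn_integral_prod_weight_finite:
  assumes "real DIM('b::euclidean_space) < \<kappa>"
  shows "(\<integral>\<^sup>+(x::'b). ennreal (\<Prod>b\<in>Basis. (1 + \<bar>x \<bullet> b\<bar>) powr (- (\<kappa> / DIM('b)))) \<partial>lborel) < \<infinity>"
proof -
  have "(\<integral>\<^sup>+(x::'b). ennreal (\<Prod>b\<in>Basis. (1 + \<bar>x \<bullet> b\<bar>) powr (- (\<kappa> / DIM('b)))) \<partial>lborel) =
     (\<integral>\<^sup>+(x::'b). (\<Prod>b\<in>Basis. ennreal ((1 + \<bar>x \<bullet> b\<bar>) powr (- (\<kappa> / DIM('b))))) \<partial>lborel)"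
    by (simp add: prod_ennreal)
  also have "\<dots> = (\<Prod>b\<in>(Basis::'b set). (\<integral>\<^sup>+t. ennreal ((1 + \<bar>t\<bar>) powr (- (\<kappa> / DIM('b)))) \<partial>lborel))"
    by (rule nn_integral_lborel_prod) auto
  also have "\<dots> < \<infinity>"
    using nn_integral_one_plus_abs_powr_finite[of "\<kappa> / DIM('b)"] assms
    by (simp add: power_less_top_ennreal field_simps)
  finally show ?thesis .
qed

lemma nn_integral_scale:
  fixes F :: "'b::euclidean_space \<Rightarrow> ennreal"
  assumes [measurable]: "F \<in> borel_measurable borel" and c: "0 < c"
  shows "(\<integral>\<^sup>+x. F x \<partial>lborel) = ennreal (c ^ DIM('b)) * (\<integral>\<^sup>+x. F (c *\<^sub>R x) \<partial>lborel)"
  using c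
  by (subst lborel_affine[of c 0]) (auto simp: nn_integral_density nn_integral_distr nn_integral_cmult)

text \<open>By homogeneity the slice at height \<open>u\<close> contributes
  \<open>u powr (- (\<kappa> - DIM('b)))\<close> times the slice at height 1, and integration over
  \<open>u \<ge> 1\<close> gives the factor \<open>1 / (\<kappa> - n)\<close>. This ratio of
  boundary and interior integrals of the extremal function enters the optimal constant.\<close>

lemma norm_powr_halfspace:
  fixes N :: "real \<times> 'b::euclidean_space \<Rightarrow> real" and \<kappa> :: real
  defines "n \<equiv> DIM(real \<times> 'b)" and "H1 \<equiv> {z. 1 \<le> fst z} :: (real \<times> 'b) set"
  assumes N: "is_norm N" and \<kappa>: "n < \<kappa>"
  shows "integrable lborel (\<lambda>x. N (1, x) powr (- \<kappa>))"
    and "set_integrable lborel H1 (\<lambda>z. N z powr (- \<kappa>))"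
    and "(LINT x|lborel. N (1, x) powr (- \<kappa>)) = (\<kappa> - n) * (LINT z:H1|lborel. N z powr (- \<kappa>))"
    and "0 < (LINT z:H1|lborel. N z powr (- \<kappa>))"
proof -
  let ?d = "DIM('b)"
  have n: "n = Suc ?d" by (simp add: n_def)
  have [measurable]: "N \<in> borel_measurable borel"
    using continuous_on_is_norm[OF N] by (intro borel_measurable_continuous_onI)
  have [measurable]: "H1 \<in> sets borel" unfolding H1_def
    by (intro borel_closed closed_Collect_le continuous_intros)
  define J where "J = (\<integral>\<^sup>+x. ennreal (N (1, x) powr (- \<kappa>)) \<partial>lborel)"
  obtain c where c: "0 < c" "\<And>x. c * norm x \<le> N x" using is_norm_ge_norm[OF N] by blast
  have Npos: "0 < N (u, x)" if "0 < u" for u x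
  proof (rule is_normD(7)[OF N])
    show "(u, x) \<noteq> 0" using that by (auto simp: zero_prod_def)
  qed
  \<comment> \<open>\<open>N (1, x)\<close> dominates a multiple of
    \<open>1 + \<bar>x \<bullet> b\<bar>\<close> for every \<open>b\<close>. Its power is therefore
    split into equal factors, one per coordinate, and each is compared with its own
    coordinate.\<close>
  have bound: "N (1, x) powr (- \<kappa>) \<le> (c / 2) powr (- \<kappa>) * (\<Prod>b\<in>Basis. (1 + \<bar>x \<bullet> b\<bar>) powr (- (\<kappa> / ?d)))" for x
  proof -
    have b: "c / 2 * (1 + \<bar>x \<bullet> b\<bar>) \<le> N (1, x)" if "b \<in> Basis" for b
    proof -
      have "\<bar>x \<bullet> b\<bar> \<le> norm x" by (rule Basis_le_norm[OF that])
      also have "norm x \<le> norm (1::real, x)" by (rule norm_snd_le)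
      finally have "1 + \<bar>x \<bullet> b\<bar> \<le> 2 * norm (1::real, x)"
        using norm_fst_le[of "1::real" x] by simp
      then have "c / 2 * (1 + \<bar>x \<bullet> b\<bar>) \<le> c / 2 * (2 * norm (1::real, x))"
        using c(1) by (intro mult_left_mono) auto
      then show ?thesis using c(2)[of "(1, x)"] by simp
    qed
    have "N (1, x) powr (- \<kappa>) = (\<Prod>b\<in>(Basis::'b set). N (1, x) powr (- (\<kappa> / ?d)))"
      using Npos[of 1 x] by (simp add: powr_realpow[symmetric] powr_powr)
    also have "\<dots> \<le> (\<Prod>b\<in>(Basis::'b set). (c / 2 * (1 + \<bar>x \<bullet> b\<bar>)) powr (- (\<kappa> / ?d)))"
      using b c \<kappa> by (intro prod_mono conjI powr_mono2') (auto simp: add_pos_nonneg)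
    also have "\<dots> = (\<Prod>b\<in>(Basis::'b set). (c / 2) powr (- (\<kappa> / ?d)) * (1 + \<bar>x \<bullet> b\<bar>) powr (- (\<kappa> / ?d)))"
      by (intro prod.cong refl powr_mult)
    also have "\<dots> = (c / 2) powr (- \<kappa>) * (\<Prod>b\<in>Basis. (1 + \<bar>x \<bullet> b\<bar>) powr (- (\<kappa> / ?d)))"
      using c by (simp add: prod.distrib powr_realpow[symmetric] powr_powr)
    finally show ?thesis .
  qed
  have "J \<le> (\<integral>\<^sup>+(x::'b). ennreal ((c / 2) powr (- \<kappa>)) * ennreal (\<Prod>b\<in>Basis. (1 + \<bar>x \<bullet> b\<bar>) powr (- (\<kappa> / ?d))) \<partial>lborel)"
    unfolding J_def
  proof (rule nn_integral_mono)
    fix x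
    have "ennreal (N (1, x) powr (- \<kappa>)) \<le> ennreal ((c / 2) powr (- \<kappa>) * (\<Prod>b\<in>Basis. (1 + \<bar>x \<bullet> b\<bar>) powr (- (\<kappa> / ?d))))"
      using bound by (rule ennreal_leI)
    then show "ennreal (N (1, x) powr (- \<kappa>)) \<le> ennreal ((c / 2) powr (- \<kappa>)) * ennreal (\<Prod>b\<in>Basis. (1 + \<bar>x \<bullet> b\<bar>) powr (- (\<kappa> / ?d)))"
      by (simp add: ennreal_mult')
  qed
  also have "\<dots> = ennreal ((c / 2) powr (- \<kappa>)) * (\<integral>\<^sup>+(x::'b). ennreal (\<Prod>b\<in>Basis. (1 + \<bar>x \<bullet> b\<bar>) powr (- (\<kappa> / ?d))) \<partial>lborel)"
    by (rule nn_integral_cmult) auto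
  also have "\<dots> < \<infinity>"
    using nn_integral_prod_weight_finite[where 'b='b, of \<kappa>] \<kappa> n by (simp add: ennreal_mult_less_top)
  finally have J: "J < \<infinity>" .
  show int1: "integrable lborel (\<lambda>x. N (1, x) powr (- \<kappa>))"
    using J unfolding J_def by (intro integrableI_bounded) auto
  have eJ: "J = ennreal (LINT x|lborel. N (1, x) powr (- \<kappa>))"
    unfolding J_def using int1 by (intro nn_integral_eq_integral) auto
  have scale: "(\<integral>\<^sup>+x. ennreal (N (u, x) powr (- \<kappa>)) \<partial>lborel) = ennreal (u powr (- (\<kappa> - ?d))) * J" if u: "0 < u" for u
  proof -
    have "(\<integral>\<^sup>+x. ennreal (N (u, x) powr (- \<kappa>)) \<partial>lborel) =
        ennreal (u ^ ?d) * (\<integral>\<^sup>+x. ennreal (N (u, u *\<^sub>R x) powr (- \<kappa>)) \<partial>lborel)"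
      by (rule nn_integral_scale[OF _ u]) auto
    also have "(\<integral>\<^sup>+x. ennreal (N (u, u *\<^sub>R x) powr (- \<kappa>)) \<partial>lborel) =
      (\<integral>\<^sup>+x. ennreal (u powr (- \<kappa>)) * ennreal (N (1, x) powr (- \<kappa>)) \<partial>lborel)"
    proof (rule nn_integral_cong)
      fix x
      have "N (u, u *\<^sub>R x) = u * N (1, x)" using is_normD(3)[OF N, of u "(1, x)"] u by simp
      then show "ennreal (N (u, u *\<^sub>R x) powr (- \<kappa>)) = ennreal (u powr (- \<kappa>)) * ennreal (N (1, x) powr (- \<kappa>))"
        using u is_normD(1)[OF N] by (simp add: powr_mult ennreal_mult')
    qed
    also have "\<dots> = ennreal (u powr (- \<kappa>)) * J" unfolding J_def by (rule nn_integral_cmult) auto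
    also have "ennreal (u ^ ?d) * (ennreal (u powr (- \<kappa>)) * J) = ennreal (u ^ ?d * u powr (- \<kappa>)) * J"
      using u by (simp add: ennreal_mult' mult.assoc)
    also have "u ^ ?d * u powr (- \<kappa>) = u powr (- (\<kappa> - ?d))"
      using u by (simp add: powr_realpow[symmetric] powr_add[symmetric])
    finally show ?thesis .
  qed
  have "(\<integral>\<^sup>+z. indicator H1 z * ennreal (N z powr (- \<kappa>)) \<partial>lborel) =
    (\<integral>\<^sup>+z. indicator H1 z * ennreal (N z powr (- \<kappa>)) \<partial>(lborel \<Otimes>\<^sub>M lborel))"
    by (simp add: lborel_prod)
  also have "\<dots> = (\<integral>\<^sup>+u. (\<integral>\<^sup>+x. indicator H1 (u, x) * ennreal (N (u, x) powr (- \<kappa>)) \<partial>lborel) \<partial>lborel)"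
    by (rule lborel.nn_integral_fst[symmetric]) (simp add: lborel_prod)
  also have "\<dots> = (\<integral>\<^sup>+u. indicator {1..} u * (\<integral>\<^sup>+x. ennreal (N (u, x) powr (- \<kappa>)) \<partial>lborel) \<partial>lborel)"
    by (intro nn_integral_cong) (auto simp: H1_def indicator_def)
  also have "\<dots> = (\<integral>\<^sup>+u. (indicator {1..} u * ennreal (u powr (- (\<kappa> - ?d)))) * J \<partial>lborel)"
    by (intro nn_integral_cong) (auto simp: indicator_def scale)
  also have "\<dots> = (\<integral>\<^sup>+u. indicator {1..} u * ennreal (u powr (- (\<kappa> - ?d))) \<partial>lborel) * J"
    by (rule nn_integral_multc) auto
  also have "\<dots> = ennreal (1 / (\<kappa> - ?d - 1)) * J"
    using \<kappa> n by (subst nn_integral_powr_to_inf) auto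
  also have "\<dots> = ennreal ((LINT x|lborel. N (1, x) powr (- \<kappa>)) / (\<kappa> - n))"
    unfolding eJ using \<kappa> n by (subst ennreal_mult'[symmetric]) (auto simp: algebra_simps)
  finally have eq: "(\<integral>\<^sup>+z. ennreal (indicator H1 z *\<^sub>R N z powr (- \<kappa>)) \<partial>lborel) =
      ennreal ((LINT x|lborel. N (1, x) powr (- \<kappa>)) / (\<kappa> - n))"
    by (simp add: ennreal_mult' ennreal_indicator)
  show int2: "set_integrable lborel H1 (\<lambda>z. N z powr (- \<kappa>))"
    unfolding set_integrable_def using eq
    by (intro integrableI_bounded) (auto simp: abs_mult ennreal_less_top)
  have B0: "0 \<le> (LINT x|lborel. N (1, x) powr (- \<kappa>))" by (rule Bochner_Integration.integral_nonneg) auto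
  have "ennreal (LINT z:H1|lborel. N z powr (- \<kappa>)) = ennreal ((LINT x|lborel. N (1, x) powr (- \<kappa>)) / (\<kappa> - n))"
    unfolding eq[symmetric] set_lebesgue_integral_def
    using int2 by (intro nn_integral_eq_integral[symmetric]) (auto simp: set_integrable_def)
  then have I: "(LINT z:H1|lborel. N z powr (- \<kappa>)) = (LINT x|lborel. N (1, x) powr (- \<kappa>)) / (\<kappa> - n)"
    using B0 \<kappa> by (subst (asm) ennreal_inj) (auto simp: set_lebesgue_integral_def intro!: Bochner_Integration.integral_nonneg)
  then show "(LINT x|lborel. N (1, x) powr (- \<kappa>)) = (\<kappa> - n) * (LINT z:H1|lborel. N z powr (- \<kappa>))"
    using \<kappa> by (simp add: field_simps)
  have "(LINT x|lborel. N (1, x) powr (- \<kappa>)) \<noteq> 0"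
  proof
    assume "(LINT x|lborel. N (1, x) powr (- \<kappa>)) = 0"
    then have "AE x in lborel. N (1, x) powr (- \<kappa>) = 0"
      using int1 by (subst (asm) integral_nonneg_eq_0_iff_AE) auto
    then have "AE x::'b in lborel. False" using Npos by (auto elim!: eventually_mono simp: less_le)
    then have "emeasure lborel (UNIV :: 'b set) = 0" by (subst (asm) AE_iff_measurable[of UNIV]) auto
    then show False by simp
  qed
  then have "0 < (LINT x|lborel. N (1, x) powr (- \<kappa>))" using B0 by linarith
  then show "0 < (LINT z:H1|lborel. N z powr (- \<kappa>))" unfolding I using \<kappa> by simp
qed

lemma lborel_translation:
  fixes F :: "'a::euclidean_space \<Rightarrow> real"
  assumes F: "set_integrable lborel S F" and S: "S \<in> sets borel"
  shows "set_integrable lborel {z. z + c \<in> S} (\<lambda>z. F (z + c))"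
    and "(LINT z:{z. z + c \<in> S}|lborel. F (z + c)) = (LINT z:S|lborel. F z)"
proof -
  have ind: "indicator {z. z + c \<in> S} z = (indicator S (c + z) :: real)" for z
    by (simp add: indicator_def add.commute)
  have m: "(\<lambda>z. indicator S z *\<^sub>R F z) \<in> borel_measurable borel"
    using F by (auto simp: set_integrable_def)
  have "integrable (distr lborel borel ((+) c)) (\<lambda>z. indicator S z *\<^sub>R F z)"
    using F by (simp add: set_integrable_def lborel_distr_plus)
  then show "set_integrable lborel {z. z + c \<in> S} (\<lambda>z. F (z + c))"
    unfolding set_integrable_def ind by (subst (asm) integrable_distr_eq) (use m in \<open>auto simp: add.commute\<close>)
  have "(LINT z:S|lborel. F z) = integral\<^sup>L (distr lborel borel ((+) c)) (\<lambda>z. indicator S z *\<^sub>R F z)"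
    by (simp add: set_lebesgue_integral_def lborel_distr_plus)
  also have "\<dots> = (LINT z:{z. z + c \<in> S}|lborel. F (z + c))"
    unfolding set_lebesgue_integral_def ind by (subst integral_distr) (use m in \<open>auto simp: add.commute\<close>)
  finally show "(LINT z:{z. z + c \<in> S}|lborel. F (z + c)) = (LINT z:S|lborel. F z)" by simp
qed

section \<open>Almost everywhere differentiability of a norm\<close>

text \<open>A hyperplane separating \<open>z\<close> from the open \<open>N\<close>-ball with
  \<open>z\<close> on its boundary, rescaled, is a supporting functional by homogeneity of
  \<open>N\<close>.\<close>

lemma is_norm_support:
  fixes N :: "'a::euclidean_space \<Rightarrow> real"
  assumes N: "is_norm N"
  obtains q where "\<And>w. w \<bullet> q \<le> N w" "z \<bullet> q = N z"
proof (cases "z = 0")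
  case True
  then show ?thesis using that[of 0] is_normD[OF N] by simp
next
  case False
  note nN = is_normD[OF N]
  have Nz: "0 < N z" using nN(7) False by blast
  let ?S = "{w. N w < N z}"
  have cS: "convex ?S"
  proof (rule convexI, simp)
    fix x y :: 'a and u v :: real
    assume h: "N x < N z" "N y < N z" "0 \<le> u" "0 \<le> v" "u + v = 1"
    have "N (u *\<^sub>R x + v *\<^sub>R y) \<le> u * N x + v * N y"
      using nN(3)[of u x] nN(3)[of v y] nN(4) h by (metis abs_of_nonneg)
    also have "\<dots> < N z" using h by (rule convex_bound_lt)
    finally show "N (u *\<^sub>R x + v *\<^sub>R y) < N z" .
  qed
  have "\<exists>q b. q \<noteq> 0 \<and> (\<forall>x\<in>?S. q \<bullet> x \<le> b) \<and> (\<forall>x\<in>{z}. b \<le> q \<bullet> x)"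
    using Nz nN(6) by (intro separating_hyperplane_sets cS) (auto intro: exI[of _ 0])
  then obtain q b where q: "q \<noteq> 0" "\<And>x. N x < N z \<Longrightarrow> q \<bullet> x \<le> b" "b \<le> q \<bullet> z" by auto
  \<comment> \<open>A number \<open>t\<close> above \<open>N w\<close> avoids division by 0 when
    \<open>w = 0\<close>; letting \<open>t\<close> decrease to \<open>N w\<close> follows.\<close>
  have qle: "(q \<bullet> w) * N z \<le> (q \<bullet> z) * t" if "N w < t" for w t
  proof -
    have t: "0 < t" using that nN(1)[of w] by linarith
    have "N ((N z / t) *\<^sub>R w) < N z" using that Nz t unfolding nN(3) by (simp add: field_simps)
    from q(2)[OF this] q(3) have "(N z / t) * (q \<bullet> w) \<le> q \<bullet> z" by simp
    then show ?thesis using t by (simp add: field_simps)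
  qed
  have qle': "(q \<bullet> w) * N z \<le> (q \<bullet> z) * N w" for w
  proof (rule tendsto_lowerbound)
    show "((\<lambda>t. (q \<bullet> z) * t) \<longlongrightarrow> (q \<bullet> z) * N w) (at_right (N w))" by (intro tendsto_intros)
    show "\<forall>\<^sub>F t in at_right (N w). (q \<bullet> w) * N z \<le> (q \<bullet> z) * t"
      using eventually_at_right_less[of "N w"] by (rule eventually_mono) (rule qle)
  qed simp
  have "0 < (q \<bullet> q) * N z" using q Nz by simp
  also have "\<dots> \<le> (q \<bullet> z) * N q" by (rule qle')
  finally have qz: "0 < q \<bullet> z" using nN(1)[of q] by (simp add: zero_less_mult_iff)
  show ?thesis
  proof (rule that)
    show "z \<bullet> ((N z / (q \<bullet> z)) *\<^sub>R q) = N z" using qz by (simp add: inner_commute)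
    show "w \<bullet> ((N z / (q \<bullet> z)) *\<^sub>R q) \<le> N w" for w
      using qle'[of w] qz by (simp add: field_simps inner_commute)
  qed
qed

lemma dual_norm_support:
  fixes N :: "'a::euclidean_space \<Rightarrow> real"
  assumes N: "is_norm N" and "\<And>w. w \<bullet> q \<le> N w" "z \<bullet> q = N z" "z \<noteq> 0"
  shows "dual_norm N q = 1"
proof (rule antisym)
  show "dual_norm N q \<le> 1" using assms by (intro dual_norm_le) auto
  have "N z * 1 \<le> N z * dual_norm N q" using inner_le_dual_norm[OF N, of z q] assms by simp
  then show "1 \<le> dual_norm N q" using is_normD(7)[OF N assms(4)] by simp
qed

section \<open>Second differences of a norm\<close>

definition second_difference :: "('a::euclidean_space \<Rightarrow> real) \<Rightarrow> 'a \<Rightarrow> real \<Rightarrow> 'a \<Rightarrow> real" where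
  "second_difference N b h z = N (z + h *\<^sub>R b) + N (z - h *\<^sub>R b) - 2 * N z"

lemma second_difference_nonneg: "is_norm N \<Longrightarrow> 0 \<le> second_difference N b h z"
  using is_normD(4)[of N "z + h *\<^sub>R b" "z - h *\<^sub>R b"] is_normD(3)[of N 2 z]
  by (simp add: second_difference_def scaleR_2)

text \<open>By convexity of \<open>N\<close>, the second difference divided by the step is
  nondecreasing in the step. One good step therefore controls all smaller ones.\<close>

lemma second_difference_mono:
  assumes N: "is_norm N" and t: "0 \<le> t" "t \<le> h" "0 < h"
  shows "second_difference N b t z \<le> t / h * second_difference N b h z"
proof -
  note nN = is_normD[OF N]
  have *: "N (z + t *\<^sub>R c) \<le> (1 - t / h) * N z + t / h * N (z + h *\<^sub>R c)" for c
  proof -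
    have "z + t *\<^sub>R c = (1 - t / h) *\<^sub>R z + (t / h) *\<^sub>R (z + h *\<^sub>R c)"
      using t by (simp add: algebra_simps)
    also have "N \<dots> \<le> N ((1 - t / h) *\<^sub>R z) + N ((t / h) *\<^sub>R (z + h *\<^sub>R c))" by (rule nN(4))
    also have "\<dots> = (1 - t / h) * N z + t / h * N (z + h *\<^sub>R c)"
      using t unfolding nN(3) by (simp add: field_simps)
    finally show ?thesis .
  qed
  define r where "r = t / h"
  show ?thesis using *[of b] *[of "- b"] unfolding r_def[symmetric]
    by (simp add: second_difference_def algebra_simps)
qed

text \<open>Against a Lipschitz weight, discrete integration by parts bounds the integral of the second
  difference by a multiple of \<open>h\<^sup>2\<close>, whereas it is at least of order \<open>h\<close> on the exceptional set.\<close>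

lemma AE_second_difference:
  fixes N :: "'a::euclidean_space \<Rightarrow> real"
  assumes N: "is_norm N" and \<epsilon>: "0 < \<epsilon>"
  shows "AE z in lborel. \<exists>h>0. second_difference N b h z < \<epsilon> * h"
proof -
  \<comment> \<open>Asking for the failure at all \<open>h\<close> at once gives an intersection of
    closed sets, so measurability is immediate.\<close>
  define C where "C = {z. \<forall>h>0. \<epsilon> * h \<le> second_difference N b h z}"
  have cN: "continuous_on S N" for S by (rule continuous_on_is_norm[OF N])
  have cS: "continuous_on UNIV (second_difference N b h)" for h
    unfolding second_difference_def
    by (intro continuous_intros continuous_on_compose2[OF cN[of UNIV]]) auto
  have "closed C"
    unfolding C_def Collect_all_eq Collect_imp_eq
    by (intro closed_INT ballI closed_Un closed_Collect_le cS continuous_on_const) auto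
  then have [measurable]: "C \<in> sets borel" by (rule borel_closed)
  obtain L where L: "0 < L" "\<And>x. N x \<le> L * norm x" using is_norm_le_norm[OF N] by blast
  have null: "AE z in lborel. norm z < R \<longrightarrow> z \<notin> C" if R: "0 < R" for R
  proof -
    \<comment> \<open>A 1-Lipschitz weight, positive on the open ball of radius \<open>R\<close>.
      Its increment over the step \<open>h\<close> is of order \<open>h\<close>, and so is the
      increment of \<open>N\<close>; together they give the square.\<close>
    define \<eta> where "\<eta> z = max 0 (R - norm z)" for z :: 'a
    have c\<eta>: "continuous_on UNIV \<eta>" unfolding \<eta>_def by (intro continuous_intros)
    have \<eta>0: "0 \<le> \<eta> z" "\<eta> z \<noteq> 0 \<Longrightarrow> norm z \<le> R" for z by (auto simp: \<eta>_def max_def split: if_splits)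
    have \<eta>L: "\<bar>\<eta> z - \<eta> w\<bar> \<le> norm (z - w)" for z w
      unfolding \<eta>_def using norm_triangle_ineq3[of z w] by (auto simp: max_def)
    have [measurable]: "\<eta> \<in> borel_measurable borel" "N \<in> borel_measurable borel"
      using c\<eta> cN by (auto intro: borel_measurable_continuous_onI)
    have int: "integrable lborel F" if F: "continuous_on UNIV F" "\<And>z. r < norm z \<Longrightarrow> F z = 0" for F :: "'a \<Rightarrow> real" and r
    proof -
      have "integrable lborel (\<lambda>z. indicator (cball 0 r) z * F z)"
        using borel_integrable_compact[OF compact_cball continuous_on_subset[OF F(1) subset_UNIV], of 0 r] by simp
      also have "(\<lambda>z. indicator (cball 0 r) z * F z) = F" using F(2) by (auto simp: fun_eq_iff indicator_def)
      finally show ?thesis .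
    qed
    define V where "V = measure lborel (cball (0::'a) (R + norm b))"
    have est: "\<epsilon> * (LINT z|lborel. indicator C z * \<eta> z) \<le> h * (L * norm b * norm b * V)" if h: "0 < h" "h < 1" for h
    proof -
      let ?D = "\<lambda>z. N (z + h *\<^sub>R b) - N z"
      have i1: "integrable lborel (\<lambda>z. \<eta> z * ?D z)"
        by (rule int[of _ R]) (use \<eta>0 in \<open>auto intro!: continuous_intros c\<eta> continuous_on_compose2[OF cN[of UNIV]] simp: not_le[symmetric]\<close>)
      have i2: "integrable lborel (\<lambda>z. \<eta> (z + h *\<^sub>R b) * ?D z)"
      proof (rule int[of _ "R + norm b"])
        fix z :: 'a assume "R + norm b < norm z"
        moreover have "norm z \<le> norm (z + h *\<^sub>R b) + norm (h *\<^sub>R b)" using norm_triangle_ineq4[of "z + h *\<^sub>R b" "h *\<^sub>R b"] by simp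
        moreover have "norm (h *\<^sub>R b) \<le> norm b" using h by (simp add: mult_left_le_one_le)
        ultimately have "R < norm (z + h *\<^sub>R b)" by linarith
        then have "\<eta> (z + h *\<^sub>R b) = 0" using \<eta>0(2) not_le by blast
        then show "\<eta> (z + h *\<^sub>R b) * ?D z = 0" by simp
      qed (auto intro!: continuous_intros continuous_on_compose2[OF c\<eta>] continuous_on_compose2[OF cN[of UNIV]])
      have i3: "integrable lborel (\<lambda>z. \<eta> z * (N z - N (z - h *\<^sub>R b)))"
        by (rule int[of _ R]) (use \<eta>0 in \<open>auto intro!: continuous_intros c\<eta> continuous_on_compose2[OF cN[of UNIV]] simp: not_le[symmetric]\<close>)
      \<comment> \<open>Discrete integration by parts: translation invariance turns the backward
        difference of \<open>N\<close> into the forward one, against the shifted weight.\<close>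
      have shift: "(LINT z|lborel. \<eta> z * (N z - N (z - h *\<^sub>R b))) = (LINT z|lborel. \<eta> (z + h *\<^sub>R b) * ?D z)"
        using lborel_translation(2)[of UNIV "\<lambda>z. \<eta> z * (N z - N (z - h *\<^sub>R b))" "h *\<^sub>R b"] i3
        by (simp add: set_lebesgue_integral_def set_integrable_def)
      have i4: "integrable lborel (\<lambda>z. indicator C z * \<eta> z)"
        by (rule Bochner_Integration.integrable_bound[OF int[OF c\<eta>, of R]])
          (use \<eta>0 in \<open>auto simp: indicator_def not_le[symmetric]\<close>)
      have i5: "integrable lborel (\<lambda>z. L * h * norm b * (h * norm b) * indicator (cball (0::'a) (R + norm b)) z)"
        by (intro integrable_mult_right integrable_real_indicator emeasure_lborel_cball_finite) auto
      have "h * (\<epsilon> * (LINT z|lborel. indicator C z * \<eta> z)) = (LINT z|lborel. (h * \<epsilon>) * (indicator C z * \<eta> z))"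
        by simp
      also have "\<dots> \<le> (LINT z|lborel. \<eta> z * ?D z - \<eta> z * (N z - N (z - h *\<^sub>R b)))"
      proof (rule integral_mono)
        fix z :: 'a
        have "(h * \<epsilon>) * indicator C z \<le> second_difference N b h z"
          using h second_difference_nonneg[OF N] by (auto simp: C_def indicator_def mult.commute)
        then have "(h * \<epsilon>) * indicator C z * \<eta> z \<le> second_difference N b h z * \<eta> z"
          using \<eta>0 by (intro mult_right_mono) auto
        then show "(h * \<epsilon>) * (indicator C z * \<eta> z) \<le> \<eta> z * ?D z - \<eta> z * (N z - N (z - h *\<^sub>R b))"
          by (simp add: second_difference_def algebra_simps)
      qed (intro integrable_mult_right Bochner_Integration.integrable_diff i1 i3 i4)+
      also have "\<dots> = (LINT z|lborel. \<eta> z * ?D z - \<eta> (z + h *\<^sub>R b) * ?D z)"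
        using i1 i2 i3 shift by simp
      also have "\<dots> \<le> (LINT z|lborel. L * h * norm b * (h * norm b) * indicator (cball (0::'a) (R + norm b)) z)"
      proof (rule integral_mono)
        fix z :: 'a
        have "\<bar>?D z\<bar> \<le> L * h * norm b"
          using is_norm_diff_le[OF N, of "z + h *\<^sub>R b" z] L(2)[of "h *\<^sub>R b"] h by (simp add: mult.assoc)
        moreover have "\<bar>\<eta> z - \<eta> (z + h *\<^sub>R b)\<bar> \<le> h * norm b" using \<eta>L[of z "z + h *\<^sub>R b"] h by simp
        ultimately have "\<bar>?D z\<bar> * \<bar>\<eta> z - \<eta> (z + h *\<^sub>R b)\<bar> \<le> L * h * norm b * (h * norm b)"
          by (intro mult_mono) (use L h in auto)
        then have "\<bar>?D z * (\<eta> z - \<eta> (z + h *\<^sub>R b))\<bar> \<le> L * h * norm b * (h * norm b)" by (simp add: abs_mult)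
        then have 1: "\<eta> z * ?D z - \<eta> (z + h *\<^sub>R b) * ?D z \<le> L * h * norm b * (h * norm b)"
          by (simp add: abs_le_iff algebra_simps)
        show "\<eta> z * ?D z - \<eta> (z + h *\<^sub>R b) * ?D z \<le> L * h * norm b * (h * norm b) * indicator (cball (0::'a) (R + norm b)) z"
        proof (cases "norm z \<le> R + norm b")
          case False
          moreover have "norm z \<le> norm (z + h *\<^sub>R b) + norm (h *\<^sub>R b)" using norm_triangle_ineq4[of "z + h *\<^sub>R b" "h *\<^sub>R b"] by simp
          moreover have "norm (h *\<^sub>R b) \<le> norm b" using h by (simp add: mult_left_le_one_le)
          ultimately have "R < norm (z + h *\<^sub>R b)" "R < norm z" using norm_ge_zero[of b] by linarith+
          then have "\<eta> (z + h *\<^sub>R b) = 0" "\<eta> z = 0" using \<eta>0(2) not_le by blast+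
          then show ?thesis using False by simp
        qed (use 1 in simp)
      qed (intro Bochner_Integration.integrable_diff i1 i2 i5)+
      also have "\<dots> = h * (h * (L * norm b * norm b * V))" by (simp add: V_def)
      finally show ?thesis using h by simp
    qed
    have i4: "integrable lborel (\<lambda>z. indicator C z * \<eta> z)"
      by (rule Bochner_Integration.integrable_bound[OF int[OF c\<eta>, of R]])
        (use \<eta>0 in \<open>auto simp: indicator_def not_le[symmetric]\<close>)
    have "\<epsilon> * (LINT z|lborel. indicator C z * \<eta> z) \<le> 0 * (L * norm b * norm b * V)"
    proof (rule tendsto_lowerbound)
      show "((\<lambda>h. h * (L * norm b * norm b * V)) \<longlongrightarrow> 0 * (L * norm b * norm b * V)) (at_right 0)"
        by (intro tendsto_intros)
      have "\<forall>\<^sub>F h in at_right 0. 0 < h \<and> h < (1::real)"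
        by (auto simp: eventually_at_right_field intro!: exI[of _ 1])
      then show "\<forall>\<^sub>F h in at_right 0. \<epsilon> * (LINT z|lborel. indicator C z * \<eta> z) \<le> h * (L * norm b * norm b * V)"
        by (rule eventually_mono) (use est in blast)
    qed simp
    then have "(LINT z|lborel. indicator C z * \<eta> z) \<le> 0" using \<epsilon> by (simp add: mult_le_0_iff)
    moreover have "0 \<le> (LINT z|lborel. indicator C z * \<eta> z)"
      using \<eta>0 by (intro Bochner_Integration.integral_nonneg) auto
    ultimately have "(LINT z|lborel. indicator C z * \<eta> z) = 0" by simp
    then have "AE z in lborel. indicator C z * \<eta> z = 0"
      using i4 \<eta>0 by (subst (asm) integral_nonneg_eq_0_iff_AE) auto
    then show ?thesis by (rule eventually_mono) (auto simp: \<eta>_def indicator_def split: if_splits)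
  qed
  have "AE z in lborel. \<forall>k::nat. norm z < real (Suc k) \<longrightarrow> z \<notin> C"
    using null by (subst AE_all_countable) auto
  then show ?thesis
  proof (rule eventually_mono)
    fix z assume *: "\<forall>k::nat. norm z < real (Suc k) \<longrightarrow> z \<notin> C"
    obtain k :: nat where "norm z < k" using reals_Archimedean2 by blast
    then have "z \<notin> C" using *[rule_format, of k] by simp
    then show "\<exists>h>0. second_difference N b h z < \<epsilon> * h" by (auto simp: C_def not_le)
  qed
qed

text \<open>Let \<open>g\<close> be the excess of \<open>N\<close> over a supporting functional at
  \<open>z\<close>. It is nonnegative and convex, so \<open>g w\<close> is at most the average of
  its values at \<open>DIM('a)\<close> times the coordinate parts of \<open>w\<close>, and each of
  these values is bounded by a second difference. Small second differences along the basis thus give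
  full differentiability, with the supporting functional as derivative.\<close>

lemma AE_is_norm_differentiable:
  fixes N :: "'a::euclidean_space \<Rightarrow> real"
  assumes N: "is_norm N"
  shows "AE z in lborel. \<exists>q. (N has_derivative (\<lambda>w. w \<bullet> q)) (at z) \<and> (\<forall>w. w \<bullet> q \<le> N w) \<and> z \<bullet> q = N z"
proof -
  note nN = is_normD[OF N]
  have "AE z in lborel. \<forall>b\<in>Basis. \<forall>k::nat. \<exists>h>0. second_difference N b h z < 1 / real (Suc k) * h"
  proof (intro AE_finite_allI finite_Basis)
    fix b :: 'a
    show "AE z in lborel. \<forall>k::nat. \<exists>h>0. second_difference N b h z < 1 / real (Suc k) * h"
      by (subst AE_all_countable) (intro allI AE_second_difference[OF N], simp)
  qed
  then show ?thesis
  proof (rule eventually_mono)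
    fix z assume good: "\<forall>b\<in>Basis. \<forall>k::nat. \<exists>h>0. second_difference N b h z < 1 / real (Suc k) * h"
    obtain q where q: "\<And>w. w \<bullet> q \<le> N w" "z \<bullet> q = N z" using is_norm_support[OF N] by blast
    define g where "g w = N (z + w) - N z - w \<bullet> q" for w
    have g0: "0 \<le> g w" for w using q(1)[of "z + w"] q(2) by (simp add: g_def inner_add_left)
    let ?n = "real DIM('a)"
    have n: "0 < ?n" by simp
    have avg: "g w \<le> 1 / ?n * (\<Sum>b\<in>Basis. g ((?n * (w \<bullet> b)) *\<^sub>R b))" for w
    proof -
      have sum_le: "N (\<Sum>b\<in>S. v b) \<le> (\<Sum>b\<in>S. N (v b))" if "finite S" for S and v :: "'a \<Rightarrow> 'a"
        using that by (induction S rule: finite_induct) (auto simp: nN(6) intro: order_trans[OF nN(4)])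
      have "z + w = (\<Sum>b\<in>Basis. (1 / ?n) *\<^sub>R (z + (?n * (w \<bullet> b)) *\<^sub>R b))"
        using n by (simp add: scaleR_right_distrib sum.distrib sum_constant_scaleR euclidean_representation)
      then have "N (z + w) \<le> (\<Sum>b\<in>Basis. N ((1 / ?n) *\<^sub>R (z + (?n * (w \<bullet> b)) *\<^sub>R b)))"
        using sum_le[OF finite_Basis] by metis
      also have "\<dots> = 1 / ?n * (\<Sum>b\<in>Basis. N (z + (?n * (w \<bullet> b)) *\<^sub>R b))"
        unfolding nN(3) sum_distrib_left by simp
      finally have 1: "N (z + w) \<le> 1 / ?n * (\<Sum>b\<in>Basis. N (z + (?n * (w \<bullet> b)) *\<^sub>R b))" .
      have "1 / ?n * (\<Sum>b\<in>Basis. g ((?n * (w \<bullet> b)) *\<^sub>R b)) =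
         1 / ?n * (\<Sum>b\<in>Basis. N (z + (?n * (w \<bullet> b)) *\<^sub>R b)) - N z - (\<Sum>b\<in>Basis. (w \<bullet> b) * (q \<bullet> b))"
        using n by (simp add: g_def sum_subtractf diff_divide_distrib sum_divide_distrib inner_commute)
      also have "(\<Sum>b\<in>Basis. (w \<bullet> b) * (q \<bullet> b)) = w \<bullet> q" by (rule euclidean_inner[symmetric])
      finally show ?thesis using 1 by (simp add: g_def)
    qed
    have small: "\<exists>d>0. \<forall>t. \<bar>t\<bar> \<le> d \<longrightarrow> g (t *\<^sub>R b) \<le> \<epsilon> * \<bar>t\<bar>" if b: "b \<in> Basis" and \<epsilon>: "0 < \<epsilon>" for b \<epsilon>
    proof -
      obtain k :: nat where k: "1 / real (Suc k) < \<epsilon>" using \<epsilon> nat_approx_posE by metis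
      obtain h where h: "0 < h" "second_difference N b h z < 1 / real (Suc k) * h" using good b by blast
      have "g (t *\<^sub>R b) \<le> \<epsilon> * \<bar>t\<bar>" if t: "\<bar>t\<bar> \<le> h" for t
      proof -
        have "g (t *\<^sub>R b) \<le> g (t *\<^sub>R b) + g (- t *\<^sub>R b)" using g0 by simp
        also have "\<dots> = second_difference N b \<bar>t\<bar> z" by (simp add: g_def second_difference_def abs_if)
        also have "\<dots> \<le> \<bar>t\<bar> / h * second_difference N b h z" using t h by (intro second_difference_mono[OF N]) auto
        also have "\<dots> \<le> \<bar>t\<bar> / h * (1 / real (Suc k) * h)" using h by (intro mult_left_mono) auto
        also have "\<dots> = 1 / real (Suc k) * \<bar>t\<bar>" using h by simp
        also have "\<dots> \<le> \<epsilon> * \<bar>t\<bar>" using k by (intro mult_right_mono) auto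
        finally show ?thesis .
      qed
      then show ?thesis using h by blast
    qed
    have "(N has_derivative (\<lambda>w. w \<bullet> q)) (at z)"
      unfolding has_derivative_at_alt
    proof (intro conjI allI impI)
      show "bounded_linear (\<lambda>w. w \<bullet> q)" by (rule bounded_linear_inner_left)
      fix \<epsilon> :: real assume \<epsilon>: "0 < \<epsilon>"
      then have "\<forall>b\<in>Basis. \<exists>d>0. \<forall>t. \<bar>t\<bar> \<le> d \<longrightarrow> g (t *\<^sub>R b) \<le> \<epsilon> / ?n * \<bar>t\<bar>"
        using small[of _ "\<epsilon> / ?n"] n by (meson divide_pos_pos)
      then obtain d where d: "\<And>b. b \<in> Basis \<Longrightarrow> 0 < d b"
        "\<And>b t. b \<in> Basis \<Longrightarrow> \<bar>t\<bar> \<le> d b \<Longrightarrow> g (t *\<^sub>R b) \<le> \<epsilon> / ?n * \<bar>t\<bar>" by metis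
      define d0 where "d0 = Min (d ` Basis) / ?n"
      have d0: "0 < d0" using d n unfolding d0_def by (intro divide_pos_pos) auto
      show "\<exists>d>0. \<forall>y. norm (y - z) < d \<longrightarrow> norm (N y - N z - (y - z) \<bullet> q) \<le> \<epsilon> * norm (y - z)"
      proof (intro exI conjI allI impI, rule d0)
        fix y assume y: "norm (y - z) < d0"
        let ?w = "y - z"
        have "g ?w \<le> 1 / ?n * (\<Sum>b\<in>Basis. g ((?n * (?w \<bullet> b)) *\<^sub>R b))" by (rule avg)
        also have "\<dots> \<le> 1 / ?n * (\<Sum>b\<in>(Basis::'a set). \<epsilon> * norm ?w)"
        proof (intro mult_left_mono sum_mono)
          fix b :: 'a assume b: "b \<in> Basis"
          have wb: "\<bar>?w \<bullet> b\<bar> \<le> norm ?w" by (rule Basis_le_norm[OF b])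
          have "?n * d0 \<le> d b" using b n by (simp add: d0_def)
          moreover have "?n * \<bar>?w \<bullet> b\<bar> \<le> ?n * d0" using wb y n by (intro mult_left_mono) auto
          moreover have "\<bar>?n * (?w \<bullet> b)\<bar> = ?n * \<bar>?w \<bullet> b\<bar>" by (simp add: abs_mult)
          ultimately have "\<bar>?n * (?w \<bullet> b)\<bar> \<le> d b" by linarith
          from d(2)[OF b this] have "g ((?n * (?w \<bullet> b)) *\<^sub>R b) \<le> \<epsilon> * \<bar>?w \<bullet> b\<bar>" using n by (simp add: abs_mult)
          also have "\<dots> \<le> \<epsilon> * norm ?w" using wb \<epsilon> by (intro mult_left_mono) auto
          finally show "g ((?n * (?w \<bullet> b)) *\<^sub>R b) \<le> \<epsilon> * norm ?w" .
        qed auto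
        also have "\<dots> = \<epsilon> * norm ?w" using n by simp
        finally show "norm (N y - N z - ?w \<bullet> q) \<le> \<epsilon> * norm ?w" using g0[of ?w] by (simp add: g_def)
      qed
    qed
    then show "\<exists>q. (N has_derivative (\<lambda>w. w \<bullet> q)) (at z) \<and> (\<forall>w. w \<bullet> q \<le> N w) \<and> z \<bullet> q = N z"
      using q by blast
  qed
qed

section \<open>Smooth approximation of powers of a norm\<close>

lemma C_k_on_cong:
  assumes "open U" "\<And>x. x \<in> U \<Longrightarrow> f x = g x" "C_k_on k f U"
  shows "C_k_on k g U"
  using assms(2,3)
proof (induction k arbitrary: f g)
  case 0
  then show ?case by (simp cong: continuous_on_cong)
next
  case (Suc k)
  have *: "g differentiable (at x)" "frechet_derivative f (at x) = frechet_derivative g (at x)" if x: "x \<in> U" for x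
  proof -
    have "(f has_derivative frechet_derivative f (at x)) (at x)"
      using Suc.prems(2) x by (simp add: frechet_derivative_works)
    then have "(g has_derivative frechet_derivative f (at x)) (at x)"
      by (rule has_derivative_transform_within_open[OF _ assms(1) x]) (use Suc.prems in auto)
    then show "g differentiable (at x)" "frechet_derivative f (at x) = frechet_derivative g (at x)"
      by (auto simp: differentiable_def dest: frechet_derivative_at)
  qed
  have "C_k_on k (\<lambda>x. frechet_derivative g (at x) v) U" for v
    by (rule Suc.IH[where f = "\<lambda>x. frechet_derivative f (at x) v"]) (use Suc.prems * in auto)
  then show ?case using * by simp
qed

text \<open>Lets the closure proofs exhibit a derivative instead of computing with
  \<open>frechet_derivative\<close>.\<close>

lemma C_k_on_SucI:
  assumes "open U" "\<And>x. x \<in> U \<Longrightarrow> (f has_derivative f' x) (at x)" "\<And>v. C_k_on k (\<lambda>x. f' x v) U"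
  shows "C_k_on (Suc k) f U"
proof -
  have "C_k_on k (\<lambda>x. frechet_derivative f (at x) v) U" for v
    by (rule C_k_on_cong[OF assms(1) _ assms(3)[of v]]) (metis assms(2) frechet_derivative_at)
  then show ?thesis using assms(2) by (auto simp: differentiable_def)
qed

lemma C_k_on_SucD:
  assumes "C_k_on (Suc k) f U"
  shows "x \<in> U \<Longrightarrow> (f has_derivative frechet_derivative f (at x)) (at x)"
    "C_k_on k (\<lambda>x. frechet_derivative f (at x) v) U"
  using assms by (auto simp: frechet_derivative_works)

lemma C_k_on_Suc_imp:
  assumes "open U" "C_k_on (Suc k) f U"
  shows "C_k_on k f U"
  using assms(2)
proof (induction k arbitrary: f)
  case 0
  then show ?case by (auto intro!: continuous_at_imp_continuous_on differentiable_imp_continuous_within)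
next
  case (Suc k)
  show ?case
    by (rule C_k_on_SucI[OF assms(1) C_k_on_SucD(1)[OF Suc.prems]])
      (auto intro!: Suc.IH C_k_on_SucD(2)[OF Suc.prems])
qed

lemma C_k_on_const: "open U \<Longrightarrow> C_k_on k (\<lambda>_. c) U"
proof (induction k arbitrary: c)
  case (Suc k)
  then show ?case by (intro C_k_on_SucI[where f' = "\<lambda>_ _. 0"]) auto
qed auto

lemma C_k_on_affine: "open U \<Longrightarrow> C_k_on k (\<lambda>z. l \<bullet> (z + e)) U"
proof (cases k)
  case 0
  then show ?thesis by (auto intro!: continuous_intros)
next
  case (Suc j)
  assume "open U"
  then show ?thesis unfolding Suc
    by (intro C_k_on_SucI[where f' = "\<lambda>_ v. l \<bullet> v"] C_k_on_const)
       (auto intro!: derivative_eq_intros)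
qed

lemma C_k_on_add: "open U \<Longrightarrow> C_k_on k f U \<Longrightarrow> C_k_on k g U \<Longrightarrow> C_k_on k (\<lambda>x. f x + g x) U"
proof (induction k arbitrary: f g)
  case (Suc k)
  show ?case
    by (rule C_k_on_SucI[OF Suc.prems(1) has_derivative_add[OF C_k_on_SucD(1)[OF Suc.prems(2)] C_k_on_SucD(1)[OF Suc.prems(3)]]])
      (auto intro!: Suc.IH Suc.prems(1) C_k_on_SucD(2)[OF Suc.prems(2)] C_k_on_SucD(2)[OF Suc.prems(3)])
qed (auto intro: continuous_intros)

lemma C_k_on_mult: "open U \<Longrightarrow> C_k_on k f U \<Longrightarrow> C_k_on k g U \<Longrightarrow> C_k_on k (\<lambda>x. f x * g x) U"
proof (induction k arbitrary: f g)
  case (Suc k)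
  show ?case
    by (rule C_k_on_SucI[OF Suc.prems(1) has_derivative_mult[OF C_k_on_SucD(1)[OF Suc.prems(2)] C_k_on_SucD(1)[OF Suc.prems(3)]]])
      (auto intro!: C_k_on_add Suc.IH Suc.prems(1) C_k_on_SucD(2)[OF Suc.prems(2)] C_k_on_SucD(2)[OF Suc.prems(3)]
         C_k_on_Suc_imp[OF Suc.prems(1,2)] C_k_on_Suc_imp[OF Suc.prems(1,3)])
qed (auto intro: continuous_intros)

lemma C_k_on_power: "open U \<Longrightarrow> C_k_on k f U \<Longrightarrow> C_k_on k (\<lambda>x. f x ^ m) U"
  by (induction m) (auto intro: C_k_on_const C_k_on_mult)

lemma C_k_on_sum:
  assumes "open U" "finite L" "\<And>l. l \<in> L \<Longrightarrow> C_k_on k (f l) U"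
  shows "C_k_on k (\<lambda>x. \<Sum>l\<in>L. f l x) U"
  using assms(2,3) by (induction L rule: finite_induct) (auto intro: C_k_on_const C_k_on_add assms(1))

lemma has_derivative_powr_const:
  fixes u :: "'a::real_normed_vector \<Rightarrow> real"
  assumes "(u has_derivative u') (at x)" "0 < u x"
  shows "((\<lambda>x. u x powr r) has_derivative (\<lambda>v. r * u x powr (r - 1) * u' v)) (at x)"
  using DERIV_compose_FDERIV[OF has_real_derivative_powr[OF assms(2)] assms(1), of r]
  by (simp add: mult_ac)

text \<open>Differentiation changes the exponent, so the induction runs over all \<open>r\<close>;
  the derivative of \<open>u\<close> appears as a factor, so all orders of \<open>u\<close> are
  assumed at once.\<close>

lemma C_k_on_powr:
  assumes "open U" "\<And>j. C_k_on j u U" "\<And>x. x \<in> U \<Longrightarrow> 0 < u x"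
  shows "C_k_on k (\<lambda>x. u x powr r) U"
proof (induction k arbitrary: r)
  case 0
  show ?case using assms(2)[of 0] assms(3) by (force intro!: continuous_intros)
next
  case (Suc k)
  have D: "x \<in> U \<Longrightarrow> (u has_derivative frechet_derivative u (at x)) (at x)" for x
    using C_k_on_SucD(1)[OF assms(2)[of "Suc 0"]] .
  show ?case
  proof (rule C_k_on_SucI[OF assms(1) has_derivative_powr_const[OF D assms(3)]])
    fix v
    show "C_k_on k (\<lambda>x. r * u x powr (r - 1) * frechet_derivative u (at x) v) U"
      by (intro C_k_on_mult C_k_on_const Suc assms(1) C_k_on_SucD(2)[OF assms(2)])
  qed
qed

text \<open>By compactness of the unit sphere, finitely many supporting functionals norm every
  vector up to the factor \<open>1 - \<epsilon>\<close>.\<close>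

lemma polyhedral_norm_approx:
  fixes N :: "'a::euclidean_space \<Rightarrow> real"
  assumes N: "is_norm N" and \<epsilon>: "0 < \<epsilon>"
  obtains L where "finite L" "\<And>l w. l \<in> L \<Longrightarrow> \<bar>l \<bullet> w\<bar> \<le> N w"
    "\<And>w. w \<noteq> 0 \<Longrightarrow> \<exists>l\<in>L. (1 - \<epsilon>) * N w < l \<bullet> w"
proof -
  note nN = is_normD[OF N]
  have "\<exists>q. (\<forall>w. w \<bullet> q \<le> N w) \<and> z \<bullet> q = N z" for z using is_norm_support[OF N] by metis
  then obtain q where q: "\<And>z w. w \<bullet> q z \<le> N w" "\<And>z. z \<bullet> q z = N z" by metis
  define V where "V z = {w. (1 - \<epsilon>) * N w < w \<bullet> q z}" for z
  have "open (V z)" for z unfolding V_def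
    by (intro open_Collect_less continuous_intros continuous_on_is_norm N)
  moreover have "sphere 0 1 \<subseteq> (\<Union>z\<in>sphere 0 1. V z)"
  proof
    fix z :: 'a assume z: "z \<in> sphere 0 1"
    then have "z \<noteq> 0" by force
    then have "0 < N z" by (rule nN(7))
    then have "z \<in> V z" using q(2)[of z] \<epsilon> by (simp add: V_def algebra_simps)
    then show "z \<in> (\<Union>z\<in>sphere 0 1. V z)" using z by blast
  qed
  ultimately obtain T where T: "T \<subseteq> sphere 0 1" "finite T" "sphere 0 1 \<subseteq> (\<Union>z\<in>T. V z)"
    using compactE_image[OF compact_sphere, of "sphere 0 1" V 0 1] by metis
  show thesis
  proof (rule that[of "q ` T"])
    show "finite (q ` T)" using T by simp
    show "\<bar>l \<bullet> w\<bar> \<le> N w" if "l \<in> q ` T" for l w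
      using that q(1)[of w] q(1)[of "- w"] nN(5)[of w] by (auto simp: inner_commute abs_le_iff)
    show "\<exists>l\<in>q ` T. (1 - \<epsilon>) * N w < l \<bullet> w" if w: "w \<noteq> 0" for w
    proof -
      have "w /\<^sub>R norm w \<in> sphere 0 1" using w by simp
      then obtain z where z: "z \<in> T" "w /\<^sub>R norm w \<in> V z" using T(3) by blast
      then have "(1 - \<epsilon>) * (N w / norm w) < (w \<bullet> q z) / norm w"
        unfolding V_def using nN(3)[of "inverse (norm w)" w] by (simp add: divide_inverse mult_ac)
      then have "(1 - \<epsilon>) * N w < q z \<bullet> w" using w by (simp add: divide_less_cancel inner_commute)
      then show ?thesis using z by blast
    qed
  qed
qed

text \<open>Used for the gradient of the \<open>l^k\<close> norm \<open>M\<close>, with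
  \<open>k = Suc j\<close>. An entry above \<open>\<delta> * M\<close> satisfies
  \<open>t l ^ j \<le> t l ^ Suc j / (\<delta> * M)\<close>, any other is bounded by the constant.
  For \<open>\<delta>\<close> slightly below 1 and then \<open>j\<close> large, the constant is
  close to 1 whatever the number of entries.\<close>

lemma sum_power_pred_le:
  fixes t :: "'a \<Rightarrow> real" and M \<delta> :: real
  assumes L: "finite L" "\<And>l. l \<in> L \<Longrightarrow> 0 \<le> t l" and M: "0 < M" "(\<Sum>l\<in>L. t l ^ Suc j) = M ^ Suc j"
    and \<delta>: "0 < \<delta>"
  shows "(\<Sum>l\<in>L. t l ^ j) \<le> (1 / \<delta> + card L * \<delta> ^ j) * M ^ j"
proof -
  have "(\<Sum>l\<in>L. t l ^ j) \<le> (\<Sum>l\<in>L. t l ^ Suc j / (\<delta> * M) + (\<delta> * M) ^ j)"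
  proof (rule sum_mono)
    fix l assume l: "l \<in> L"
    have t: "0 \<le> t l" using L l by auto
    show "t l ^ j \<le> t l ^ Suc j / (\<delta> * M) + (\<delta> * M) ^ j"
    proof (cases "\<delta> * M \<le> t l")
      case True
      then have "t l ^ j * (\<delta> * M) \<le> t l ^ j * t l" using t by (intro mult_left_mono) auto
      then have "t l ^ j \<le> t l ^ Suc j / (\<delta> * M)" using \<delta> M by (simp add: pos_le_divide_eq mult.commute)
      moreover have "0 \<le> (\<delta> * M) ^ j" using \<delta> M by simp
      ultimately show ?thesis by linarith
    next
      case False
      then have "t l ^ j \<le> (\<delta> * M) ^ j" using t by (intro power_mono) auto
      moreover have "0 \<le> t l ^ Suc j / (\<delta> * M)" using \<delta> M t by simp
      ultimately show ?thesis by linarith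
    qed
  qed
  also have "\<dots> = M ^ Suc j / (\<delta> * M) + card L * (\<delta> * M) ^ j"
    by (simp add: sum.distrib sum_divide_distrib[symmetric] M(2)[simplified])
  also have "\<dots> = (1 / \<delta> + card L * \<delta> ^ j) * M ^ j"
    using M \<delta> by (simp add: field_simps)
  finally show ?thesis .
qed

text \<open>\<open>f\<close> is a negative power of the \<open>l^k\<close> combination of the
  functionals in \<open>L\<close>, with \<open>k = Suc j\<close>. An even \<open>k\<close> makes the
  sum of powers a polynomial that is positive on \<open>U\<close>; a large \<open>k\<close> makes
  the combination, and its gradient in the dual norm of \<open>N\<close>, agree with those of a norm
  up to \<open>\<epsilon>\<close>.\<close>

lemma smooth_norm_power_approx:
  fixes N :: "'a::euclidean_space \<Rightarrow> real"
  assumes N: "is_norm N" and \<epsilon>: "0 < \<epsilon>" "\<epsilon> < 1" and s: "0 < s" and U: "open U" "\<And>z. z \<in> U \<Longrightarrow> z + e \<noteq> 0"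
  obtains f where "\<And>k. C_k_on k f U"
    "\<And>z. z \<in> U \<Longrightarrow> ((1 + \<epsilon>) * N (z + e)) powr (- s) \<le> f z"
    "\<And>z. z \<in> U \<Longrightarrow> f z \<le> ((1 - \<epsilon>) * N (z + e)) powr (- s)"
    "\<And>z. z \<in> U \<Longrightarrow> \<exists>D. (f has_derivative (\<lambda>w. w \<bullet> D)) (at z) \<and>
        dual_norm N D \<le> s * (1 + \<epsilon>) * ((1 - \<epsilon>) * N (z + e)) powr (- s - 1)"
proof -
  note nN = is_normD[OF N]
  obtain L where L: "finite L" "\<And>l w. l \<in> L \<Longrightarrow> \<bar>l \<bullet> w\<bar> \<le> N w"
    "\<And>w. w \<noteq> 0 \<Longrightarrow> \<exists>l\<in>L. (1 - \<epsilon>) * N w < l \<bullet> w"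
    using polyhedral_norm_approx[OF N \<epsilon>(1)] by blast
  \<comment> \<open>Splits the allowance \<open>\<epsilon>\<close>:
    \<open>1 / \<delta> = 1 + \<epsilon> / 2\<close>, and \<open>j\<close> is then so large that
    \<open>card L * \<delta> ^ j < \<epsilon> / 2\<close>. The same \<open>j\<close> absorbs
    \<open>card L\<close> into \<open>(1 + \<epsilon>) ^ Suc j\<close>.\<close>
  define \<delta> where "\<delta> = 1 / (1 + \<epsilon> / 2)"
  have \<delta>: "0 < \<delta>" "\<delta> < 1" "1 / \<delta> = 1 + \<epsilon> / 2" using \<epsilon> by (auto simp: \<delta>_def field_simps)
  have "(\<lambda>j. card L * \<delta> ^ j) \<longlonglongrightarrow> real (card L) * 0" using \<delta> by (intro tendsto_intros LIMSEQ_realpow_zero) auto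
  then have "\<forall>\<^sub>F j in sequentially. card L * \<delta> ^ j < \<epsilon> / 2" using \<epsilon> by (intro order_tendstoD(2)) auto
  then obtain j0 where j0: "\<And>j. j0 \<le> j \<Longrightarrow> card L * \<delta> ^ j < \<epsilon> / 2" by (auto simp: eventually_sequentially)
  \<comment> \<open>Odd, so that the exponent \<open>Suc j\<close> is even.\<close>
  define j where "j = Suc (2 * j0)"
  have j: "even (Suc j)" "odd j" "card L * \<delta> ^ j < \<epsilon> / 2" using j0[of j] by (simp_all add: j_def del: power_Suc)
  have cardL: "card L \<le> (1 + \<epsilon>) ^ Suc j"
  proof -
    have "card L < \<epsilon> / 2 * (1 + \<epsilon> / 2) ^ j" using j(3) \<epsilon> by (simp add: \<delta>_def power_divide field_simps)
    also have "\<dots> \<le> (1 + \<epsilon>) * (1 + \<epsilon>) ^ j" using \<epsilon> by (intro mult_mono power_mono) auto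
    finally show ?thesis by simp
  qed
  define k where "k = real (Suc j)"
  have k: "0 < k" by (simp add: k_def)
  define u where "u z = (\<Sum>l\<in>L. (l \<bullet> (z + e)) ^ Suc j)" for z
  have u_ge: "((1 - \<epsilon>) * N (z + e)) ^ Suc j \<le> u z" and u_le: "u z \<le> ((1 + \<epsilon>) * N (z + e)) ^ Suc j"
    if z: "z \<in> U" for z
  proof -
    obtain l where l: "l \<in> L" "(1 - \<epsilon>) * N (z + e) < l \<bullet> (z + e)" using L(3) U(2)[OF z] by blast
    have "((1 - \<epsilon>) * N (z + e)) ^ Suc j \<le> (l \<bullet> (z + e)) ^ Suc j"
      using l \<epsilon> nN(1) by (intro power_mono) auto
    also have "\<dots> \<le> u z" unfolding u_def using L(1) l(1) j(1)
      by (intro member_le_sum) (auto simp del: power_Suc simp: zero_le_even_power)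
    finally show "((1 - \<epsilon>) * N (z + e)) ^ Suc j \<le> u z" .
    have "u z \<le> (\<Sum>l\<in>L. N (z + e) ^ Suc j)" unfolding u_def
    proof (rule sum_mono)
      fix l assume "l \<in> L"
      then have "\<bar>l \<bullet> (z + e)\<bar> ^ Suc j \<le> N (z + e) ^ Suc j" using L(2) by (intro power_mono) auto
      then show "(l \<bullet> (z + e)) ^ Suc j \<le> N (z + e) ^ Suc j" using power_even_abs[OF j(1)] by metis
    qed
    also have "\<dots> = card L * N (z + e) ^ Suc j" by simp
    also have "\<dots> \<le> (1 + \<epsilon>) ^ Suc j * N (z + e) ^ Suc j" using cardL nN(1) by (intro mult_right_mono) auto
    finally show "u z \<le> ((1 + \<epsilon>) * N (z + e)) ^ Suc j" by (simp only: power_mult_distrib)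
  qed
  have Npos: "0 < N (z + e)" if "z \<in> U" for z using nN(7) U(2)[OF that] by blast
  have upos: "0 < u z" if "z \<in> U" for z
    using u_ge[OF that] Npos[OF that] \<epsilon> by (meson diff_gt_0_iff_gt less_le_trans mult_pos_pos zero_less_power)
  have u_k: "u z powr (1 / k) = M \<longleftrightarrow> u z = M ^ Suc j" if "0 < M" "z \<in> U" for z M
  proof
    assume "u z powr (1 / k) = M"
    then have "M powr k = u z" using upos[OF that(2)] k by (simp add: powr_powr[symmetric] flip: \<open>u z powr (1 / k) = M\<close>) (simp add: powr_powr)
    then show "u z = M ^ Suc j" using that(1) unfolding k_def by (metis powr_realpow)
  next
    assume "u z = M ^ Suc j"
    then have "u z = M powr k" using that(1) unfolding k_def by (metis powr_realpow)
    then show "u z powr (1 / k) = M" using that(1) k by (simp add: powr_powr)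
  qed
  have powk: "(c ^ Suc j) powr (- s / k) = c powr (- s)" if "0 < c" for c
  proof -
    have "c ^ Suc j = c powr k" using that unfolding k_def by (metis powr_realpow)
    then show ?thesis using k by (simp add: powr_powr)
  qed
  define f where "f z = u z powr (- s / k)" for z
  have Cu: "C_k_on i u U" for i unfolding u_def
    by (intro C_k_on_sum L(1) U(1) C_k_on_power C_k_on_affine)
  show thesis
  proof (rule that[of f])
    show "C_k_on i f U" for i unfolding f_def by (rule C_k_on_powr[OF U(1) Cu upos])
    fix z assume z: "z \<in> U"
    have c: "0 < (1 - \<epsilon>) * N (z + e)" "0 < (1 + \<epsilon>) * N (z + e)" using Npos[OF z] \<epsilon> by auto
    have sk: "- s / k \<le> 0" using s k by simp
    show "((1 + \<epsilon>) * N (z + e)) powr (- s) \<le> f z"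
      unfolding f_def powk[OF c(2), symmetric] using sk upos[OF z] u_le[OF z] by (rule powr_mono2')
    show "f z \<le> ((1 - \<epsilon>) * N (z + e)) powr (- s)"
      unfolding f_def powk[OF c(1), symmetric] using c(1) u_ge[OF z] by (intro powr_mono2'[OF sk]) auto
    define M where "M = u z powr (1 / k)"
    have M0: "0 < M" using upos[OF z] by (simp add: M_def)
    have uM: "u z = M ^ Suc j" using u_k[OF M0 z] M_def by simp
    have M_ge: "(1 - \<epsilon>) * N (z + e) \<le> M"
    proof (rule ccontr)
      assume "\<not> (1 - \<epsilon>) * N (z + e) \<le> M"
      then have "M ^ Suc j < ((1 - \<epsilon>) * N (z + e)) ^ Suc j" using M0 by (intro power_strict_mono) auto
      then show False using u_ge[OF z] uM by simp
    qed
    define D where "D = (- s * u z powr (- s / k - 1)) *\<^sub>R (\<Sum>l\<in>L. (l \<bullet> (z + e)) ^ j *\<^sub>R l)"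
    have "(u has_derivative (\<lambda>v. \<Sum>l\<in>L. k * (l \<bullet> (z + e)) ^ j * (l \<bullet> v))) (at z)"
      unfolding u_def k_def by (auto intro!: derivative_eq_intros sum.cong simp del: power_Suc simp: mult_ac)
    from has_derivative_powr_const[OF this upos[OF z], of "- s / k"]
    have "(f has_derivative (\<lambda>w. w \<bullet> D)) (at z)"
      unfolding f_def D_def
      by (rule has_derivative_eq_rhs)
        (use k in \<open>auto simp: fun_eq_iff inner_sum_right sum_distrib_left sum_negf inner_commute mult_ac intro!: sum.cong\<close>)
    moreover have "dual_norm N D \<le> s * (1 + \<epsilon>) * ((1 - \<epsilon>) * N (z + e)) powr (- s - 1)"
    proof (rule dual_norm_le[OF N])
      fix w
      have S: "(\<Sum>l\<in>L. \<bar>l \<bullet> (z + e)\<bar> ^ j) \<le> (1 + \<epsilon>) * M ^ j"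
      proof -
        have "(\<Sum>l\<in>L. \<bar>l \<bullet> (z + e)\<bar> ^ Suc j) = M ^ Suc j"
          using uM by (simp only: u_def power_even_abs[OF j(1)])
        then have "(\<Sum>l\<in>L. \<bar>l \<bullet> (z + e)\<bar> ^ j) \<le> (1 / \<delta> + card L * \<delta> ^ j) * M ^ j"
          by (intro sum_power_pred_le[OF L(1) _ M0 _ \<delta>(1)]) auto
        also have "\<dots> \<le> (1 + \<epsilon>) * M ^ j" using \<delta>(3) j(3) M0 by (intro mult_right_mono) auto
        finally show ?thesis .
      qed
      have "w \<bullet> D = s * u z powr (- s / k - 1) * (\<Sum>l\<in>L. (l \<bullet> (z + e)) ^ j * (- (l \<bullet> w)))"
        by (simp add: D_def inner_sum_right inner_commute sum_negf)
      \<comment> \<open>Each functional in \<open>L\<close> has dual norm at most 1, so only the sum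
        of the powers with exponent \<open>j\<close> remains to be bounded.\<close>
      also have "\<dots> \<le> s * u z powr (- s / k - 1) * (\<Sum>l\<in>L. \<bar>l \<bullet> (z + e)\<bar> ^ j * N w)"
      proof (intro mult_left_mono sum_mono)
        fix l assume "l \<in> L"
        have "(l \<bullet> (z + e)) ^ j * (- (l \<bullet> w)) \<le> \<bar>(l \<bullet> (z + e)) ^ j * (- (l \<bullet> w))\<bar>" by simp
        also have "\<dots> = \<bar>l \<bullet> (z + e)\<bar> ^ j * \<bar>l \<bullet> w\<bar>" by (simp add: abs_mult power_abs)
        also have "\<dots> \<le> \<bar>l \<bullet> (z + e)\<bar> ^ j * N w" using L(2)[OF \<open>l \<in> L\<close>] by (intro mult_left_mono) auto
        finally show "(l \<bullet> (z + e)) ^ j * (- (l \<bullet> w)) \<le> \<bar>l \<bullet> (z + e)\<bar> ^ j * N w" .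
      qed (use s in auto)
      also have "\<dots> \<le> s * u z powr (- s / k - 1) * ((1 + \<epsilon>) * M ^ j * N w)"
        using S s nN(1)[of w] by (intro mult_left_mono) (auto simp: sum_distrib_right[symmetric] mult_right_mono)
      also have "\<dots> = s * (1 + \<epsilon>) * (u z powr (- s / k - 1) * M ^ j) * N w" by (simp add: mult_ac)
      also have "u z powr (- s / k - 1) * M ^ j = M powr (- s - 1)"
      proof -
        have "u z = M powr k" using uM M0 unfolding k_def by (metis powr_realpow)
        then have "u z powr (- s / k - 1) = M powr (- s - k)" using k by (simp add: powr_powr algebra_simps)
        moreover have "M ^ j = M powr (k - 1)" using M0 by (simp add: k_def powr_realpow)
        ultimately show ?thesis by (simp add: powr_add[symmetric])
      qed
      also have "s * (1 + \<epsilon>) * M powr (- s - 1) * N w \<le> s * (1 + \<epsilon>) * ((1 - \<epsilon>) * N (z + e)) powr (- s - 1) * N w"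
        using M_ge c s \<epsilon> nN(1)[of w] by (intro mult_right_mono mult_left_mono powr_mono2') auto
      finally show "w \<bullet> D \<le> s * (1 + \<epsilon>) * ((1 - \<epsilon>) * N (z + e)) powr (- s - 1) * N w" .
    qed (use s \<epsilon> in auto)
    ultimately show "\<exists>D. (f has_derivative (\<lambda>w. w \<bullet> D)) (at z) \<and>
        dual_norm N D \<le> s * (1 + \<epsilon>) * ((1 - \<epsilon>) * N (z + e)) powr (- s - 1)" by blast
  qed
qed

section \<open>The sharp trace inequality\<close>

lemma gradient_eq:
  assumes "(f has_derivative (\<lambda>w. w \<bullet> D)) (at z)"
  shows "gradient f z = D"
  unfolding gradient_def gderiv_def
proof (rule the_equality)
  fix D' assume "(f has_derivative (\<lambda>w. w \<bullet> D')) (at z)"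
  then have "(\<lambda>w. w \<bullet> D') = (\<lambda>w. w \<bullet> D)" using assms by (rule has_derivative_unique)
  then have "(D' - D) \<bullet> (D' - D) = 0" by (simp add: fun_eq_iff inner_diff_right)
  then show "D' = D" by simp
qed (use assms in simp)

lemma C_k_on_gradient:
  fixes g :: "'a::euclidean_space \<Rightarrow> real"
  assumes g: "C_k_on (Suc 0) g U"
  shows "z \<in> U \<Longrightarrow> (g has_derivative (\<lambda>w. w \<bullet> gradient g z)) (at z)" "continuous_on U (gradient g)"
proof -
  define D where "D z = (\<Sum>b\<in>Basis. frechet_derivative g (at z) b *\<^sub>R b)" for z
  have D: "(g has_derivative (\<lambda>w. w \<bullet> D z)) (at z)" if z: "z \<in> U" for z
  proof -
    have f: "(g has_derivative frechet_derivative g (at z)) (at z)" using C_k_on_SucD(1)[OF g z] .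
    then have lin: "linear (frechet_derivative g (at z))" by (rule has_derivative_linear)
    have "frechet_derivative g (at z) w = w \<bullet> D z" for w
    proof -
      have "frechet_derivative g (at z) w = frechet_derivative g (at z) (\<Sum>b\<in>Basis. (w \<bullet> b) *\<^sub>R b)"
        by (simp add: euclidean_representation)
      also have "\<dots> = w \<bullet> D z"
        unfolding linear_sum[OF lin] linear_scale[OF lin] by (simp add: D_def inner_sum_right mult.commute)
      finally show ?thesis .
    qed
    then have "frechet_derivative g (at z) = (\<lambda>w. w \<bullet> D z)" by (simp add: fun_eq_iff)
    then show ?thesis using f by simp
  qed
  then have eq: "gradient g z = D z" if "z \<in> U" for z using that by (intro gradient_eq)
  show "(g has_derivative (\<lambda>w. w \<bullet> gradient g z)) (at z)" if "z \<in> U" using D eq that by simp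
  have "continuous_on U D" unfolding D_def using C_k_on_SucD(2)[OF g]
    by (intro continuous_intros) auto
  then show "continuous_on U (gradient g)" using eq by (simp cong: continuous_on_cong)
qed

lemma halfspace_eq: "halfspace = {z. 0 \<le> fst z}" and closed_halfspace: "closed halfspace"
  and halfspace_borel [measurable]: "halfspace \<in> sets borel"
proof -
  show *: "halfspace = {z. 0 \<le> fst z}" by (auto simp: halfspace_def)
  show c: "closed halfspace" unfolding * by (intro closed_Collect_le continuous_intros)
  show "halfspace \<in> sets borel" using c by (rule borel_closed)
qed

lemma AE_fst_neq_0: "AE z::real \<times> (real ^ 'm) in lebesgue. fst z \<noteq> 0"
proof -
  have "negligible {z::real \<times> (real ^ 'm). z \<bullet> (1, 0) = 0}"
    by (rule negligible_standard_hyperplane) (auto simp: Basis_prod_def)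
  moreover have "{z::real \<times> (real ^ 'm). z \<bullet> (1, 0) = 0} = {z. fst z = 0}"
    by (auto simp: inner_prod_def)
  ultimately have "{z::real \<times> (real ^ 'm). fst z = 0} \<in> null_sets lebesgue"
    by (simp add: negligible_iff_null_sets)
  from AE_not_in[OF this] show ?thesis by simp
qed

text \<open>Integrands with a gradient left unspecified on a null set are replaced by a continuous
  \<open>F\<close>; completion of the measure then changes neither integrability nor the
  integral.\<close>

lemma set_integral_lebesgue_eq_lborel:
  fixes F G :: "'a::euclidean_space \<Rightarrow> real"
  assumes F: "continuous_on S F" "closed S" and eq: "AE z in lebesgue. z \<in> S \<longrightarrow> G z = F z"
  shows "set_integrable lebesgue S G \<longleftrightarrow> set_integrable lborel S F"
    and "(LINT z:S|lebesgue. G z) = (LINT z:S|lborel. F z)"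
proof -
  have m: "(\<lambda>z. indicator S z *\<^sub>R F z) \<in> borel_measurable lborel"
    using borel_measurable_continuous_on_indicator[OF borel_closed[OF F(2)] F(1)] by simp
  then have m': "(\<lambda>z. indicator S z *\<^sub>R F z) \<in> borel_measurable lebesgue"
    by (rule measurable_completion)
  have eq': "AE z in lebesgue. indicator S z *\<^sub>R F z = indicator S z *\<^sub>R G z"
    using eq by (rule eventually_mono) (auto simp: indicator_def)
  have eq'': "AE z in lebesgue. indicator S z *\<^sub>R G z = indicator S z *\<^sub>R F z"
    using eq by (rule eventually_mono) (auto simp: indicator_def)
  have m'': "(\<lambda>z. indicator S z *\<^sub>R G z) \<in> borel_measurable lebesgue"
    by (rule borel_measurable_AE[OF m' eq'])
  show "set_integrable lebesgue S G \<longleftrightarrow> set_integrable lborel S F"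
    unfolding set_integrable_def integrable_cong_AE[OF m'' m' eq''] by (rule integrable_completion[OF m])
  have "(LINT z:S|lebesgue. G z) = (LINT z:S|lebesgue. F z)"
    unfolding set_lebesgue_integral_def
    by (rule integral_cong_AE[OF m'' m' eq''])
  also have "\<dots> = (LINT z:S|lborel. F z)"
    unfolding set_lebesgue_integral_def by (rule integral_completion[OF m])
  finally show "(LINT z:S|lebesgue. G z) = (LINT z:S|lborel. F z)" .
qed

lemma integral_lebesgue_eq_lborel:
  fixes F :: "'a::euclidean_space \<Rightarrow> real"
  assumes F: "continuous_on UNIV F"
  shows "integrable lebesgue F \<longleftrightarrow> integrable lborel F" and "(LINT z|lebesgue. F z) = (LINT z|lborel. F z)"
  using set_integral_lebesgue_eq_lborel[OF F closed_UNIV, of F]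
  by (auto simp: set_integrable_def set_lebesgue_integral_def)

lemma AE_lborel_translation:
  assumes "AE z in lborel. P (z :: 'a::euclidean_space)"
  shows "AE z in lborel. P (z + c)"
proof -
  have "AE z in distr lborel borel ((+) c). P z" unfolding lborel_distr_plus by (rule assms)
  then have "AE z in lborel. P (c + z)" by (rule AE_distrD[rotated]) simp
  then show ?thesis by (simp add: add.commute)
qed

section \<open>Exponents, constants and the sharp inequality\<close>

locale trace_setting =
  fixes N :: "real \<times> (real ^ 'm) \<Rightarrow> real" and n :: nat and p a :: real
  assumes n: "n = DIM(real \<times> (real ^ 'm))" and N: "is_norm N" and p: "1 < p" "p < real n" "real n \<le> a"
begin

definition "q = p / (p - 1)"
definition "r = p * ((a - 1) / (a - p))"
definition "s = (a - p) / (p - 1)"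
text \<open>The common value of \<open>s * r\<close>, \<open>(s + 1) * p\<close> and
  \<open>q * (a - 1)\<close>. Because of this coincidence the boundary, interior and gradient
  integrals of the extremal function, as well as \<open>K\<close>, are all multiples of integrals of
  \<open>N powr (- \<kappa>)\<close>.\<close>

definition "\<kappa> = p * (a - 1) / (p - 1)"
definition "\<theta> = (a - p) / (p * (a - n) + n - p)"
definition "I0 = (LINT z:{z. 1 \<le> fst z}|lborel. N z powr (- \<kappa>))"
definition "K = (LINT y:{z. 1 \<le> fst z}|lborel. (N y powr q / q) powr (1 - a))"
definition "c = (p - 1) / p * (p / (a - p)) powr p"

text \<open>In terms of \<open>W = N powr q / q\<close>, the constant \<open>K\<close> is the integral of \<open>W powr (1 - a)\<close> over the shifted
  half-space, and the extremal function has interior integral \<open>I0\<close>; \<open>sharp_const\<close> below is \<open>D\<^sub>n\<^sub>,\<^sub>p\<^sub>,\<^sub>a\<close>.\<close>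

lemma exponents: "1 < q" "1 < r" "0 < s" "real n < \<kappa>" "s * r = \<kappa>" "(s + 1) * p = \<kappa>" "q * (1 - a) = - \<kappa>"
  "0 < \<theta>" "\<theta> \<le> 1" "\<kappa> - n = (a - n) + (a - p) / (p - 1)" "1 < a" "p < a" "(a - p) / (p * (a - 1)) = 1 / r"
  "(a - 1) / (a - p) / r = 1 / p"
proof -
  show a: "1 < a" "p < a" using p by auto
  show "1 < q" "0 < s" using p by (auto simp: q_def s_def)
  have "1 * (a - 1) < p * (a - 1)" using a p by (intro mult_strict_right_mono) auto
  then have "a - p < p * (a - 1)" using p by (simp add: algebra_simps)
  then show "1 < r" using a by (simp add: r_def field_simps)
  show kn: "\<kappa> - n = (a - n) + (a - p) / (p - 1)" using p by (simp add: \<kappa>_def field_simps)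
  have "0 < (a - p) / (p - 1)" using p by simp
  then show "real n < \<kappa>" using kn p by linarith
  show "s * r = \<kappa>" using p a by (simp add: s_def r_def \<kappa>_def)
  have "s + 1 = (a - 1) / (p - 1)" using p by (simp add: s_def field_simps)
  then show "(s + 1) * p = \<kappa>" by (simp add: \<kappa>_def)
  show "q * (1 - a) = - \<kappa>" using p by (simp add: q_def \<kappa>_def minus_divide_left algebra_simps)
  have den: "0 < p * (a - n) + n - p" using p by (simp add: add_nonneg_pos add_diff_eq[symmetric])
  show "0 < \<theta>" unfolding \<theta>_def using den p by simp
  have "1 * (a - n) \<le> p * (a - n)" using p by (intro mult_right_mono) auto
  then have "a - p \<le> p * (a - n) + n - p" by simp
  then show "\<theta> \<le> 1" unfolding \<theta>_def using den by simp
  show "(a - p) / (p * (a - 1)) = 1 / r" "(a - 1) / (a - p) / r = 1 / p" using p a by (auto simp: r_def)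
qed

lemma theta_equation_iff: "theta_equation n p a t \<longleftrightarrow> t = \<theta>"
proof -
  have den: "0 < p * (a - n) + n - p" using p by (simp add: add_nonneg_pos add_diff_eq[symmetric])
  have nz: "real n \<noteq> 0" "a - 1 \<noteq> 0" using p by auto
  have "theta_equation n p a t \<longleftrightarrow> (real n - 1) * (a - p) = t * (real n - p) * (a - 1) + (1 - t) * ((a - p) * n)"
  proof -
    have "(real n - 1) / real n * ((a - p) / (a - 1)) = (real n - 1) * (a - p) / (real n * (a - 1))" by simp
    moreover have "t * ((real n - p) / real n) + (1 - t) * ((a - p) / (a - 1)) =
        (t * (real n - p) * (a - 1) + (1 - t) * ((a - p) * n)) / (real n * (a - 1))"
      using nz by (simp add: add_divide_distrib)
    ultimately show ?thesis unfolding theta_equation_def using nz by (simp only: divide_cancel_right) simp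
  qed
  also have "\<dots> \<longleftrightarrow> t * (p * (a - n) + n - p) = a - p" by (auto simp: algebra_simps)
  also have "\<dots> \<longleftrightarrow> t = \<theta>" unfolding \<theta>_def using den by (auto simp: field_simps)
  finally show ?thesis .
qed

lemma shifted_norm_integrals: "integrable lborel (\<lambda>x. N (1, x) powr (- \<kappa>))" "set_integrable lborel {z. 1 \<le> fst z} (\<lambda>z. N z powr (- \<kappa>))"
  "(LINT x|lborel. N (1, x) powr (- \<kappa>)) = (\<kappa> - n) * I0" "0 < I0"
  "set_integrable lborel halfspace (\<lambda>z. N (z + (1, 0)) powr (- \<kappa>))"
  "(LINT z:halfspace|lborel. N (z + (1, 0)) powr (- \<kappa>)) = I0"
proof -
  note * = norm_powr_halfspace[OF N, of \<kappa>] exponents(4)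
  show "integrable lborel (\<lambda>x. N (1, x) powr (- \<kappa>))" and 1: "set_integrable lborel {z. 1 \<le> fst z} (\<lambda>z. N z powr (- \<kappa>))"
    "(LINT x|lborel. N (1, x) powr (- \<kappa>)) = (\<kappa> - n) * I0" "0 < I0"
    using * unfolding n I0_def by auto
  have b: "{z. 1 \<le> fst z} \<in> sets (borel :: (real \<times> (real ^ 'm)) measure)"
    by (intro borel_closed closed_Collect_le continuous_intros)
  have h: "halfspace = {z :: real \<times> (real ^ 'm). z + (1, 0) \<in> {z. 1 \<le> fst z}}" by (auto simp: halfspace_eq)
  show "set_integrable lborel halfspace (\<lambda>z. N (z + (1, 0)) powr (- \<kappa>))"
    "(LINT z:halfspace|lborel. N (z + (1, 0)) powr (- \<kappa>)) = I0"
    unfolding h I0_def using lborel_translation[OF 1(1) b, of "(1, 0)"] by simp_all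
qed

lemma weight_integral: "set_integrable lborel {z. 1 \<le> fst z} (\<lambda>y. (N y powr q / q) powr (1 - a))" "K = q powr (a - 1) * I0" "0 < K"
proof -
  have "(N y powr q / q) powr (1 - a) = q powr (a - 1) * N y powr (- \<kappa>)" for y
  proof -
    have "(N y powr q / q) powr (1 - a) = (N y powr q) powr (1 - a) * (1 / q) powr (1 - a)"
      by (simp add: powr_mult[symmetric])
    moreover have "(1 / q) powr (1 - a) = q powr (a - 1)" using exponents(1) by (simp add: powr_def ln_div algebra_simps)
    ultimately show ?thesis using exponents(7) by (simp add: powr_powr)
  qed
  then show "set_integrable lborel {z. 1 \<le> fst z} (\<lambda>y. (N y powr q / q) powr (1 - a))" and 1: "K = q powr (a - 1) * I0"
    using shifted_norm_integrals(2) by (simp_all add: K_def I0_def)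
  show "0 < K" unfolding 1 using shifted_norm_integrals(4) exponents(1) by simp
qed

definition "sharp_const = (K * (\<kappa> - n)) powr (1 / r) * (1 / K) powr ((1 - \<theta>) / r) * (c / K) powr (\<theta> / p)"

lemma c_pos: "0 < c" using p by (simp add: c_def)

lemma sharp_const_pos: "0 < sharp_const"
  unfolding sharp_const_def using weight_integral(3) exponents(4) c_pos by simp

text \<open>The bound of \<open>halfspace_inequality\<close> raised to the power
  \<open>1 / r\<close>, regrouped into a constant and the powers of \<open>\<Gamma>\<close> and
  \<open>I\<close>.\<close>

lemma sharp_const_eq:
  "(K * (\<kappa> - n) * ((I / K) powr (1 - \<theta>) * (c * \<Gamma> / K) powr (\<theta> * ((a - 1) / (a - p))))) powr (1 / r) =
    sharp_const * \<Gamma> powr (\<theta> / p) * I powr ((1 - \<theta>) / r)"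
proof -
  have "\<theta> * ((a - 1) / (a - p)) * (1 / r) = \<theta> * ((a - 1) / (a - p) / r)" by simp
  then have e: "\<theta> * ((a - 1) / (a - p)) * (1 / r) = \<theta> / p" unfolding exponents(14) by simp
  have "I / K = I * (1 / K)" "c * \<Gamma> / K = \<Gamma> * (c / K)" by simp_all
  then show ?thesis unfolding sharp_const_def
    by (simp only: powr_mult powr_powr e) (simp add: mult_ac)
qed

text \<open>Equality for the extremal function: \<open>s powr p * I0\<close> and \<open>I0\<close>
  are its gradient and interior integrals. The powers of \<open>q\<close> combine to the exponent
  \<open>1 - a\<close>, which cancels \<open>q powr (a - 1)\<close> in \<open>K\<close> and leaves
  the boundary integral.\<close>

lemma sharp_const_extremal: "((\<kappa> - n) * I0) powr (1 / r) = sharp_const * (s powr p * I0) powr (\<theta> / p) * I0 powr ((1 - \<theta>) / r)"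
proof -
  have q: "0 < q" using exponents by simp
  have i: "I0 / K = q powr (1 - a)"
    using shifted_norm_integrals(4) q unfolding weight_integral(2) by (simp add: powr_minus_divide[symmetric])
  have g: "c * (s powr p * I0) / K = q powr (p - a)"
  proof -
    have "c * s powr p = 1 / q * ((p / (a - p)) powr p * s powr p)" by (simp add: c_def q_def)
    also have "(p / (a - p)) powr p * s powr p = q powr p"
      unfolding powr_mult[symmetric] using exponents(12) by (simp add: s_def q_def)
    also have "1 / q * q powr p = q powr (p - 1)" using q by (simp add: powr_diff)
    finally have "c * s powr p = q powr (p - 1)" .
    moreover have "c * (s powr p * I0) / K = c * s powr p * (I0 / K)" by simp
    ultimately have "c * (s powr p * I0) / K = q powr (p - 1) * q powr (1 - a)" unfolding i by simp
    then show ?thesis using q by (simp add: powr_add[symmetric])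
  qed
  have ex: "(1 - a) * (1 - \<theta>) + (p - a) * (\<theta> * ((a - 1) / (a - p))) = 1 - a"
  proof -
    have "(p - a) * ((a - 1) / (a - p)) = 1 - a" using exponents(12) by (simp add: field_simps)
    then have "(p - a) * (\<theta> * ((a - 1) / (a - p))) = (1 - a) * \<theta>" by (metis mult.assoc mult.commute)
    then show ?thesis by (simp add: algebra_simps)
  qed
  have "K * (\<kappa> - n) * ((I0 / K) powr (1 - \<theta>) * (c * (s powr p * I0) / K) powr (\<theta> * ((a - 1) / (a - p)))) =
     K * (\<kappa> - n) * q powr ((1 - a) * (1 - \<theta>) + (p - a) * (\<theta> * ((a - 1) / (a - p))))"
    unfolding i g by (simp add: powr_powr powr_add)
  also have "\<dots> = (\<kappa> - n) * I0"
    unfolding ex weight_integral(2) using q by (simp add: powr_diff)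
  finally have X: "K * (\<kappa> - n) * ((I0 / K) powr (1 - \<theta>) * (c * (s powr p * I0) / K) powr (\<theta> * ((a - 1) / (a - p)))) =
    (\<kappa> - n) * I0" .
  show ?thesis using sharp_const_eq[of I0 "s powr p * I0"] unfolding X .
qed

lemma trace_GN: "trace_GN_inequality N p a \<theta> sharp_const"
  unfolding trace_GN_inequality_def
proof (intro allI impI)
  fix f :: "real \<times> (real ^ 'm) \<Rightarrow> real"
  assume sm: "smooth_on halfspace f" and f0: "\<forall>z\<in>halfspace. 0 \<le> f z" and wd: "well_defined N p a f"
  obtain U g where U: "open U" "halfspace \<subseteq> U" "\<And>k. C_k_on k g U" "\<And>z. z \<in> halfspace \<Longrightarrow> f z = g z"
    using sm unfolding smooth_on_def by blast
  note G = C_k_on_gradient[OF U(3)]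
  have r: "0 < r" using exponents by simp
  have cg: "continuous_on halfspace g" using U(3)[of 0] U(2) by (auto intro: continuous_on_subset)
  have cD: "continuous_on halfspace (gradient g)" using G(2) U(2) by (rule continuous_on_subset)
  have g0: "0 \<le> g z" if "z \<in> halfspace" for z using f0[rule_format, OF that] U(4)[OF that] by simp
  \<comment> \<open>On the boundary \<open>gradient f\<close> may depend on values of
    \<open>f\<close> off the half-space, hence agreement with the gradient of the smooth extension
    holds almost everywhere only.\<close>
  have grad: "AE z in lebesgue. z \<in> halfspace \<longrightarrow> dual_norm N (gradient f z) powr p = dual_norm N (gradient g z) powr p"
    using AE_fst_neq_0
  proof (rule eventually_mono, intro impI)
    fix z :: "real \<times> (real ^ 'm)" assume "fst z \<noteq> 0" "z \<in> halfspace"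
    then have z: "z \<in> {z. 0 < fst z}" "z \<in> U" using U(2) by (auto simp: halfspace_eq)
    have o: "open {z :: real \<times> (real ^ 'm). 0 < fst z}" by (intro open_Collect_less continuous_intros)
    have "(f has_derivative (\<lambda>w. w \<bullet> gradient g z)) (at z)"
      by (rule has_derivative_transform_within_open[OF G(1)[OF z(2)] o z(1)]) (auto simp: U(4) halfspace_eq)
    then show "dual_norm N (gradient f z) powr p = dual_norm N (gradient g z) powr p"
      by (simp add: gradient_eq)
  qed
  have cgr: "continuous_on halfspace (\<lambda>z. g z powr r)"
    using r g0 by (intro continuous_on_powr' cg continuous_on_const) auto
  have cb: "continuous_on UNIV (\<lambda>x. g (0, x) powr r)"
    by (rule continuous_on_compose2[OF cgr]) (auto intro!: continuous_intros simp: halfspace_eq)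
  have fb: "(\<lambda>x. f (0, x) powr r) = (\<lambda>x. g (0, x) powr r)" by (auto simp: U(4) halfspace_eq fun_eq_iff)
  define B I \<Gamma> where "B = (LINT x|lborel. g (0, x) powr r)" and "I = (LINT z:halfspace|lborel. g z powr r)"
    and "\<Gamma> = (LINT z:halfspace|lborel. dual_norm N (gradient g z) powr p)"
  have cN: "continuous_on halfspace (\<lambda>z. dual_norm N (gradient g z) powr p)"
    using p by (intro continuous_on_dual_norm_powr N cD) auto
  have int: "set_integrable lborel halfspace (\<lambda>z. dual_norm N (gradient g z) powr p)"
    "set_integrable lborel halfspace (\<lambda>z. g z powr r)" "integrable lborel (\<lambda>x. g (0, x) powr r)"
    using wd set_integral_lebesgue_eq_lborel(1)[OF cN closed_halfspace grad]
       set_integral_lebesgue_eq_lborel(1)[OF cgr closed_halfspace, of "\<lambda>z. f z powr r"]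
       integral_lebesgue_eq_lborel(1)[OF cb] fb U(4)
    unfolding well_defined_def r_def by auto
  have terms: "trace_term p a f = B powr (1 / r)" "gradient_term N p \<theta> f = \<Gamma> powr (\<theta> / p)"
    "interior_term p a \<theta> f = I powr ((1 - \<theta>) / r)"
  proof -
    show "trace_term p a f = B powr (1 / r)"
      unfolding trace_term_def r_def[symmetric] fb B_def integral_lebesgue_eq_lborel(2)[OF cb] exponents(13) ..
    show "gradient_term N p \<theta> f = \<Gamma> powr (\<theta> / p)"
      unfolding gradient_term_def \<Gamma>_def set_integral_lebesgue_eq_lborel(2)[OF cN closed_halfspace grad] ..
    have "(LINT z:halfspace|lebesgue. f z powr r) = I"
      unfolding I_def by (rule set_integral_lebesgue_eq_lborel(2)[OF cgr closed_halfspace]) (auto simp: U(4))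
    then show "interior_term p a \<theta> f = I powr ((1 - \<theta>) / r)"
      unfolding interior_term_def r_def[symmetric] exponents(13) by simp
  qed
  have I0': "0 \<le> I" unfolding I_def set_lebesgue_integral_def by (rule Bochner_Integration.integral_nonneg) auto
  show "trace_term p a f \<le> sharp_const * gradient_term N p \<theta> f * interior_term p a \<theta> f"
  proof (cases "\<exists>z\<in>halfspace. g z \<noteq> 0")
    case False
    then have "B = 0" unfolding B_def by (auto simp: halfspace_eq)
    then show ?thesis unfolding terms using sharp_const_pos by simp
  next
    case True
    then obtain z0 where z0: "z0 \<in> halfspace" "g z0 \<noteq> 0" by blast
    \<comment> \<open>Positivity of \<open>I\<close> is what the optimisation demands. If
      \<open>I\<close> were 0, the open set of interior points with \<open>g > 0\<close> would be
      null and hence empty, contradicting continuity at \<open>z0\<close>.\<close>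
    have "I \<noteq> 0"
    proof
      assume "I = 0"
      then have "AE z in lborel. indicator halfspace z *\<^sub>R g z powr r = 0"
        unfolding I_def set_lebesgue_integral_def using int(2)
        by (subst (asm) integral_nonneg_eq_0_iff_AE) (auto simp: set_integrable_def)
      then have ae: "AE z in lborel. z \<in> halfspace \<longrightarrow> g z = 0"
        using r by (auto elim!: eventually_mono simp: indicator_def split: if_splits)
      define W where "W = {z. 0 < fst z} \<inter> g -` {0<..}"
      have "continuous_on {z. 0 < fst z} g" using cg by (rule continuous_on_subset) (auto simp: halfspace_eq)
      then have oW: "open W" unfolding W_def
        by (subst (asm) continuous_on_open_vimage) (auto intro!: open_Collect_less continuous_intros simp: Int_commute)
      have "AE z in lebesgue. z \<notin> W"
        using AE_completion[OF ae] by (rule eventually_mono) (auto simp: W_def halfspace_eq)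
      then have "negligible W" unfolding negligible_iff_null_sets
        using oW by (subst AE_iff_null_sets) auto
      then have W0: "W = {}" using open_not_negligible[OF oW] by blast
      have "(g \<longlongrightarrow> g z0) (at z0 within halfspace)" using cg z0(1) by (simp add: continuous_on_def)
      moreover have "0 < g z0" using z0 g0[OF z0(1)] by simp
      ultimately have "\<forall>\<^sub>F z in at z0 within halfspace. 0 < g z" by (rule order_tendstoD)
      then obtain d where d: "0 < d" "\<And>z. z \<in> halfspace \<Longrightarrow> z \<noteq> z0 \<Longrightarrow> dist z z0 < d \<Longrightarrow> 0 < g z"
        by (auto simp: eventually_at)
      \<comment> \<open>\<open>z0\<close> may lie on the boundary, so it is pushed inwards.\<close>
      have "z0 + (d / 2, 0) \<in> W" unfolding W_def using z0(1) d(1)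
        by (auto intro!: d(2) simp: halfspace_eq dist_norm prod_eq_iff)
      then show False using W0 by blast
    qed
    then have Ipos: "0 < I" using I0' by simp
    have "B \<le> K * (\<kappa> - n) * ((I / K) powr (1 - \<theta>) * (c * \<Gamma> / K) powr (\<theta> * ((a - 1) / (a - p))))"
      unfolding exponents(10) B_def K_def I_def \<theta>_def c_def \<Gamma>_def q_def r_def halfspace_eq
    proof (rule halfspace_inequality[where 'b = "real ^ 'm", folded n, OF N p])
      show "\<exists>z. 0 \<le> fst z \<and> g z \<noteq> 0"
        by (intro exI[of _ z0]) (use z0 in \<open>simp add: halfspace_eq\<close>)
    qed (use g0 G(1) U(2) cD int weight_integral[unfolded K_def q_def] z0 Ipos[unfolded I_def] in
          \<open>auto simp: halfspace_eq r_def q_def\<close>)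
    then have "B powr (1 / r) \<le> (K * (\<kappa> - n) * ((I / K) powr (1 - \<theta>) * (c * \<Gamma> / K) powr (\<theta> * ((a - 1) / (a - p))))) powr (1 / r)"
      using r by (intro powr_mono2) (auto simp: B_def)
    then show ?thesis unfolding terms sharp_const_eq .
  qed
qed

section \<open>The extremal function and optimality of the constant\<close>

lemma extremal_powr: "extremal N p a z powr r = N (z + (1, 0)) powr (- \<kappa>)"
  unfolding extremal_def s_def[symmetric] using exponents(5) by (simp add: powr_powr)

lemma N_shift_pos: "z \<in> {z. -1 < fst z} \<Longrightarrow> 0 < N (z + (1, 0))"
  by (rule is_normD(7)[OF N]) (auto simp: prod_eq_iff)

lemma continuous_on_N_shift: "continuous_on {z. -1 < fst z} (\<lambda>z. N (z + (1, 0)) powr t)"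
  using N_shift_pos
  by (intro continuous_on_powr' continuous_on_const continuous_on_compose2[OF continuous_on_is_norm[OF N, of UNIV]]
      continuous_intros) (force simp: less_le)+

lemma halfspace_subset: "halfspace \<subseteq> {z :: real \<times> (real ^ 'm). -1 < fst z}"
  by (auto simp: halfspace_eq)

text \<open>Where \<open>N\<close> is differentiable at the shifted point, its derivative
  \<open>d\<close> is a supporting functional and has dual norm 1. The gradient of the extremal
  function is \<open>- s * N powr (- s - 1)\<close> times \<open>d\<close>, and
  \<open>(s + 1) * p = \<kappa>\<close> gives the power.\<close>

lemma extremal_gradient:
  "AE z in lebesgue. z \<in> halfspace \<longrightarrow> extremal N p a differentiable (at z) \<and>
     dual_norm N (gradient (extremal N p a) z) powr p = s powr p * N (z + (1, 0)) powr (- \<kappa>)"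
  using AE_completion[OF AE_lborel_translation[OF AE_is_norm_differentiable[OF N], of "(1, 0)"]]
proof (rule eventually_mono, intro impI)
  fix z :: "real \<times> (real ^ 'm)"
  let ?y = "z + (1, 0)"
  assume "\<exists>d. (N has_derivative (\<lambda>w. w \<bullet> d)) (at ?y) \<and> (\<forall>w. w \<bullet> d \<le> N w) \<and> ?y \<bullet> d = N ?y"
    and z: "z \<in> halfspace"
  then obtain d where d: "(N has_derivative (\<lambda>w. w \<bullet> d)) (at ?y)" "\<And>w. w \<bullet> d \<le> N w" "?y \<bullet> d = N ?y" by blast
  have pos: "0 < N ?y" using N_shift_pos z halfspace_subset by blast
  have "((\<lambda>z. N (z + (1, 0))) has_derivative (\<lambda>w. w \<bullet> d)) (at z)"
    by (rule has_derivative_compose[of "\<lambda>z. z + (1, 0)" "\<lambda>w. w", OF _ d(1)]) (auto intro!: derivative_eq_intros)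
  from has_derivative_powr_const[OF this pos, of "- s"]
  have D: "(extremal N p a has_derivative (\<lambda>w. w \<bullet> (- s * N ?y powr (- s - 1)) *\<^sub>R d)) (at z)"
    unfolding extremal_def[abs_def] s_def[symmetric] by simp
  have "gradient (extremal N p a) z = (- s * N ?y powr (- s - 1)) *\<^sub>R d" by (rule gradient_eq[OF D])
  moreover have "dual_norm N ((- s * N ?y powr (- s - 1)) *\<^sub>R d) = s * N ?y powr (- s - 1)"
  proof (rule antisym)
    have 1: "dual_norm N d = 1"
      by (rule dual_norm_support[OF N d(2,3)]) (use pos is_normD(6)[OF N] in auto)
    show "dual_norm N ((- s * N ?y powr (- s - 1)) *\<^sub>R d) \<le> s * N ?y powr (- s - 1)"
      using dual_norm_scaleR_le[OF N, of "- s * N ?y powr (- s - 1)" d] 1 exponents(3) by (simp add: abs_mult)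
    \<comment> \<open>The lower bound is tested at \<open>- ?y\<close>, where the functional, with
      its negative factor, attains its norm.\<close>
    have "(- ?y) \<bullet> ((- s * N ?y powr (- s - 1)) *\<^sub>R d) \<le> N (- ?y) * dual_norm N ((- s * N ?y powr (- s - 1)) *\<^sub>R d)"
      by (rule inner_le_dual_norm[OF N])
    moreover have "(- ?y) \<bullet> ((- s * N ?y powr (- s - 1)) *\<^sub>R d) = N ?y * (s * N ?y powr (- s - 1))"
      unfolding inner_scaleR_right inner_minus_left d(3) by simp
    ultimately show "s * N ?y powr (- s - 1) \<le> dual_norm N ((- s * N ?y powr (- s - 1)) *\<^sub>R d)"
      unfolding is_normD(5)[OF N] using pos by (simp only: mult_le_cancel_left_pos)
  qed
  moreover have "(s * N ?y powr (- s - 1)) powr p = s powr p * N ?y powr (- \<kappa>)"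
  proof -
    have "(- s - 1) * p = - \<kappa>" using exponents(6) by (simp add: algebra_simps)
    then show ?thesis by (simp only: powr_mult powr_powr)
  qed
  ultimately show "extremal N p a differentiable (at z) \<and>
     dual_norm N (gradient (extremal N p a) z) powr p = s powr p * N ?y powr (- \<kappa>)"
    using D by (auto simp: differentiable_def)
qed

lemma cont_shift_powr:
  "continuous_on halfspace (\<lambda>z. N (z + (1, 0)) powr t)" "continuous_on UNIV (\<lambda>x. N (1, x) powr t)"
proof -
  show *: "continuous_on halfspace (\<lambda>z. N (z + (1, 0)) powr t)"
    using continuous_on_N_shift halfspace_subset by (rule continuous_on_subset)
  have "continuous_on UNIV (\<lambda>x. N ((0, x) + (1, 0)) powr t)"
    by (rule continuous_on_compose2[OF *]) (auto intro!: continuous_intros simp: halfspace_eq)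
  then show "continuous_on UNIV (\<lambda>x. N (1, x) powr t)" by simp
qed

lemma extremal_terms:
  "well_defined N p a (extremal N p a)"
  "trace_term p a (extremal N p a) = ((\<kappa> - n) * I0) powr (1 / r)"
  "gradient_term N p t (extremal N p a) = (s powr p * I0) powr (t / p)"
  "interior_term p a t (extremal N p a) = I0 powr ((1 - t) / r)"
proof -
  have g: "AE z in lebesgue. z \<in> halfspace \<longrightarrow>
     dual_norm N (gradient (extremal N p a) z) powr p = s powr p * N (z + (1, 0)) powr (- \<kappa>)"
    using extremal_gradient by (rule eventually_mono) blast
  have cg: "continuous_on halfspace (\<lambda>z. s powr p * N (z + (1, 0)) powr (- \<kappa>))"
    by (intro continuous_on_mult continuous_on_const cont_shift_powr)
  note G = set_integral_lebesgue_eq_lborel[OF cg closed_halfspace g]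
  note H = set_integral_lebesgue_eq_lborel[OF cont_shift_powr(1)[of "- \<kappa>"] closed_halfspace, of "\<lambda>z. N (z + (1, 0)) powr (- \<kappa>)", simplified]
  note L = integral_lebesgue_eq_lborel[OF cont_shift_powr(2)[of "- \<kappa>"]]
  have b: "extremal N p a (0, x) powr r = N (1, x) powr (- \<kappa>)" for x by (simp add: extremal_powr)
  show "well_defined N p a (extremal N p a)"
    unfolding well_defined_def r_def[symmetric] b extremal_powr
    using G(1) H(1) L(1) shifted_norm_integrals(1,5) extremal_gradient by (auto elim: eventually_mono)
  show "trace_term p a (extremal N p a) = ((\<kappa> - n) * I0) powr (1 / r)"
    unfolding trace_term_def r_def[symmetric] b exponents(13) L(2) shifted_norm_integrals(3) ..
  show "gradient_term N p t (extremal N p a) = (s powr p * I0) powr (t / p)"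
    unfolding gradient_term_def G(2) using shifted_norm_integrals(6) by simp
  show "interior_term p a t (extremal N p a) = I0 powr ((1 - t) / r)"
    unfolding interior_term_def r_def[symmetric] extremal_powr H(2) shifted_norm_integrals(6) exponents(13) by simp
qed

text \<open>The inequality with constant \<open>D'\<close> is tested on the smooth approximation of
  the extremal function. The boundary integral is estimated from below and the other two from above,
  and all factors containing \<open>\<epsilon>\<close> tend to 1. Positivity of the boundary term
  yields \<open>0 \<le> D'\<close>, which is what allows upper bounds to be inserted on the
  right-hand side.\<close>

lemma trace_GN_approx:
  assumes D': "trace_GN_inequality N p a \<theta> D'" and \<epsilon>: "0 < \<epsilon>" "\<epsilon> < 1"
  shows "0 \<le> D'" "((1 + \<epsilon>) powr (- \<kappa>) * ((\<kappa> - n) * I0)) powr (1 / r) \<le>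
    D' * ((1 + \<epsilon>) powr p * (1 - \<epsilon>) powr (- \<kappa>) * (s powr p * I0)) powr (\<theta> / p) *
     ((1 - \<epsilon>) powr (- \<kappa>) * I0) powr ((1 - \<theta>) / r)"
proof -
  let ?U = "{z :: real \<times> (real ^ 'm). -1 < fst z}"
  have U: "open ?U" by (intro open_Collect_less continuous_intros)
  have ne: "z + (1, 0) \<noteq> 0" if "z \<in> ?U" for z using that by (auto simp: prod_eq_iff)
  obtain f where f: "\<And>k. C_k_on k f ?U"
    "\<And>z. z \<in> ?U \<Longrightarrow> ((1 + \<epsilon>) * N (z + (1, 0))) powr (- s) \<le> f z"
    "\<And>z. z \<in> ?U \<Longrightarrow> f z \<le> ((1 - \<epsilon>) * N (z + (1, 0))) powr (- s)"
    "\<And>z. z \<in> ?U \<Longrightarrow> \<exists>D. (f has_derivative (\<lambda>w. w \<bullet> D)) (at z) \<and>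
        dual_norm N D \<le> s * (1 + \<epsilon>) * ((1 - \<epsilon>) * N (z + (1, 0))) powr (- s - 1)"
    using smooth_norm_power_approx[OF N \<epsilon> exponents(3) U ne] by blast
  have r: "0 < r" using exponents by simp
  have sr: "- s * r = - \<kappa>" "(- s - 1) * p = - \<kappa>" using exponents(5,6) by (auto simp: algebra_simps)
  have f0: "0 \<le> f z" if "z \<in> halfspace" for z
    using f(2)[of z] that halfspace_subset by (meson order_trans powr_ge_zero subsetD)
  have lower: "(1 + \<epsilon>) powr (- \<kappa>) * N (z + (1, 0)) powr (- \<kappa>) \<le> f z powr r" if "z \<in> halfspace" for z
  proof -
    have "(((1 + \<epsilon>) * N (z + (1, 0))) powr (- s)) powr r \<le> f z powr r"
      using f(2)[OF subsetD[OF halfspace_subset that]] r by (intro powr_mono2) auto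
    then show ?thesis by (simp only: powr_powr sr powr_mult)
  qed
  have upper: "f z powr r \<le> (1 - \<epsilon>) powr (- \<kappa>) * N (z + (1, 0)) powr (- \<kappa>)" if "z \<in> halfspace" for z
  proof -
    have "f z powr r \<le> (((1 - \<epsilon>) * N (z + (1, 0))) powr (- s)) powr r"
      using f(3)[OF subsetD[OF halfspace_subset that]] f0[OF that] r by (intro powr_mono2) auto
    then show ?thesis by (simp only: powr_powr sr powr_mult)
  qed
  have grad: "dual_norm N (gradient f z) powr p \<le> (1 + \<epsilon>) powr p * (1 - \<epsilon>) powr (- \<kappa>) * (s powr p * N (z + (1, 0)) powr (- \<kappa>))"
    if z: "z \<in> halfspace" for z
  proof -
    obtain D where D: "(f has_derivative (\<lambda>w. w \<bullet> D)) (at z)"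
      "dual_norm N D \<le> s * (1 + \<epsilon>) * ((1 - \<epsilon>) * N (z + (1, 0))) powr (- s - 1)"
      using f(4) z halfspace_subset by blast
    have "dual_norm N (gradient f z) powr p \<le> (s * (1 + \<epsilon>) * ((1 - \<epsilon>) * N (z + (1, 0))) powr (- s - 1)) powr p"
      using D(2) p unfolding gradient_eq[OF D(1)] by (intro powr_mono2 dual_norm_nonneg[OF N]) auto
    also have "\<dots> = (1 + \<epsilon>) powr p * (1 - \<epsilon>) powr (- \<kappa>) * (s powr p * N (z + (1, 0)) powr (- \<kappa>))"
      by (simp only: powr_mult powr_powr sr) (simp only: mult_ac)
    finally show ?thesis .
  qed
  note G = C_k_on_gradient[OF f(1)]
  have cf: "continuous_on halfspace f" using f(1)[of 0] halfspace_subset by (auto intro: continuous_on_subset)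
  have cfr: "continuous_on halfspace (\<lambda>z. f z powr r)"
    using r f0 by (intro continuous_on_powr' cf continuous_on_const) auto
  have cb: "continuous_on UNIV (\<lambda>x. f (0, x) powr r)"
    by (rule continuous_on_compose2[OF cfr]) (auto intro!: continuous_intros simp: halfspace_eq)
  have cN: "continuous_on halfspace (\<lambda>z. dual_norm N (gradient f z) powr p)"
    using p by (intro continuous_on_dual_norm_powr N continuous_on_subset[OF G(2) halfspace_subset]) auto
  have meas: "set_borel_measurable lborel halfspace F" if "continuous_on halfspace F" for F :: "real \<times> (real ^ 'm) \<Rightarrow> real"
    using borel_measurable_continuous_on_indicator[OF halfspace_borel that] by (simp add: set_borel_measurable_def)
  have int1: "set_integrable lborel halfspace (\<lambda>z. C * N (z + (1, 0)) powr (- \<kappa>))" for C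
    using shifted_norm_integrals(5) by (rule set_integrable_mult_right)
  have int2: "set_integrable lborel halfspace (\<lambda>z. f z powr r)"
    by (rule set_integrable_bound[OF int1[of "(1 - \<epsilon>) powr (- \<kappa>)"] meas[OF cfr]]) (use upper in auto)
  have int3: "set_integrable lborel halfspace (\<lambda>z. dual_norm N (gradient f z) powr p)"
    by (rule set_integrable_bound[OF int1[of "(1 + \<epsilon>) powr p * (1 - \<epsilon>) powr (- \<kappa>) * s powr p"] meas[OF cN]])
      (use grad in \<open>auto simp: mult_ac abs_mult\<close>)
  have int4: "integrable lborel (\<lambda>x. f (0, x) powr r)"
  proof (rule Bochner_Integration.integrable_bound)
    show "integrable lborel (\<lambda>x. (1 - \<epsilon>) powr (- \<kappa>) * N (1, x) powr (- \<kappa>))" using shifted_norm_integrals(1) by simp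
    show "(\<lambda>x. f (0, x) powr r) \<in> borel_measurable lborel" using cb by (simp add: borel_measurable_continuous_onI)
    show "AE x in lborel. norm (f (0, x) powr r) \<le> norm ((1 - \<epsilon>) powr (- \<kappa>) * N (1, x) powr (- \<kappa>))"
      using upper[of "(0, x)" for x] by (auto simp: halfspace_eq)
  qed
  note eqs = integral_lebesgue_eq_lborel[OF cb] set_integral_lebesgue_eq_lborel[OF cfr closed_halfspace, of "\<lambda>z. f z powr r", simplified]
    set_integral_lebesgue_eq_lborel[OF cN closed_halfspace, of "\<lambda>z. dual_norm N (gradient f z) powr p", simplified]
  have "f differentiable (at z)" if "z \<in> halfspace" for z
    using G(1)[OF subsetD[OF halfspace_subset that]] by (auto simp: differentiable_def)
  then have wd: "well_defined N p a f"
    unfolding well_defined_def r_def[symmetric] eqs(1,3,5) using int2 int3 int4 by simp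
  have sm: "smooth_on halfspace f" unfolding smooth_on_def using U halfspace_subset f(1) by blast
  have ineq: "trace_term p a f \<le> D' * gradient_term N p \<theta> f * interior_term p a \<theta> f"
    using D' sm wd f0 unfolding trace_GN_inequality_def by blast
  have B: "((1 + \<epsilon>) powr (- \<kappa>) * ((\<kappa> - n) * I0)) powr (1 / r) \<le> trace_term p a f"
  proof -
    have "(1 + \<epsilon>) powr (- \<kappa>) * ((\<kappa> - n) * I0) = (LINT x|lborel. (1 + \<epsilon>) powr (- \<kappa>) * N (1, x) powr (- \<kappa>))"
      using shifted_norm_integrals(3) by simp
    also have "\<dots> \<le> (LINT x|lborel. f (0, x) powr r)"
      using shifted_norm_integrals(1) lower[of "(0, x)" for x] by (intro integral_mono int4) (auto simp: halfspace_eq)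
    finally show ?thesis
      unfolding trace_term_def r_def[symmetric] eqs(2) exponents(13) using r shifted_norm_integrals(4) exponents(4)
      by (intro powr_mono2) auto
  qed
  have \<Gamma>: "gradient_term N p \<theta> f \<le> ((1 + \<epsilon>) powr p * (1 - \<epsilon>) powr (- \<kappa>) * (s powr p * I0)) powr (\<theta> / p)"
  proof -
    have "(LINT z:halfspace|lborel. dual_norm N (gradient f z) powr p) \<le>
        (LINT z:halfspace|lborel. ((1 + \<epsilon>) powr p * (1 - \<epsilon>) powr (- \<kappa>) * s powr p) * N (z + (1, 0)) powr (- \<kappa>))"
      using grad by (intro set_integral_mono int3 int1) (auto simp: mult_ac)
    also have "\<dots> = (1 + \<epsilon>) powr p * (1 - \<epsilon>) powr (- \<kappa>) * (s powr p * I0)" using shifted_norm_integrals(6) by simp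
    finally show ?thesis unfolding gradient_term_def eqs(6) using p exponents(8)
      by (intro powr_mono2) (auto simp: set_lebesgue_integral_def intro!: Bochner_Integration.integral_nonneg)
  qed
  have I: "interior_term p a \<theta> f \<le> ((1 - \<epsilon>) powr (- \<kappa>) * I0) powr ((1 - \<theta>) / r)"
  proof -
    have "(LINT z:halfspace|lborel. f z powr r) \<le> (LINT z:halfspace|lborel. (1 - \<epsilon>) powr (- \<kappa>) * N (z + (1, 0)) powr (- \<kappa>))"
      using upper by (intro set_integral_mono int2 int1) auto
    also have "\<dots> = (1 - \<epsilon>) powr (- \<kappa>) * I0" using shifted_norm_integrals(6) by simp
    finally have "(LINT z:halfspace|lborel. f z powr r) powr ((1 - \<theta>) / r) \<le> ((1 - \<epsilon>) powr (- \<kappa>) * I0) powr ((1 - \<theta>) / r)"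
      using exponents(9) r by (intro powr_mono2) (auto simp: set_lebesgue_integral_def intro!: Bochner_Integration.integral_nonneg)
    then show ?thesis unfolding interior_term_def r_def[symmetric] eqs(4) exponents(13) by simp
  qed
  have tpos: "0 < trace_term p a f"
    using B shifted_norm_integrals(4) exponents(4) \<epsilon> by (elim less_le_trans[rotated]) simp
  have nn: "0 \<le> gradient_term N p \<theta> f" "0 \<le> interior_term p a \<theta> f" by (auto simp: gradient_term_def interior_term_def)
  show D0: "0 \<le> D'"
  proof (rule ccontr)
    assume "\<not> 0 \<le> D'"
    then have "D' * gradient_term N p \<theta> f * interior_term p a \<theta> f \<le> 0" using nn by (intro mult_nonpos_nonneg) auto
    then show False using ineq tpos by linarith
  qed
  have "D' * gradient_term N p \<theta> f * interior_term p a \<theta> f \<le>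
    D' * ((1 + \<epsilon>) powr p * (1 - \<epsilon>) powr (- \<kappa>) * (s powr p * I0)) powr (\<theta> / p) *
     ((1 - \<epsilon>) powr (- \<kappa>) * I0) powr ((1 - \<theta>) / r)"
    using \<Gamma> I nn D0 by (intro mult_mono mult_left_mono mult_nonneg_nonneg) auto
  then show "((1 + \<epsilon>) powr (- \<kappa>) * ((\<kappa> - n) * I0)) powr (1 / r) \<le>
    D' * ((1 + \<epsilon>) powr p * (1 - \<epsilon>) powr (- \<kappa>) * (s powr p * I0)) powr (\<theta> / p) *
     ((1 - \<epsilon>) powr (- \<kappa>) * I0) powr ((1 - \<theta>) / r)"
    using B ineq by linarith
qed

text \<open>As \<open>\<epsilon>\<close> tends to 0, the tested inequality becomes the inequality
  for the extremal function, although that function itself may fail to be smooth. There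
  \<open>sharp_const\<close> gives equality, and the common positive factor can be
  cancelled.\<close>

lemma sharp_const_optimal:
  assumes D': "trace_GN_inequality N p a \<theta> D'"
  shows "sharp_const \<le> D'"
proof -
  let ?L = "\<lambda>\<epsilon>. ((1 + \<epsilon>) powr (- \<kappa>) * ((\<kappa> - n) * I0)) powr (1 / r)"
  let ?R = "\<lambda>\<epsilon>. D' * ((1 + \<epsilon>) powr p * (1 - \<epsilon>) powr (- \<kappa>) * (s powr p * I0)) powr (\<theta> / p) *
     ((1 - \<epsilon>) powr (- \<kappa>) * I0) powr ((1 - \<theta>) / r)"
  have pos: "0 < I0" "0 < \<kappa> - n" "0 < s powr p" using shifted_norm_integrals(4) exponents by auto
  have "(?L \<longlongrightarrow> ?L 0) (at_right 0)" "(?R \<longlongrightarrow> ?R 0) (at_right 0)"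
    using pos by (intro tendsto_intros; simp)+
  moreover have "\<forall>\<^sub>F \<epsilon> in at_right 0. ?L \<epsilon> \<le> ?R \<epsilon>"
  proof -
    have "\<forall>\<^sub>F \<epsilon> in at_right 0. 0 < \<epsilon> \<and> \<epsilon> < (1::real)"
      by (auto simp: eventually_at_right_field intro!: exI[of _ 1])
    then show ?thesis by (rule eventually_mono) (use trace_GN_approx(2)[OF D'] in blast)
  qed
  ultimately have "?L 0 \<le> ?R 0" by (intro tendsto_le[of "at_right 0"]) auto
  then have "sharp_const * ((s powr p * I0) powr (\<theta> / p) * I0 powr ((1 - \<theta>) / r)) \<le>
    D' * ((s powr p * I0) powr (\<theta> / p) * I0 powr ((1 - \<theta>) / r))"
    using sharp_const_extremal by (simp add: mult.assoc)
  then show ?thesis using pos by (subst (asm) mult_le_cancel_right_pos) auto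
qed

end

theorem theorem17:
  fixes N :: "real \<times> (real ^ 'm) \<Rightarrow> real"
    and n :: nat and p a :: real
  assumes "n = DIM(real \<times> (real ^ 'm))"
    and "n \<ge> 2"
    and "is_norm N"
    and "1 < p" and "p < real n" and "real n \<le> a"
  shows "\<exists>\<theta>. \<theta> \<in> {0..1} \<and> (\<forall>t. theta_equation n p a t \<longleftrightarrow> t = \<theta>) \<and>
    (\<exists>D. trace_GN_inequality N p a \<theta> D \<and>
         (\<forall>D'. trace_GN_inequality N p a \<theta> D' \<longrightarrow> D \<le> D') \<and>
         well_defined N p a (extremal N p a) \<and>
         trace_term p a (extremal N p a) =
           D * gradient_term N p \<theta> (extremal N p a) * interior_term p a \<theta> (extremal N p a))"
proof -
  interpret trace_setting N n p a
    by unfold_locales (use assms in auto)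
  show ?thesis
  proof (intro exI conjI allI impI)
    show "\<theta> \<in> {0..1}" using exponents(8,9) by simp
    show "theta_equation n p a t \<longleftrightarrow> t = \<theta>" for t by (rule theta_equation_iff)
    show "trace_GN_inequality N p a \<theta> sharp_const" by (rule trace_GN)
    show "sharp_const \<le> D'" if "trace_GN_inequality N p a \<theta> D'" for D'
      using that by (rule sharp_const_optimal)
    show "well_defined N p a (extremal N p a)" by (rule extremal_terms(1))
    show "trace_term p a (extremal N p a) = sharp_const * gradient_term N p \<theta> (extremal N p a) *
        interior_term p a \<theta> (extremal N p a)"
      unfolding extremal_terms(2-4) by (rule sharp_const_extremal)
  qed
qed

end
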